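(* Let $X$ be an irreducible SFT, $x_0\in X$ and $p$ a prime. The map $\Upsilon_p:\mathrm{Aut}(X)\to\mathrm{GL}(H^1(G_{X,x_0},\mathbb{F}_p))$ is a group homomorphism.
   Context: A shift space over a finite alphabet $\mathcal{A}$ is a nonempty closed shift-invariant subset $X\subseteq\mathcal{A}^{\mathbb{Z}}$ (product topology), with shift map $\sigma_X$. It is a shift of finite type (SFT) if it is defined by a finite set of forbidden words, and irreducible if for all words $u,v$ occurring in points of $X$ there is a nonempty word $w$ with $uwv$ occurring in a point of $X$. A sliding block code is a continuous shift-commuting map; a factor map is a surjective one; a topological conjugacy is a bijective one; $\mathrm{Aut}(X)$ is the group of topological conjugacies $X\to X$. For irreducible SFTs $X,Y$, a factor map $\varpi:Y\to X$ is unramified if there is an integer $d\ge1$ with $|\varpi^{-1}(x)|=d$ for all $x\in X$; $\deg(\varpi)=d$. Put $\mathrm{Aut}(Y/X,\varpi)=\{\varphi\in\mathrm{Aut}(Y)\mid\varpi\circ\varphi=\varpi\}$. The map $\varpi$ is a Galois factor if it is unramified and $|\mathrm{Aut}(Y/X,\varpi)|=\deg(\varpi)$; then $\mathrm{Gal}(Y/X,\varpi):=\mathrm{Aut}(Y/X,\varpi)$. Absolute Galois group. Let $X$ be an irreducible SFT and $x_0\in X$. A pointed Galois factor over $(X,x_0)$ is a triple $(Y,y_0,\varpi)$ with $Y$ an irreducible SFT, $y_0\in Y$ and $\varpi:Y\to X$ a Galois factor with $\varpi(y_0)=x_0$. Two of them, $(Y,y_0,\varpi)$ and $(Y',y_0',\varpi')$,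 are equivalent if there is a topological conjugacy $\gamma:Y\to Y'$ with $\gamma(y_0)=y_0'$ and $\varpi=\varpi'\circ\gamma$; $\mathcal{I}(X,x_0)$ is the set of equivalence classes. Fix a representative $(Y_i,y_{i,0},\varpi_i)$ of each $i\in\mathcal{I}(X,x_0)$ and set $G_i=\mathrm{Gal}(Y_i/X,\varpi_i)$. Write $i\le j$ if there is an unramified factor map $\alpha_{ij}:Y_j\to Y_i$ with $\alpha_{ij}(y_{j,0})=y_{i,0}$ and $\varpi_j=\varpi_i\circ\alpha_{ij}$; such a map is unique, and $\le$ is a directed partial order. For $i\le j$ and $\varphi\in G_j$, $p_{ij}(\varphi)$ is the unique element of $G_i$ with $p_{ij}(\varphi)\circ\alpha_{ij}=\alpha_{ij}\circ\varphi$. The absolute Galois group is the profinite group $G_{X,x_0}=\varprojlim_{i}G_i$ with respect to the maps $p_{ij}$ (each $G_i$ discrete). For $g=(g_i)_i\in G_{X,x_0}$ and any pointed Galois factor $(Y,y,\varpi)$ over $(X,x_0)$, of class $i$, with $\theta:Y_i\to Y$ the unique topological conjugacy satisfying $\theta(y_{i,0})=y$ and $\varpi_i=\varpi\circ\theta$, write $g_{(Y,y,\varpi)}=\theta\circ g_i\circ\theta^{-1}\in\mathrm{Gal}(Y/X,\varpi)$. The representation $\Upsilon_p$. For $x\in X$ let $F(x)=\varprojlim_{i\in\mathcal{I}(X,x_0)}\varpi_i^{-1}(x)$ with transition maps the restrictions of $\alpha_{ij}$ (nonempty). For $f\in\mathrm{Aut}(X)$ and $\xi=(\xi_i)_i\in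 F(f(x_0))$, the automorphism $\beta_{f,\xi}$ of $G_{X,x_0}$ is defined by $\beta_{f,\xi}(g)_i=g_{(Y_i,\xi_i,f^{-1}\circ\varpi_i)}$ (note $\mathrm{Gal}(Y_i/X,f^{-1}\circ\varpi_i)=\mathrm{Gal}(Y_i/X,\varpi_i)$). Up to inner automorphisms it does not depend on $\xi$. For a prime $p$, with $\mathbb{F}_p$ discrete and with trivial action, $H^1(G_{X,x_0},\mathbb{F}_p)=\mathrm{Hom}_{\mathrm{cont}}(G_{X,x_0},\mathbb{F}_p)$, an $\mathbb{F}_p$-vector space, and $\Upsilon_p(f)(\chi)=\chi\circ\beta_{f,\xi}^{-1}$ (a linear automorphism, independent of $\xi$). *)

theory Defs
  imports "HOL-Analysis.Analysis" "HOL-Algebra.Product_Groups" "HOL-Algebra.Bij" "HOL-Number_Theory.Residues"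
begin

text \<open>
  Points are bi-infinite sequences \<open>int \<Rightarrow> 'a\<close>.  Maps between sets of points are extensional
  functions (value \<open>undefined\<close> off the domain), so that equality of HOL functions is equality of
  maps, and they are composed with \<^const>\<open>compose\<close>.
\<close>

section \<open>Shift spaces and sliding block codes\<close>

definition shift_map :: "(int \<Rightarrow> 'a) \<Rightarrow> int \<Rightarrow> 'a" where
  "shift_map x = (\<lambda>n. x (n + 1))"

definition shift_space :: "(int \<Rightarrow> 'a) set \<Rightarrow> bool" where
  "shift_space X \<longleftrightarrow> X \<noteq> {} \<and> shift_map ` X = X \<and>
     (\<exists>A. finite A \<and> closedin (product_topology (\<lambda>_::int. discrete_topology A) UNIV) X)"

definition occurs_in :: "'a list \<Rightarrow> (int \<Rightarrow> 'a) \<Rightarrow> bool" where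
  "occurs_in w x \<longleftrightarrow> (\<exists>n. \<forall>k < length w. x (n + int k) = w ! k)"

definition shift_language :: "(int \<Rightarrow> 'a) set \<Rightarrow> 'a list set" where
  "shift_language X = {w. \<exists>x\<in>X. occurs_in w x}"

definition shift_of_finite_type :: "(int \<Rightarrow> 'a) set \<Rightarrow> bool" where
  "shift_of_finite_type X \<longleftrightarrow> shift_space X \<and>
     (\<exists>A F. finite A \<and> finite F \<and> F \<subseteq> lists A \<and>
        X = {x. range x \<subseteq> A \<and> (\<forall>w\<in>F. \<not> occurs_in w x)})"

definition irreducible_shift :: "(int \<Rightarrow> 'a) set \<Rightarrow> bool" where
  "irreducible_shift X \<longleftrightarrow>
     (\<forall>u\<in>shift_language X. \<forall>v\<in>shift_language X. \<exists>w. w \<noteq> [] \<and> u @ w @ v \<in> shift_language X)"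

definition irreducible_SFT :: "(int \<Rightarrow> 'a) set \<Rightarrow> bool" where
  "irreducible_SFT X \<longleftrightarrow> shift_of_finite_type X \<and> irreducible_shift X"

definition shift_topology :: "(int \<Rightarrow> 'a) set \<Rightarrow> (int \<Rightarrow> 'a) topology" where
  "shift_topology X = subtopology (product_topology (\<lambda>_. discrete_topology UNIV) UNIV) X"

text \<open>The topology on a shift space does not depend on the ambient alphabet.\<close>

lemma shift_topology_alphabet:
  assumes "X \<subseteq> (UNIV \<rightarrow>\<^sub>E A)"
  shows "shift_topology X = subtopology (product_topology (\<lambda>_. discrete_topology A) UNIV) X"
proof -
  have "subtopology (product_topology (\<lambda>_::int. discrete_topology UNIV) UNIV) (UNIV \<rightarrow>\<^sub>E A)
      = product_topology (\<lambda>_. discrete_topology A) UNIV"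
    by (simp add: subtopology_product_topology)
  then show ?thesis
    using assms unfolding shift_topology_def
    by (metis inf.absorb_iff2 subtopology_subtopology)
qed

definition sliding_block_code ::
    "(int \<Rightarrow> 'a) set \<Rightarrow> (int \<Rightarrow> 'b) set \<Rightarrow> ((int \<Rightarrow> 'a) \<Rightarrow> (int \<Rightarrow> 'b)) \<Rightarrow> bool" where
  "sliding_block_code X Y f \<longleftrightarrow> f \<in> extensional X \<and>
     continuous_map (shift_topology X) (shift_topology Y) f \<and>
     (\<forall>x\<in>X. f (shift_map x) = shift_map (f x))"

definition factor_map ::
    "(int \<Rightarrow> 'a) set \<Rightarrow> (int \<Rightarrow> 'b) set \<Rightarrow> ((int \<Rightarrow> 'a) \<Rightarrow> (int \<Rightarrow> 'b)) \<Rightarrow> bool" where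
  "factor_map Y X f \<longleftrightarrow> sliding_block_code Y X f \<and> f ` Y = X"

definition conjugacy ::
    "(int \<Rightarrow> 'a) set \<Rightarrow> (int \<Rightarrow> 'b) set \<Rightarrow> ((int \<Rightarrow> 'a) \<Rightarrow> (int \<Rightarrow> 'b)) \<Rightarrow> bool" where
  "conjugacy X Y f \<longleftrightarrow> sliding_block_code X Y f \<and> bij_betw f X Y"

definition Aut_shift :: "(int \<Rightarrow> 'a) set \<Rightarrow> ((int \<Rightarrow> 'a) \<Rightarrow> (int \<Rightarrow> 'a)) monoid" where
  "Aut_shift X = BijGroup X \<lparr>carrier := {f. conjugacy X X f}\<rparr>"


section \<open>Unramified and Galois factors\<close>

definition fibre ::
    "(int \<Rightarrow> 'a) set \<Rightarrow> ((int \<Rightarrow> 'a) \<Rightarrow> (int \<Rightarrow> 'b)) \<Rightarrow> (int \<Rightarrow> 'b) \<Rightarrow> (int \<Rightarrow> 'a) set" where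
  "fibre Y f x = {y\<in>Y. f y = x}"

text \<open>Since \<^const>\<open>card\<close> of an infinite set is 0, the condition \<open>d \<ge> 1\<close> forces finite fibres.\<close>

definition unramified ::
    "(int \<Rightarrow> 'a) set \<Rightarrow> (int \<Rightarrow> 'b) set \<Rightarrow> ((int \<Rightarrow> 'a) \<Rightarrow> (int \<Rightarrow> 'b)) \<Rightarrow> bool" where
  "unramified Y X f \<longleftrightarrow> factor_map Y X f \<and> (\<exists>d\<ge>1. \<forall>x\<in>X. card (fibre Y f x) = d)"

definition factor_degree ::
    "(int \<Rightarrow> 'a) set \<Rightarrow> (int \<Rightarrow> 'b) set \<Rightarrow> ((int \<Rightarrow> 'a) \<Rightarrow> (int \<Rightarrow> 'b)) \<Rightarrow> nat" where
  "factor_degree Y X f = (THE d. \<forall>x\<in>X. card (fibre Y f x) = d)"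

definition Gal ::
    "(int \<Rightarrow> 'a) set \<Rightarrow> ((int \<Rightarrow> 'a) \<Rightarrow> (int \<Rightarrow> 'b)) \<Rightarrow> ((int \<Rightarrow> 'a) \<Rightarrow> (int \<Rightarrow> 'a)) monoid" where
  "Gal Y f = (Aut_shift Y) \<lparr>carrier := {\<phi> \<in> carrier (Aut_shift Y). compose Y f \<phi> = f}\<rparr>"

definition Galois_factor ::
    "(int \<Rightarrow> 'a) set \<Rightarrow> (int \<Rightarrow> 'b) set \<Rightarrow> ((int \<Rightarrow> 'a) \<Rightarrow> (int \<Rightarrow> 'b)) \<Rightarrow> bool" where
  "Galois_factor Y X f \<longleftrightarrow> unramified Y X f \<and> card (carrier (Gal Y f)) = factor_degree Y X f"


section \<open>The absolute Galois group\<close>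

text \<open>
  The alphabet of a cover is a finite set of natural numbers.  Renaming symbols is a topological
  conjugacy, so every equivalence class of pointed Galois factors over arbitrary finite alphabets
  has a member of this form, and the classes form a set.
\<close>

record 'a pointed_cover =
  total_space :: "(int \<Rightarrow> nat) set"
  base_point :: "int \<Rightarrow> nat"
  covering :: "(int \<Rightarrow> nat) \<Rightarrow> (int \<Rightarrow> 'a)"

definition pointed_Galois_factors ::
    "(int \<Rightarrow> 'a) set \<Rightarrow> (int \<Rightarrow> 'a) \<Rightarrow> 'a pointed_cover set" where
  "pointed_Galois_factors X x0 =
     {t. irreducible_SFT (total_space t) \<and> base_point t \<in> total_space t \<and>
         Galois_factor (total_space t) X (covering t) \<and> covering t (base_point t) = x0}"

definition pointed_conjugacy ::
    "'a pointed_cover \<Rightarrow> 'a pointed_cover \<Rightarrow> ((int \<Rightarrow> nat) \<Rightarrow> (int \<Rightarrow> nat)) \<Rightarrow> bool" where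
  "pointed_conjugacy s t \<gamma> \<longleftrightarrow> conjugacy (total_space s) (total_space t) \<gamma> \<and>
     \<gamma> (base_point s) = base_point t \<and>
     covering s = compose (total_space s) (covering t) \<gamma>"

definition pointed_equiv ::
    "(int \<Rightarrow> 'a) set \<Rightarrow> (int \<Rightarrow> 'a) \<Rightarrow> ('a pointed_cover \<times> 'a pointed_cover) set" where
  "pointed_equiv X x0 =
     {(s, t). s \<in> pointed_Galois_factors X x0 \<and> t \<in> pointed_Galois_factors X x0 \<and>
              (\<exists>\<gamma>. pointed_conjugacy s t \<gamma>)}"

definition Galois_classes ::
    "(int \<Rightarrow> 'a) set \<Rightarrow> (int \<Rightarrow> 'a) \<Rightarrow> 'a pointed_cover set set" where
  "Galois_classes X x0 = pointed_Galois_factors X x0 // pointed_equiv X x0"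

text \<open>
  From here on \<open>R\<close> is a choice of representatives: \<open>R i \<in> i\<close> for every class \<open>i\<close>.
\<close>

type_synonym 'a reps = "'a pointed_cover set \<Rightarrow> 'a pointed_cover"

definition is_transition ::
    "'a reps \<Rightarrow> 'a pointed_cover set \<Rightarrow> 'a pointed_cover set
       \<Rightarrow> ((int \<Rightarrow> nat) \<Rightarrow> (int \<Rightarrow> nat)) \<Rightarrow> bool" where
  "is_transition R i j \<alpha> \<longleftrightarrow>
     unramified (total_space (R j)) (total_space (R i)) \<alpha> \<and>
     \<alpha> (base_point (R j)) = base_point (R i) \<and>
     covering (R j) = compose (total_space (R j)) (covering (R i)) \<alpha>"

definition class_le :: "'a reps \<Rightarrow> 'a pointed_cover set \<Rightarrow> 'a pointed_cover set \<Rightarrow> bool" where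
  "class_le R i j \<longleftrightarrow> (\<exists>\<alpha>. is_transition R i j \<alpha>)"

definition transition ::
    "'a reps \<Rightarrow> 'a pointed_cover set \<Rightarrow> 'a pointed_cover set
       \<Rightarrow> (int \<Rightarrow> nat) \<Rightarrow> (int \<Rightarrow> nat)" where
  "transition R i j = (THE \<alpha>. is_transition R i j \<alpha>)"

definition rep_Gal ::
    "'a reps \<Rightarrow> 'a pointed_cover set \<Rightarrow> ((int \<Rightarrow> nat) \<Rightarrow> (int \<Rightarrow> nat)) monoid" where
  "rep_Gal R i = Gal (total_space (R i)) (covering (R i))"

definition Gal_transition ::
    "'a reps \<Rightarrow> 'a pointed_cover set \<Rightarrow> 'a pointed_cover set
       \<Rightarrow> ((int \<Rightarrow> nat) \<Rightarrow> (int \<Rightarrow> nat)) \<Rightarrow> (int \<Rightarrow> nat) \<Rightarrow> (int \<Rightarrow> nat)" where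
  "Gal_transition R i j \<phi> =
     (THE \<psi>. \<psi> \<in> carrier (rep_Gal R i) \<and>
        compose (total_space (R j)) \<psi> (transition R i j) =
        compose (total_space (R j)) (transition R i j) \<phi>)"

type_synonym 'a Galois_thread = "'a pointed_cover set \<Rightarrow> (int \<Rightarrow> nat) \<Rightarrow> (int \<Rightarrow> nat)"

definition absolute_Galois ::
    "(int \<Rightarrow> 'a) set \<Rightarrow> (int \<Rightarrow> 'a) \<Rightarrow> 'a reps \<Rightarrow> 'a Galois_thread monoid" where
  "absolute_Galois X x0 R =
     (product_group (Galois_classes X x0) (rep_Gal R))
       \<lparr>carrier := {g \<in> \<Pi>\<^sub>E i\<in>Galois_classes X x0. carrier (rep_Gal R i).
          \<forall>i\<in>Galois_classes X x0. \<forall>j\<in>Galois_classes X x0.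
            class_le R i j \<longrightarrow> Gal_transition R i j (g j) = g i}\<rparr>"

definition Galois_topology ::
    "(int \<Rightarrow> 'a) set \<Rightarrow> (int \<Rightarrow> 'a) \<Rightarrow> 'a reps \<Rightarrow> 'a Galois_thread topology" where
  "Galois_topology X x0 R =
     subtopology
       (product_topology (\<lambda>i. discrete_topology (carrier (rep_Gal R i))) (Galois_classes X x0))
       (carrier (absolute_Galois X x0 R))"

text \<open>The component of \<open>g\<close> at an arbitrary pointed Galois factor \<open>t\<close>, in the group of \<open>t\<close>.\<close>

definition component_at ::
    "(int \<Rightarrow> 'a) set \<Rightarrow> (int \<Rightarrow> 'a) \<Rightarrow> 'a reps \<Rightarrow> 'a Galois_thread \<Rightarrow> 'a pointed_cover
       \<Rightarrow> (int \<Rightarrow> nat) \<Rightarrow> (int \<Rightarrow> nat)" where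
  "component_at X x0 R g t =
     (let i = pointed_equiv X x0 `` {t};
          \<theta> = (THE \<theta>. pointed_conjugacy (R i) t \<theta>)
      in compose (total_space t) \<theta>
           (compose (total_space t) (g i) (inv_into (total_space (R i)) \<theta>)))"


section \<open>The representation\<close>

definition limit_fibre ::
    "(int \<Rightarrow> 'a) set \<Rightarrow> (int \<Rightarrow> 'a) \<Rightarrow> 'a reps \<Rightarrow> (int \<Rightarrow> 'a)
       \<Rightarrow> ('a pointed_cover set \<Rightarrow> int \<Rightarrow> nat) set" where
  "limit_fibre X x0 R x =
     {\<xi> \<in> \<Pi>\<^sub>E i\<in>Galois_classes X x0. fibre (total_space (R i)) (covering (R i)) x.
        \<forall>i\<in>Galois_classes X x0. \<forall>j\<in>Galois_classes X x0.
          class_le R i j \<longrightarrow> transition R i j (\<xi> j) = \<xi> i}"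

definition Galois_beta ::
    "(int \<Rightarrow> 'a) set \<Rightarrow> (int \<Rightarrow> 'a) \<Rightarrow> 'a reps \<Rightarrow> ((int \<Rightarrow> 'a) \<Rightarrow> (int \<Rightarrow> 'a))
       \<Rightarrow> ('a pointed_cover set \<Rightarrow> int \<Rightarrow> nat) \<Rightarrow> 'a Galois_thread \<Rightarrow> 'a Galois_thread" where
  "Galois_beta X x0 R f \<xi> =
     (\<lambda>g\<in>carrier (absolute_Galois X x0 R). \<lambda>i\<in>Galois_classes X x0.
        component_at X x0 R g
          \<lparr>total_space = total_space (R i), base_point = \<xi> i,
           covering = compose (total_space (R i)) (inv_into X f) (covering (R i))\<rparr>)"

text \<open>
  The cohomology group as a module over \<^term>\<open>residue_ring (int p)\<close>; the multiplication and unit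
  fields of the \<open>module\<close> record play no role.
\<close>

definition Galois_H1 ::
    "(int \<Rightarrow> 'a) set \<Rightarrow> (int \<Rightarrow> 'a) \<Rightarrow> 'a reps \<Rightarrow> nat
       \<Rightarrow> (int, 'a Galois_thread \<Rightarrow> int) module" where
  "Galois_H1 X x0 R p =
     (let G = absolute_Galois X x0 R; K = residue_ring (int p)
      in \<lparr>carrier = {\<eta> \<in> extensional (carrier G). \<eta> \<in> hom G (add_monoid K) \<and>
             continuous_map (Galois_topology X x0 R) (discrete_topology (carrier K)) \<eta>},
          monoid.mult = undefined, one = undefined,
          zero = (\<lambda>g\<in>carrier G. \<zero>\<^bsub>K\<^esub>),
          add = (\<lambda>\<eta> \<psi>. \<lambda>g\<in>carrier G. \<eta> g \<oplus>\<^bsub>K\<^esub> \<psi> g),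
          smult = (\<lambda>c \<eta>. \<lambda>g\<in>carrier G. c \<otimes>\<^bsub>K\<^esub> \<eta> g)\<rparr>)"

definition GL_module ::
    "('k, 'm) ring_scheme \<Rightarrow> ('k, 'v, 'n) module_scheme \<Rightarrow> ('v \<Rightarrow> 'v) monoid" where
  "GL_module K V = BijGroup (carrier V)
     \<lparr>carrier := {T \<in> Bij (carrier V).
        (\<forall>v\<in>carrier V. \<forall>w\<in>carrier V. T (v \<oplus>\<^bsub>V\<^esub> w) = T v \<oplus>\<^bsub>V\<^esub> T w) \<and>
        (\<forall>c\<in>carrier K. \<forall>v\<in>carrier V. T (c \<odot>\<^bsub>V\<^esub> v) = c \<odot>\<^bsub>V\<^esub> T v)}\<rparr>"

text \<open>
  The value \<open>\<eta> \<circ> \<beta>\<^sup>-\<^sup>1\<close> is the same for every \<open>\<xi>\<close> in the (nonempty) limit fibre over \<open>f x0\<close>;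
  the definite description selects this common value.
\<close>

definition Upsilon ::
    "(int \<Rightarrow> 'a) set \<Rightarrow> (int \<Rightarrow> 'a) \<Rightarrow> 'a reps \<Rightarrow> nat \<Rightarrow> ((int \<Rightarrow> 'a) \<Rightarrow> (int \<Rightarrow> 'a))
       \<Rightarrow> ('a Galois_thread \<Rightarrow> int) \<Rightarrow> ('a Galois_thread \<Rightarrow> int)" where
  "Upsilon X x0 R p f =
     (\<lambda>\<eta>\<in>carrier (Galois_H1 X x0 R p).
        THE \<psi>. \<exists>\<xi>\<in>limit_fibre X x0 R (f x0).
          \<psi> = compose (carrier (absolute_Galois X x0 R)) \<eta>
                (inv_into (carrier (absolute_Galois X x0 R)) (Galois_beta X x0 R f \<xi>)))"

end

theory Submission
  imports Defs "HOL-Library.Diagonal_Subsequence"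
begin

text \<open>
  The heart of the matter is that an unramified factor map of SFTs is a covering in a uniform sense:
  distinct points of a fibre differ on every window of some fixed length.  By a Baire category
  argument this holds for the points of \<open>X\<close> in some cylinder; irreducibility provides points that
  visit the cylinder on both sides of any given word, and splicing two points of a fibre that agree
  on a long window between two visits shows that they coincide.  Consequently points of \<open>Y\<close> can be
  lifted uniquely along left or right asymptotic points of \<open>X\<close>.  This gives the rigidity of maps
  over \<open>X\<close> (two of them that agree at one point agree everywhere), on which all canonical choices
  rest, and canonical bijections between limit fibres, so these are nonempty.

  Given \<open>f\<close> and \<open>\<xi>\<close>, the cover \<open>(Y\<^sub>i, \<xi>\<^sub>i, f\<^sup>-\<^sup>1 \<circ> \<varpi>\<^sub>i)\<close> is isomorphic to some representative
  \<open>Y\<^sub>k\<close> by a conjugacy \<open>\<theta>\<close> over \<open>f\<close>, and \<open>\<beta>(g)\<^sub>i = \<theta> g\<^sub>k \<theta>\<^sup>-\<^sup>1\<close>.  Composing such conjugacies gives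
  \<open>\<beta>\<close> of a composite as the composite of the \<open>\<beta>\<close>'s for a suitable thread, and a change of thread
  changes \<open>\<beta>\<close> by an inner automorphism, which characters with values in an abelian group do not see.
\<close>

section \<open>Sequences, gluing and block codes\<close>

text \<open>Constant cardinality of the fibres is what makes the covering argument work: once the
  points of nearby fibres stay apart on a fixed finite window, their limits are distinct, and by
  counting they fill the fibre over the limit point. Separation by a window thus becomes a closed
  condition, which Baire category can use.

  Elements of inverse limits over all classes are never built by compactness. Each component is
  chosen on its own, and compatibility is then forced: the two sides of a compatibility condition
  lie over the same point of \<open>X\<close> and agree far out, or they are maps over
  \<open>X\<close> that agree at one point. The thread of base points is the only one given at the
  start.

  The inverse of \<open>\<beta>\<close> in the definition of \<open>Upsilon\<close> is awkward, as
  its continuity and its dependence on the thread are not visible. It is traded for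
  \<open>\<beta>\<close> of the inverse automorphism: both composites of the two are values of
  \<open>\<beta>\<close> at the identity, hence inner, and characters cannot tell the two candidates
  apart.\<close>

definition converges_to :: "(nat \<Rightarrow> 'j \<Rightarrow> 'a) \<Rightarrow> ('j \<Rightarrow> 'a) \<Rightarrow> bool" where
  "converges_to s y \<longleftrightarrow> (\<forall>j. \<forall>\<^sub>F n in sequentially. s n j = y j)"

lemma converges_to_finite:
  assumes "converges_to s y" "finite S"
  shows "\<forall>\<^sub>F n in sequentially. \<forall>j\<in>S. s n j = y j"
  using assms by (simp add: converges_to_def eventually_ball_finite)

lemma converges_to_subseq:
  assumes "converges_to s y" "strict_mono (r :: nat \<Rightarrow> nat)"
  shows "converges_to (\<lambda>n. s (r n)) y"
  using assms eventually_subseq unfolding converges_to_def by blast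

text \<open>Sequential compactness of a countable power of a finite set, by a diagonal argument:
  stage \<open>m\<close> uses the pigeonhole principle at the coordinate \<open>from_nat m\<close>.
  The index type is left general because \<open>fibre_limit\<close> needs several points at once,
  read as one function on \<open>nat \<times> int\<close>.\<close>

lemma converges_to_subsequence_exists:
  fixes s :: "nat \<Rightarrow> 'j::countable \<Rightarrow> 'a"
  assumes "finite A" and s: "\<And>n j. s n j \<in> A"
  shows "\<exists>r y. strict_mono (r :: nat \<Rightarrow> nat) \<and> converges_to (\<lambda>n. s (r n)) y"
proof -
  interpret subseqs "\<lambda>m r. \<exists>a. \<forall>n. s (r n) (from_nat m) = a"
  proof
    fix m and t :: "nat \<Rightarrow> nat"
    have fin: "finite (range (\<lambda>n. s (t n) (from_nat m)))"
      by (rule finite_subset[OF _ \<open>finite A\<close>]) (simp add: image_subset_iff s)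
    obtain a where inf: "infinite ((\<lambda>n. s (t n) (from_nat m)) -` {a})"
      using inf_img_fin_dom[OF fin infinite_UNIV_nat] by blast
    obtain r' :: "nat \<Rightarrow> nat" where "strict_mono r'" "\<forall>n. r' n \<in> (\<lambda>n. s (t n) (from_nat m)) -` {a}"
      using infinite_enumerate[OF inf] by blast
    then show "\<exists>r' :: nat \<Rightarrow> nat. strict_mono r' \<and> (\<exists>a. \<forall>n. s ((t \<circ> r') n) (from_nat m) = a)"
      by auto
  qed
  \<comment> \<open>From \<open>Suc m\<close> on, the diagonal runs inside the subsequence picked at
    stage \<open>m\<close>, so the coordinate \<open>from_nat m\<close> has settled there.\<close>
  define a where "a m = s (diagseq (Suc m)) (from_nat m)" for m
  have a: "s (diagseq (Suc m + n)) (from_nat m) = a m" for m n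
  proof -
    have "\<exists>b. \<forall>n. s ((diagseq \<circ> (+) (Suc m)) n) (from_nat m) = b"
      by (rule diagseq_holds) (unfold comp_def, blast)
    then obtain b where b: "\<And>n. s (diagseq (Suc m + n)) (from_nat m) = b"
      unfolding comp_def by blast
    show ?thesis using b[of n] b[of 0] by (simp add: a_def)
  qed
  have "converges_to (\<lambda>n. s (diagseq n)) (\<lambda>j. a (to_nat j))"
    unfolding converges_to_def
  proof
    fix j
    show "\<forall>\<^sub>F n in sequentially. s (diagseq n) j = a (to_nat j)"
      unfolding eventually_sequentially
    proof (intro exI allI impI)
      fix n assume "Suc (to_nat j) \<le> n"
      then show "s (diagseq n) j = a (to_nat j)"
        using a[of "to_nat j" "n - Suc (to_nat j)"] by simp
    qed
  qed
  then show ?thesis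
    using subseq_diagseq by blast
qed

section \<open>Integer shifts, closedness and splicing in shifts of finite type\<close>

definition shift_by :: "int \<Rightarrow> (int \<Rightarrow> 'a) \<Rightarrow> int \<Rightarrow> 'a" where
  "shift_by m x = (\<lambda>k. x (k + m))"

lemma shift_by_apply [simp]: "shift_by m x k = x (k + m)"
  by (simp add: shift_by_def)

lemma shift_by_shift_by [simp]: "shift_by m (shift_by n x) = shift_by (m + n) x"
  by (auto simp: shift_by_def ac_simps)

lemma shift_by_0 [simp]: "shift_by 0 x = x"
  by (simp add: shift_by_def)

lemma shift_map_eq_shift_by: "shift_map = shift_by 1"
  by (auto simp: shift_map_def shift_by_def)

text \<open>Backward shifts stay in \<open>X\<close> because \<open>shift_map\<close> maps
  \<open>X\<close> onto \<open>X\<close> and is injective on sequences: a preimage in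
  \<open>X\<close> of a point can only be its backward shift.\<close>

lemma shift_space_shift_by:
  assumes "shift_space X" "x \<in> X"
  shows "shift_by m x \<in> X"
proof -
  have X: "shift_by 1 ` X = X"
    using assms by (simp add: shift_space_def shift_map_eq_shift_by)
  have pos: "shift_by (int n) z \<in> X" if "z \<in> X" for n z
  proof (induction n)
    case (Suc n)
    have "shift_by 1 (shift_by (int n) z) \<in> X" using X Suc by blast
    then show ?case by (simp del: shift_by_apply)
  qed (use that in simp)
  have neg: "shift_by (- int n) z \<in> X" if "z \<in> X" for n z
  proof (induction n)
    case (Suc n)
    then obtain u where "u \<in> X" "shift_by (- int n) z = shift_by 1 u" using X by blast
    then have "shift_by (-1) (shift_by (- int n) z) = u" by simp
    with \<open>u \<in> X\<close> show ?case by simp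
  qed (use that in simp)
  show ?thesis
    using pos[OF assms(2), of "nat m"] neg[OF assms(2), of "nat (-m)"] by (cases "m \<ge> 0") auto
qed

lemma sft_shift_space: "shift_of_finite_type X \<Longrightarrow> shift_space X"
  by (simp add: shift_of_finite_type_def)

lemma sft_alphabet:
  assumes "shift_of_finite_type X"
  shows "\<exists>A. finite A \<and> (\<forall>x\<in>X. \<forall>k. x k \<in> A)"
  using assms unfolding shift_of_finite_type_def by blast

text \<open>An occurrence of a forbidden word involves finitely many coordinates, so it would
  already be present in a late term of the sequence.\<close>

lemma sft_converges_to:
  assumes "shift_of_finite_type X" and s: "\<And>n. s n \<in> X" and y: "converges_to s y"
  shows "y \<in> X"
proof -
  obtain A F where X: "X = {x. range x \<subseteq> A \<and> (\<forall>w\<in>F. \<not> occurs_in w x)}"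
    using assms(1) unfolding shift_of_finite_type_def by blast
  have "y k \<in> A" for k
  proof -
    obtain n where "s n k = y k"
      using y eventually_happens'[OF sequentially_bot] unfolding converges_to_def by blast
    moreover have "s n k \<in> A" using s[of n] by (auto simp: X)
    ultimately show ?thesis by simp
  qed
  moreover have "\<not> occurs_in w y" if w: "w \<in> F" for w
  proof
    assume "occurs_in w y"
    then obtain a where a: "\<forall>k<length w. y (a + int k) = w ! k"
      by (auto simp: occurs_in_def)
    have "\<forall>\<^sub>F n in sequentially. \<forall>j\<in>(\<lambda>k. a + int k) ` {..<length w}. s n j = y j"
      by (rule converges_to_finite[OF y]) simp
    then obtain n where "\<forall>j\<in>(\<lambda>k. a + int k) ` {..<length w}. s n j = y j"
      using eventually_happens'[OF sequentially_bot] by blast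
    then have "occurs_in w (s n)" using a by (auto simp: occurs_in_def)
    then show False using s[of n] w by (simp add: X)
  qed
  ultimately show ?thesis by (auto simp: X)
qed

text \<open>\<open>M\<close> bounds the lengths of the forbidden words. One that starts before
  \<open>n\<close> ends before \<open>n + M\<close>, so it is read entirely in \<open>x\<close>,
  since \<open>x\<close> and \<open>y\<close> agree on the overlap; one that starts later is read
  entirely in \<open>y\<close>.\<close>

lemma sft_splice:
  assumes "shift_of_finite_type X"
  shows "\<exists>M::nat. \<forall>x\<in>X. \<forall>y\<in>X. \<forall>n.
    (\<forall>k. n \<le> k \<and> k < n + int M \<longrightarrow> x k = y k) \<longrightarrow> (\<lambda>k. if k < n then x k else y k) \<in> X"
proof -
  obtain A F where X: "X = {x. range x \<subseteq> A \<and> (\<forall>w\<in>F. \<not> occurs_in w x)}" and "finite F"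
    using assms(1) unfolding shift_of_finite_type_def by blast
  define M where "M = Max (insert 0 (length ` F))"
  have M: "length w \<le> M" if "w \<in> F" for w
    unfolding M_def using \<open>finite F\<close> that by (intro Max_ge) auto
  show ?thesis
  proof (intro exI ballI allI impI)
    fix x y n
    assume x: "x \<in> X" and y: "y \<in> X" and agree: "\<forall>k. n \<le> k \<and> k < n + int M \<longrightarrow> x k = y k"
    let ?z = "\<lambda>k. if k < n then x k else y k"
    have "\<not> occurs_in w ?z" if w: "w \<in> F" for w
    proof
      assume "occurs_in w ?z"
      then obtain a where a: "\<forall>k<length w. ?z (a + int k) = w ! k"
        by (auto simp: occurs_in_def)
      show False
      proof (cases "a < n")
        case True
        have "x (a + int k) = w ! k" if "k < length w" for k
          using a[rule_format, OF that] agree[rule_format, of "a + int k"] M[OF w] that True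
          by (auto split: if_splits)
        then have "occurs_in w x" by (auto simp: occurs_in_def)
        then show False using x w by (simp add: X)
      next
        case False
        have "y (a + int k) = w ! k" if "k < length w" for k
          using a[rule_format, OF that] False by (auto split: if_splits)
        then have "occurs_in w y" by (auto simp: occurs_in_def)
        then show False using y w by (simp add: X)
      qed
    qed
    then show "?z \<in> X" using x y by (auto simp: X)
  qed
qed

text \<open>The substitute for a path from \<open>x\<close> to \<open>z\<close>. Irreducibility
  joins only finite words; choosing these long enough for \<open>sft_splice\<close> allows the left
  half of \<open>x\<close> and the right half of \<open>z\<close> to be attached afterwards.\<close>

lemma irreducible_SFT_glue:
  assumes "irreducible_SFT X" and x: "x \<in> X" and z: "z \<in> X"
  shows "\<exists>y\<in>X. \<exists>m\<ge>0. (\<forall>k\<le>0. y k = x k) \<and> (\<forall>k\<ge>0. y (m + k) = z k)"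
proof -
  have sft: "shift_of_finite_type X" and irr: "irreducible_shift X"
    using assms(1) by (auto simp: irreducible_SFT_def)
  have sh: "shift_space X" using sft by (rule sft_shift_space)
  obtain M :: nat where splice: "\<And>x y n. \<lbrakk>x \<in> X; y \<in> X; \<forall>k. n \<le> k \<and> k < n + int M \<longrightarrow> x k = y k\<rbrakk>
      \<Longrightarrow> (\<lambda>k. if k < n then x k else y k) \<in> X"
    using sft_splice[OF sft] by blast
  \<comment> \<open>\<open>M\<close> letters form the splicing window that starts at
    \<open>- M\<close>; the letter at coordinate \<open>0\<close> is the extra one, since agreement
    with \<open>x\<close> is wanted for all \<open>k \<le> 0\<close>.\<close>
  define u where "u = map (\<lambda>i. x (int i - int M)) [0..<Suc M]"
  define v where "v = map (\<lambda>i. z (int i)) [0..<Suc M]"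
  have lu: "length u = Suc M" and lv: "length v = Suc M" by (simp_all add: u_def v_def)
  have un: "u ! i = x (int i - int M)" and vn: "v ! i = z (int i)" if "i \<le> M" for i
    using that by (simp_all add: u_def v_def del: upt_Suc)
  have "occurs_in u x" unfolding occurs_in_def
    by (rule exI[of _ "- int M"]) (use un lu in auto)
  then have "u \<in> shift_language X" using x by (auto simp: shift_language_def)
  moreover have "occurs_in v z" unfolding occurs_in_def
    by (rule exI[of _ 0]) (use vn lv in auto)
  then have "v \<in> shift_language X" using z by (auto simp: shift_language_def)
  ultimately obtain w where "u @ w @ v \<in> shift_language X"
    using irr by (auto simp: irreducible_shift_def)
  then obtain p c where p: "p \<in> X"
    and pc: "\<And>k. k < length (u @ w @ v) \<Longrightarrow> p (c + int k) = (u @ w @ v) ! k"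
    by (auto simp: shift_language_def occurs_in_def)
  \<comment> \<open>Recentred: \<open>u\<close> ends at coordinate \<open>0\<close>,
    \<open>w\<close> fills \<open>1\<close> to \<open>length w\<close>, and \<open>v\<close> starts
    at \<open>m\<close>.\<close>
  define p' where "p' = shift_by (c + int M) p"
  have p': "p' \<in> X" using sh p by (simp add: p'_def shift_space_shift_by)
  define m where "m = 1 + int (length w)"
  have p'u: "p' k = x k" if "- int M \<le> k" "k \<le> 0" for k
  proof -
    have "nat (k + int M) < Suc M" using that by simp
    then have "p (c + int (nat (k + int M))) = u ! nat (k + int M)"
      using pc[of "nat (k + int M)"] lu by (simp add: nth_append del: int_nat_eq)
    moreover have "p' k = p (c + int (nat (k + int M)))"
      using that by (simp add: p'_def ac_simps)
    ultimately show ?thesis using un[of "nat (k + int M)"] that by simp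
  qed
  have p'v: "p' (m + k) = z k" if "0 \<le> k" "k \<le> int M" for k
  proof -
    have "p (c + int (Suc M + length w + nat k)) = v ! nat k"
      using pc[of "Suc M + length w + nat k"] that lu lv by (simp add: nth_append)
    moreover have "p' (m + k) = p (c + int (Suc M + length w + nat k))"
      using that by (simp add: p'_def m_def ac_simps)
    ultimately show ?thesis using vn[of "nat k"] that by simp
  qed
  define q where "q = (\<lambda>k. if k < - int M then x k else p' k)"
  have q: "q \<in> X" unfolding q_def using p'u by (intro splice x p') auto
  define y where "y = (\<lambda>k. if k < m then q k else shift_by (-m) z k)"
  have y: "y \<in> X" unfolding y_def
  proof (intro splice q shift_space_shift_by sh z allI impI)
    fix k assume k: "m \<le> k \<and> k < m + int M"
    then have "q k = p' (m + (k - m))" by (auto simp: q_def m_def)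
    also have "\<dots> = z (k - m)" using k by (intro p'v) auto
    finally show "q k = shift_by (- m) z k" by simp
  qed
  show ?thesis
  proof (intro bexI[OF _ y] exI conjI allI impI)
    show "0 \<le> m" by (simp add: m_def)
    show "y k = x k" if "k \<le> 0" for k
      using that p'u by (auto simp: y_def q_def m_def)
    show "y (m + k) = z k" if "0 \<le> k" for k
      using that by (auto simp: y_def)
  qed
qed

section \<open>Cylinders and sliding block codes\<close>

lemma topspace_shift_topology [simp]: "topspace (shift_topology X) = X"
  by (simp add: shift_topology_def)

lemma openin_shift_topology_cylinder:
  assumes "openin (shift_topology X) U" "x \<in> U"
  shows "\<exists>S. finite S \<and> (\<forall>y\<in>X. (\<forall>k\<in>S. y k = x k) \<longrightarrow> y \<in> U)"
proof -
  obtain T where T: "openin (product_topology (\<lambda>_. discrete_topology UNIV) UNIV) T" "U = T \<inter> X"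
    using assms(1) by (auto simp: shift_topology_def openin_subtopology)
  have "x \<in> T" using T(2) assms(2) by simp
  obtain V where V: "finite {i::int. V i \<noteq> UNIV}" "x \<in> Pi\<^sub>E UNIV V" "Pi\<^sub>E UNIV V \<subseteq> T"
    using bspec[OF iffD1[OF openin_product_topology_alt T(1)] \<open>x \<in> T\<close>]
    unfolding topspace_discrete_topology by auto
  show ?thesis
  proof (intro exI conjI ballI impI)
    show "finite {i. V i \<noteq> UNIV}" by (rule V(1))
    fix y assume y: "y \<in> X" "\<forall>k\<in>{i. V i \<noteq> UNIV}. y k = x k"
    have "y k \<in> V k" for k
      using V(2) y(2) by (cases "V k = UNIV") (auto simp: PiE_iff)
    then have "y \<in> T" using V(3) by (auto simp: PiE_iff)
    then show "y \<in> U" using y T by simp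
  qed
qed

lemma sliding_block_code_in:
  "\<lbrakk>sliding_block_code X Y f; x \<in> X\<rbrakk> \<Longrightarrow> f x \<in> Y"
  unfolding sliding_block_code_def continuous_map_def by auto

lemma sliding_block_code_shift_by:
  assumes X: "shift_space X" and f: "sliding_block_code X Y f" and x: "x \<in> X"
  shows "f (shift_by m x) = shift_by m (f x)"
proof -
  have f1: "f (shift_by 1 x) = shift_by 1 (f x)" if "x \<in> X" for x
    using f that by (simp add: sliding_block_code_def shift_map_eq_shift_by)
  have pos: "f (shift_by (int n) x) = shift_by (int n) (f x)" if "x \<in> X" for n x
  proof (induction n)
    case (Suc n)
    have "f (shift_by 1 (shift_by (int n) x)) = shift_by 1 (f (shift_by (int n) x))"
      by (rule f1) (simp add: X shift_space_shift_by that)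
    then show ?case using Suc by (simp del: shift_by_apply)
  qed simp
  show ?thesis
  proof (cases "m \<ge> 0")
    case True
    then show ?thesis using pos[OF x, of "nat m"] by simp
  next
    case False
    have "f (shift_by (int (nat (-m))) (shift_by m x)) = shift_by (int (nat (-m))) (f (shift_by m x))"
      by (rule pos) (simp add: X shift_space_shift_by x)
    then have "f x = shift_by (-m) (f (shift_by m x))" using False by simp
    then show ?thesis by simp
  qed
qed

text \<open>If no radius worked, pairs agreeing on larger and larger windows would have images
  differing at \<open>0\<close>. Along a subsequence both members of the pairs have the same limit,
  and near it the coordinate \<open>0\<close> of the image is constant. Commutation with shifts
  carries the radius found at \<open>0\<close> to every coordinate.\<close>

lemma Curtis_Hedlund_Lyndon:
  assumes X: "shift_of_finite_type X" and f: "sliding_block_code X Y f"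
  shows "\<exists>r::nat. \<forall>x\<in>X. \<forall>x'\<in>X. \<forall>n.
    (\<forall>k. n - int r \<le> k \<and> k \<le> n + int r \<longrightarrow> x k = x' k) \<longrightarrow> f x n = f x' n"
proof -
  have sh: "shift_space X" using X by (rule sft_shift_space)
  have cont: "continuous_map (shift_topology X) (discrete_topology UNIV) (\<lambda>x. f x 0)"
  proof -
    have "continuous_map (shift_topology Y) (discrete_topology UNIV) (\<lambda>y. y 0)"
      unfolding shift_topology_def
      by (intro continuous_map_from_subtopology continuous_map_product_projection) simp
    then show ?thesis
      using continuous_map_compose[of "shift_topology X" "shift_topology Y" f] f
      unfolding sliding_block_code_def comp_def by blast
  qed
  have "\<exists>r::nat. \<forall>x\<in>X. \<forall>x'\<in>X. (\<forall>k. - int r \<le> k \<and> k \<le> int r \<longrightarrow> x k = x' k) \<longrightarrow> f x 0 = f x' 0"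
  proof (rule ccontr)
    assume "\<not> ?thesis"
    then have "\<forall>r. \<exists>x x'. x \<in> X \<and> x' \<in> X \<and> (\<forall>k. - int r \<le> k \<and> k \<le> int r \<longrightarrow> x k = x' k) \<and> f x 0 \<noteq> f x' 0"
      by blast
    then obtain s t where st: "\<And>r. s r \<in> X" "\<And>r. t r \<in> X"
      "\<And>r k. \<lbrakk>- int r \<le> k; k \<le> int r\<rbrakk> \<Longrightarrow> s r k = t r k" "\<And>r. f (s r) 0 \<noteq> f (t r) 0"
      by metis
    obtain A where "finite A" "\<And>x k. x \<in> X \<Longrightarrow> x k \<in> A" using sft_alphabet[OF X] by blast
    then have "\<exists>q x. strict_mono (q :: nat \<Rightarrow> nat) \<and> converges_to (\<lambda>n. s (q n)) x"
      by (intro converges_to_subsequence_exists[of A]) (use st(1) in auto)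
    then obtain q :: "nat \<Rightarrow> nat" and x where q: "strict_mono q" and x: "converges_to (\<lambda>n. s (q n)) x"
      by blast
    have "x \<in> X" by (rule sft_converges_to[OF X _ x]) (use st in simp)
    have op: "openin (shift_topology X) {y \<in> X. f y 0 = f x 0}"
      using openin_continuous_map_preimage[OF cont, of "{f x 0}"] by simp
    have "\<exists>S. finite S \<and> (\<forall>y\<in>X. (\<forall>k\<in>S. y k = x k) \<longrightarrow> y \<in> {y \<in> X. f y 0 = f x 0})"
      by (rule openin_shift_topology_cylinder[OF op]) (simp add: \<open>x \<in> X\<close>)
    then obtain S where S: "finite S" "\<And>y. \<lbrakk>y \<in> X; \<forall>k\<in>S. y k = x k\<rbrakk> \<Longrightarrow> f y 0 = f x 0"
      by blast
    obtain B where B: "\<And>k. k \<in> S \<Longrightarrow> \<bar>k\<bar> \<le> B"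
      using bdd_above_finite[OF finite_imageI[OF S(1), of abs]] by (auto simp: bdd_above_def)
    have "\<forall>\<^sub>F n in sequentially. (\<forall>k\<in>S. s (q n) k = x k) \<and> nat B \<le> n"
      by (intro eventually_conj converges_to_finite[OF x S(1)] eventually_ge_at_top)
    then obtain n where n: "\<forall>k\<in>S. s (q n) k = x k" "nat B \<le> n"
      using eventually_happens'[OF sequentially_bot] by blast
    have "nat B \<le> q n" using n(2) seq_suble[OF q, of n] by simp
    have "t (q n) k = x k" if "k \<in> S" for k
    proof -
      have "\<bar>k\<bar> \<le> int (q n)" using B[OF that] \<open>nat B \<le> q n\<close> by linarith
      then show ?thesis using st(3)[of "q n" k] n(1) that by auto
    qed
    then have "f (t (q n)) 0 = f x 0" using S(2)[OF st(2)] by blast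
    then show False using S(2)[OF st(1) n(1)] st(4)[of "q n"] by simp
  qed
  then obtain r :: nat where r: "\<And>x x'. \<lbrakk>x \<in> X; x' \<in> X; \<forall>k. - int r \<le> k \<and> k \<le> int r \<longrightarrow> x k = x' k\<rbrakk> \<Longrightarrow> f x 0 = f x' 0"
    by blast
  show ?thesis
  proof (intro exI ballI allI impI)
    fix x x' n assume x: "x \<in> X" "x' \<in> X" and "\<forall>k. n - int r \<le> k \<and> k \<le> n + int r \<longrightarrow> x k = x' k"
    then have "f (shift_by n x) 0 = f (shift_by n x') 0"
      by (intro r) (auto simp: shift_space_shift_by[OF sh])
    then show "f x n = f x' n"
      using x by (simp add: sliding_block_code_shift_by[OF sh f])
  qed
qed

lemma sliding_block_code_converges_to:
  assumes X: "shift_of_finite_type X" and f: "sliding_block_code X Y f"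
    and s: "\<And>n. s n \<in> X" and x: "converges_to s x"
  shows "converges_to (\<lambda>n. f (s n)) (f x)"
proof -
  obtain r :: nat where r: "\<And>x x' n. \<lbrakk>x \<in> X; x' \<in> X; \<forall>k. n - int r \<le> k \<and> k \<le> n + int r \<longrightarrow> x k = x' k\<rbrakk> \<Longrightarrow> f x n = f x' n"
    using Curtis_Hedlund_Lyndon[OF X f] by blast
  have "x \<in> X" by (rule sft_converges_to[OF X s x])
  show ?thesis unfolding converges_to_def
  proof
    fix j
    have "\<forall>\<^sub>F n in sequentially. \<forall>k\<in>{j - int r..j + int r}. s n k = x k"
      by (rule converges_to_finite[OF x]) simp
    then show "\<forall>\<^sub>F n in sequentially. f (s n) j = f x j"
      by eventually_elim (rule r[OF s \<open>x \<in> X\<close>], simp)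
  qed
qed

section \<open>Fibres of unramified factor maps\<close>

lemma converges_to_unique:
  assumes "converges_to s x" "converges_to s y"
  shows "x = y"
proof
  fix j
  have "\<forall>\<^sub>F n in sequentially. s n j = x j \<and> s n j = y j"
    using assms unfolding converges_to_def by (intro eventually_conj) auto
  then obtain n where "s n j = x j" "s n j = y j"
    using eventually_happens'[OF sequentially_bot] by blast
  then show "x j = y j" by metis
qed

lemma converges_to_agree:
  fixes x :: "int \<Rightarrow> 'a"
  assumes "\<And>n k. \<bar>k\<bar> \<le> int n \<Longrightarrow> s n k = x k"
  shows "converges_to s x"
  unfolding converges_to_def eventually_sequentially
proof (intro allI exI impI)
  fix k n assume "nat \<bar>k\<bar> \<le> n"
  then show "s n k = x k" by (intro assms) linarith
qed

lemma finite_separating_window: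
  fixes F :: "(int \<Rightarrow> 'a) set"
  assumes "finite F"
  shows "\<exists>N::nat. \<forall>y\<in>F. \<forall>y'\<in>F. (\<forall>k\<in>{- int N..int N}. y k = y' k) \<longrightarrow> y = y'"
proof -
  \<comment> \<open>For equal points the choice is arbitrary, which can only enlarge
    \<open>N\<close>.\<close>
  define D where "D y y' = (SOME k. y k \<noteq> y' k)" for y y' :: "int \<Rightarrow> 'a"
  define N where "N = nat (Max (insert 0 ((\<lambda>(y, y'). \<bar>D y y'\<bar>) ` (F \<times> F))))"
  have "y = y'" if "y \<in> F" "y' \<in> F" and eq: "\<forall>k\<in>{- int N..int N}. y k = y' k" for y y'
  proof (rule ccontr)
    assume "y \<noteq> y'"
    then have "\<exists>k. y k \<noteq> y' k" by auto
    then have "y (D y y') \<noteq> y' (D y y')" unfolding D_def by (rule someI_ex)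
    moreover have "\<bar>D y y'\<bar> \<le> Max (insert 0 ((\<lambda>(y, y'). \<bar>D y y'\<bar>) ` (F \<times> F)))"
      using assms that by (intro Max_ge) force+
    then have "D y y' \<in> {- int N..int N}" by (auto simp: N_def)
    ultimately show False using eq by blast
  qed
  then show ?thesis by blast
qed

lemma shift_by_fibre:
  assumes "shift_space Y" "sliding_block_code Y X f" "y \<in> fibre Y f x"
  shows "shift_by m y \<in> fibre Y f (shift_by m x)"
  using assms by (auto simp: fibre_def shift_space_shift_by sliding_block_code_shift_by)

section \<open>Separation of the points of a fibre\<close>

locale unramified_SFT =
  fixes Y :: "(int \<Rightarrow> 'a) set" and X :: "(int \<Rightarrow> 'b) set" and f :: "(int \<Rightarrow> 'a) \<Rightarrow> (int \<Rightarrow> 'b)"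
  assumes Y_SFT: "shift_of_finite_type Y" and X_irr: "irreducible_SFT X" and unram: "unramified Y X f"
begin

lemma X_SFT: "shift_of_finite_type X"
  using X_irr by (simp add: irreducible_SFT_def)

lemma Y_shift: "shift_space Y" and X_shift: "shift_space X"
  using Y_SFT X_SFT by (simp_all add: sft_shift_space)

lemma code: "sliding_block_code Y X f"
  using unram by (simp add: unramified_def factor_map_def)

lemma fibre_card: "x \<in> X \<Longrightarrow> card (fibre Y f x) = factor_degree Y X f"
  and degree_pos: "factor_degree Y X f \<ge> 1"
proof -
  obtain d where d: "d \<ge> 1" "\<forall>x\<in>X. card (fibre Y f x) = d"
    using unram by (auto simp: unramified_def)
  obtain x where "x \<in> X" using X_shift by (auto simp: shift_space_def)
  then have "factor_degree Y X f = d"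
    unfolding factor_degree_def using d by (intro the_equality) auto
  then show "x \<in> X \<Longrightarrow> card (fibre Y f x) = factor_degree Y X f" "factor_degree Y X f \<ge> 1" for x
    using d by auto
qed

lemma finite_fibre: "x \<in> X \<Longrightarrow> finite (fibre Y f x)"
  using fibre_card degree_pos by (metis card.infinite not_one_le_zero)

text \<open>Compactness applied to all points of the fibres simultaneously. The limits lie over
  \<open>x\<close>, but at this stage some of them may coincide.\<close>

lemma fibre_limit:
  assumes z: "\<And>n. z n \<in> X" and x: "converges_to z x"
  shows "\<exists>(r :: nat \<Rightarrow> nat) e y. strict_mono r \<and>
    (\<forall>n. bij_betw (e n) {..<factor_degree Y X f} (fibre Y f (z (r n)))) \<and>
    (\<forall>i<factor_degree Y X f. y i \<in> fibre Y f x \<and> converges_to (\<lambda>n. e n i) (y i))"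
proof -
  let ?d = "factor_degree Y X f"
  have "\<exists>e. bij_betw e {..<?d} (fibre Y f (z n))" for n
    using ex_bij_betw_nat_finite[OF finite_fibre[OF z[of n]]] fibre_card[OF z[of n]]
    by (simp add: atLeast0LessThan)
  then obtain e where e: "\<And>n. bij_betw (e n) {..<?d} (fibre Y f (z n))"
    by metis
  have eY: "e n i \<in> Y" and fe: "f (e n i) = z n" if "i < ?d" for n i
    using bij_betwE[OF e[of n]] that by (auto simp: fibre_def)
  obtain A where A: "finite A" "\<forall>y\<in>Y. \<forall>k. y k \<in> A" using sft_alphabet[OF Y_SFT] by blast
  \<comment> \<open>Indices from the degree on repeat the index \<open>0\<close>, which exists
    because the degree is positive; so every value stays in the finite alphabet.\<close>
  define s where "s n = (\<lambda>(i::nat, k::int). e n (if i < ?d then i else 0) k)" for n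
  have "\<exists>(r :: nat \<Rightarrow> nat) l. strict_mono r \<and> converges_to (\<lambda>n. s (r n)) l"
  proof (rule converges_to_subsequence_exists[OF A(1)])
    fix n and j :: "nat \<times> int"
    show "s n j \<in> A" using A(2) eY degree_pos by (auto simp: s_def split: prod.split)
  qed
  then obtain r :: "nat \<Rightarrow> nat" and l where r: "strict_mono r" and l: "converges_to (\<lambda>n. s (r n)) l"
    by blast
  define y where "y i = (\<lambda>k. l (i, k))" for i
  have conv: "converges_to (\<lambda>n. e (r n) i) (y i)" if "i < ?d" for i
    unfolding converges_to_def
  proof
    fix k
    have "\<forall>\<^sub>F n in sequentially. s (r n) (i, k) = l (i, k)" using l by (simp add: converges_to_def)
    then show "\<forall>\<^sub>F n in sequentially. e (r n) i k = y i k" using that by (simp add: s_def y_def)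
  qed
  have "y i \<in> fibre Y f x" if i: "i < ?d" for i
  proof -
    have "y i \<in> Y" by (rule sft_converges_to[OF Y_SFT _ conv[OF i]]) (rule eY[OF i])
    moreover have "converges_to (\<lambda>n. f (e (r n) i)) (f (y i))"
      by (rule sliding_block_code_converges_to[OF Y_SFT code _ conv[OF i]]) (rule eY[OF i])
    then have "converges_to (\<lambda>n. z (r n)) (f (y i))" by (simp add: fe[OF i])
    then have "f (y i) = x" using converges_to_unique converges_to_subseq[OF x r] by blast
    ultimately show ?thesis by (simp add: fibre_def)
  qed
  then show ?thesis
    by (intro exI[of _ r] exI[of _ "\<lambda>n. e (r n)"] exI[of _ y]) (simp add: r conv e)
qed

definition separated :: "int set \<Rightarrow> (int \<Rightarrow> 'b) \<Rightarrow> bool" where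
  "separated S x \<longleftrightarrow> (\<forall>y\<in>fibre Y f x. \<forall>y'\<in>fibre Y f x. (\<forall>k\<in>S. y k = y' k) \<longrightarrow> y = y')"

text \<open>Since all fibres have the same number of points, the limits of the points of nearby
  separated fibres exhaust the limit fibre.\<close>

lemma fibre_limit_separated:
  assumes z: "\<And>n. z n \<in> X" and x: "converges_to z x" and "finite S" and sep: "\<And>n. separated S (z n)"
  shows "\<exists>(r :: nat \<Rightarrow> nat) e y. strict_mono r \<and>
    (\<forall>n. bij_betw (e n) {..<factor_degree Y X f} (fibre Y f (z (r n)))) \<and>
    (\<forall>i<factor_degree Y X f. converges_to (\<lambda>n. e n i) (y i)) \<and>
    y ` {..<factor_degree Y X f} = fibre Y f x \<and>
    (\<forall>i<factor_degree Y X f. \<forall>j<factor_degree Y X f. (\<forall>k\<in>S. y i k = y j k) \<longrightarrow> i = j)"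
proof -
  let ?d = "factor_degree Y X f"
  obtain r :: "nat \<Rightarrow> nat" and e y where r: "strict_mono r"
    and e: "\<forall>n. bij_betw (e n) {..<?d} (fibre Y f (z (r n)))"
    and y: "\<forall>i<?d. y i \<in> fibre Y f x \<and> converges_to (\<lambda>n. e n i) (y i)"
    using fibre_limit[OF z x] by blast
  have "x \<in> X" by (rule sft_converges_to[OF X_SFT z x])
  have inj: "i = j" if ij: "i < ?d" "j < ?d" and eq: "\<forall>k\<in>S. y i k = y j k" for i j
  proof -
    have "\<forall>\<^sub>F n in sequentially. (\<forall>k\<in>S. e n i k = y i k) \<and> (\<forall>k\<in>S. e n j k = y j k)"
      using y ij \<open>finite S\<close> by (intro eventually_conj converges_to_finite) auto
    then obtain n where n: "\<forall>k\<in>S. e n i k = y i k" "\<forall>k\<in>S. e n j k = y j k"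
      using eventually_happens'[OF sequentially_bot] by blast
    have en: "e n i \<in> fibre Y f (z (r n))" "e n j \<in> fibre Y f (z (r n))"
      using bij_betwE[OF e[rule_format, of n]] ij by auto
    have "\<forall>k\<in>S. e n i k = e n j k" using n eq by simp
    then have "e n i = e n j" using sep[of "r n"] en unfolding separated_def by blast
    then show "i = j"
      using bij_betw_imp_inj_on[OF e[rule_format, of n]] ij by (auto dest: inj_onD)
  qed
  then have "inj_on y {..<?d}" by (auto simp: inj_on_def)
  then have "card (y ` {..<?d}) = card (fibre Y f x)"
    using fibre_card[OF \<open>x \<in> X\<close>] by (simp add: card_image)
  then have im: "y ` {..<?d} = fibre Y f x"
    using y finite_fibre[OF \<open>x \<in> X\<close>] by (intro card_subset_eq) auto
  show ?thesis
  proof (rule exI[of _ r], rule exI[of _ e], rule exI[of _ y], intro conjI allI impI)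
    show "strict_mono r" by (rule r)
    show "bij_betw (e n) {..<?d} (fibre Y f (z (r n)))" for n using e by simp
    show "converges_to (\<lambda>n. e n i) (y i)" if "i < ?d" for i using y that by simp
    show "y ` {..<?d} = fibre Y f x" by (rule im)
    show "i = j" if "i < ?d" "j < ?d" "\<forall>k\<in>S. y i k = y j k" for i j
      using that by (rule inj)
  qed
qed

text \<open>Fixing the window makes separation a closed condition: every point of the limit fibre is
  one of the limits \<open>y i\<close>, and these inherit separation by \<open>S\<close>.\<close>

lemma separated_limit:
  assumes "\<And>n. z n \<in> X" "converges_to z x" "finite S" "\<And>n. separated S (z n)"
  shows "separated S x"
proof -
  obtain y where y: "y ` {..<factor_degree Y X f} = fibre Y f x"
    "\<forall>i<factor_degree Y X f. \<forall>j<factor_degree Y X f. (\<forall>k\<in>S. y i k = y j k) \<longrightarrow> i = j"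
    using fibre_limit_separated[OF assms] by (elim exE conjE) (rule that)
  have "u = v" if uv: "u \<in> fibre Y f x" "v \<in> fibre Y f x" "\<forall>k\<in>S. u k = v k" for u v
  proof -
    have "u \<in> y ` {..<factor_degree Y X f}" "v \<in> y ` {..<factor_degree Y X f}"
      using uv y(1) by simp_all
    then obtain i j where ij: "i < factor_degree Y X f" "j < factor_degree Y X f" "u = y i" "v = y j"
      by blast
    have "i = j" by (rule y(2)[rule_format]) (use ij uv(3) in auto)
    then show ?thesis using ij by simp
  qed
  then show ?thesis unfolding separated_def by blast
qed

lemma not_separated_open:
  assumes "x \<in> X" "finite S" "\<not> separated S x"
  shows "\<exists>r::nat. \<forall>x'\<in>X. (\<forall>k. \<bar>k\<bar> \<le> int r \<longrightarrow> x' k = x k) \<longrightarrow> \<not> separated S x'"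
proof (rule ccontr)
  assume "\<not> ?thesis"
  then have "\<forall>r::nat. \<exists>x'. x' \<in> X \<and> (\<forall>k. \<bar>k\<bar> \<le> int r \<longrightarrow> x' k = x k) \<and> separated S x'"
    by blast
  then obtain z where z: "\<forall>r::nat. z r \<in> X \<and> (\<forall>k. \<bar>k\<bar> \<le> int r \<longrightarrow> z r k = x k) \<and> separated S (z r)"
    by (rule choice[THEN exE])
  have "converges_to z x" by (rule converges_to_agree) (simp add: z)
  then have "separated S x" by (rule separated_limit[rotated]) (simp_all add: z assms(2))
  then show False using assms(3) by simp
qed

text \<open>A Baire category argument: finite fibres are separated by some window, and being separated
  by a given window is a closed condition.\<close>

lemma separating_cylinder:
  "\<exists>x\<in>X. \<exists>r N :: nat. \<forall>x'\<in>X. (\<forall>k. \<bar>k\<bar> \<le> int r \<longrightarrow> x' k = x k) \<longrightarrow> separated {- int N..int N} x'"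
proof (rule ccontr)
  assume "\<not> ?thesis"
  then have neg: "\<exists>x'\<in>X. (\<forall>k. \<bar>k\<bar> \<le> int r \<longrightarrow> x' k = x k) \<and> \<not> separated {- int N..int N} x'"
    if "x \<in> X" for x and r N :: nat
    using that by blast
  \<comment> \<open>A nested sequence of cylinders, the \<open>n\<close>-th of which defeats the
    window of radius \<open>n\<close>; \<open>n \<le> r\<close> forces the centres to converge. The
    limit lies in all of them, so no window would separate its finite fibre.\<close>
  define P where "P n = (\<lambda>(x, r). x \<in> X \<and> n \<le> r \<and>
     (\<forall>x'\<in>X. (\<forall>k. \<bar>k\<bar> \<le> int r \<longrightarrow> x' k = x k) \<longrightarrow> \<not> separated {- int n..int n} x'))" for n :: nat
  define Q where "Q = (\<lambda>(n::nat) (x :: int \<Rightarrow> 'b, r::nat) (x', r'). r \<le> r' \<and> (\<forall>k. \<bar>k\<bar> \<le> int r \<longrightarrow> x' k = x k))"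
  have step: "\<exists>t. P n t \<and> Q m (x, r) t" if xX: "x \<in> X" for x r n m
  proof -
    obtain x' where x': "x' \<in> X" "\<forall>k. \<bar>k\<bar> \<le> int r \<longrightarrow> x' k = x k" "\<not> separated {- int n..int n} x'"
      using neg[OF xX] by blast
    obtain r' :: nat where r': "\<forall>x''\<in>X. (\<forall>k. \<bar>k\<bar> \<le> int r' \<longrightarrow> x'' k = x' k) \<longrightarrow> \<not> separated {- int n..int n} x''"
      using not_separated_open[OF x'(1) _ x'(3)] by auto
    have "P n (x', max n (max r r'))" "Q m (x, r) (x', max n (max r r'))"
      using x' r' by (auto simp: P_def Q_def)
    then show ?thesis by blast
  qed
  obtain x1 where x1: "x1 \<in> X" using X_shift by (auto simp: shift_space_def)
  have "\<exists>g. \<forall>n. P n (g n) \<and> Q n (g n) (g (Suc n))"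
  proof (rule dependent_nat_choice)
    show "\<exists>t. P 0 t" using step[OF x1] by blast
    show "\<exists>u. P (Suc n) u \<and> Q n t u" if "P n t" for t n
      using that step[of "fst t" "Suc n" n "snd t"] by (cases t) (simp add: P_def)
  qed
  then obtain g where g: "\<And>n. P n (g n)" "\<And>n. Q n (g n) (g (Suc n))" by blast
  define xs where "xs n = fst (g n)" for n
  define rs where "rs n = snd (g n)" for n
  have xs: "xs n \<in> X" "n \<le> rs n"
    "\<And>x'. \<lbrakk>x' \<in> X; \<forall>k. \<bar>k\<bar> \<le> int (rs n) \<longrightarrow> x' k = xs n k\<rbrakk> \<Longrightarrow> \<not> separated {- int n..int n} x'" for n
    using g(1)[of n] by (auto simp: P_def xs_def rs_def split: prod.splits)
  have mono: "rs n \<le> rs m \<and> (\<forall>k. \<bar>k\<bar> \<le> int (rs n) \<longrightarrow> xs m k = xs n k)" if "n \<le> m" for n m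
    using that
  proof (induction m rule: dec_induct)
    case (step m)
    have "rs m \<le> rs (Suc m)" "\<forall>k. \<bar>k\<bar> \<le> int (rs m) \<longrightarrow> xs (Suc m) k = xs m k"
      using g(2)[of m] by (auto simp: Q_def xs_def rs_def split: prod.splits)
    with step.IH show ?case by simp
  qed simp
  \<comment> \<open>Coordinate \<open>k\<close> is read off the centre whose number is the absolute
    value of \<open>k\<close>; its cylinder already fixes that coordinate because
    \<open>n \<le> rs n\<close>.\<close>
  define l where "l k = xs (nat \<bar>k\<bar>) k" for k
  have agree: "l k = xs n k" if k: "\<bar>k\<bar> \<le> int (rs n)" for n k
  proof (cases "n \<le> nat \<bar>k\<bar>")
    case True
    then show ?thesis using mono[OF True] k by (simp add: l_def)
  next
    case False
    then have "nat \<bar>k\<bar> \<le> n" by simp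
    moreover have "\<bar>k\<bar> \<le> int (rs (nat \<bar>k\<bar>))" using xs(2)[of "nat \<bar>k\<bar>"] by linarith
    ultimately show ?thesis using mono[of "nat \<bar>k\<bar>" n] by (simp add: l_def)
  qed
  have "converges_to xs l"
  proof (rule converges_to_agree)
    fix n k assume "\<bar>k\<bar> \<le> int n"
    then show "xs n k = l k" using agree[of k n] xs(2)[of n] by simp
  qed
  then have "l \<in> X" by (rule sft_converges_to[OF X_SFT xs(1)])
  then have "\<not> separated {- int n..int n} l" for n
    by (rule xs(3)) (use agree in blast)
  then show False
    using finite_separating_window[OF finite_fibre[OF \<open>l \<in> X\<close>]] unfolding separated_def by blast
qed

lemma separated_shift_by:
  assumes "separated {i..j} (shift_by a x)"
  shows "separated {a + i..a + j} x"
  unfolding separated_def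
proof (intro ballI impI)
  fix y y' assume y: "y \<in> fibre Y f x" "y' \<in> fibre Y f x" and eq: "\<forall>k\<in>{a + i..a + j}. y k = y' k"
  have "\<forall>k\<in>{i..j}. shift_by a y k = shift_by a y' k" using eq by (simp add: add.commute)
  moreover have "shift_by a y \<in> fibre Y f (shift_by a x)" "shift_by a y' \<in> fibre Y f (shift_by a x)"
    using y by (auto intro: shift_by_fibre[OF Y_shift code])
  ultimately have "shift_by a y = shift_by a y'" using assms unfolding separated_def by blast
  then have "shift_by (-a) (shift_by a y) = shift_by (-a) (shift_by a y')" by simp
  then show "y = y'" by simp
qed

text \<open>Two points of a fibre agreeing on a long window can be spliced there; if the fibre is
  separated on both sides of the window, then the splice equals both of them.\<close>

lemma separated_between:
  "\<exists>M::nat. M > 0 \<and> (\<forall>x a a' b b' n. separated {a'..a} x \<longrightarrow> separated {b..b'} x \<longrightarrow>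
     a < n + int M \<longrightarrow> n \<le> b \<longrightarrow> separated {n..n + int M - 1} x)"
proof -
  obtain ms :: nat where ms: "\<forall>x\<in>Y. \<forall>y\<in>Y. \<forall>n.
      (\<forall>k. n \<le> k \<and> k < n + int ms \<longrightarrow> x k = y k) \<longrightarrow> (\<lambda>k. if k < n then x k else y k) \<in> Y"
    using sft_splice[OF Y_SFT] by blast
  obtain r :: nat where r: "\<forall>x\<in>Y. \<forall>x'\<in>Y. \<forall>n.
      (\<forall>k. n - int r \<le> k \<and> k \<le> n + int r \<longrightarrow> x k = x' k) \<longrightarrow> f x n = f x' n"
    using Curtis_Hedlund_Lyndon[OF Y_SFT code] by blast
  \<comment> \<open>\<open>ms\<close> allows the splice. With \<open>2 * r + 1\<close> every block
    of radius \<open>r\<close> lies either before \<open>n + M\<close> or from \<open>n\<close> on,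
    so that it sees only \<open>y\<close> or only \<open>y'\<close>; the summand \<open>1\<close>
    also makes \<open>M\<close> positive.\<close>
  define M where "M = max ms (2 * r + 1)"
  have "separated {n..n + int M - 1} x"
    if sa: "separated {a'..a} x" and sb: "separated {b..b'} x" and an: "a < n + int M" and nb: "n \<le> b"
    for x a a' b b' n
    unfolding separated_def
  proof (intro ballI impI)
    fix y y' assume y: "y \<in> fibre Y f x" "y' \<in> fibre Y f x"
      and eq0: "\<forall>k\<in>{n..n + int M - 1}. y k = y' k"
    have eq: "y k = y' k" if "n \<le> k" "k < n + int M" for k using eq0 that by simp
    define u where "u = (\<lambda>k. if k < n then y k else y' k)"
    have uy: "u k = y k" if "k < n + int M" for k using that eq by (auto simp: u_def)
    have uy': "u k = y' k" if "n \<le> k" for k using that by (auto simp: u_def)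
    have uY: "u \<in> Y" unfolding u_def using y eq
      by (intro ms[rule_format]) (auto simp: fibre_def M_def)
    have "f u k = x k" for k
    proof (cases "k + int r < n + int M")
      case True
      then have "f u k = f y k"
        using y uY by (intro r[rule_format]) (auto simp: fibre_def intro: uy)
      then show ?thesis using y by (simp add: fibre_def)
    next
      case False
      then have "f u k = f y' k"
        using y uY by (intro r[rule_format]) (auto simp: fibre_def M_def intro: uy')
      then show ?thesis using y by (simp add: fibre_def)
    qed
    then have u: "u \<in> fibre Y f x" using uY by (auto simp: fibre_def)
    \<comment> \<open>\<open>u\<close> and \<open>y'\<close> agree from \<open>n\<close> on, in
      particular on the right separating window; \<open>u\<close> and \<open>y\<close> agree before
      \<open>n + M\<close>, in particular on the left one.\<close>
    have "u = y'" using sb u y(2) uy' nb unfolding separated_def by fastforce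
    moreover have "u = y" using sa u y(1) uy an unfolding separated_def by fastforce
    ultimately show "y = y'" by simp
  qed
  moreover have "M > 0" by (simp add: M_def)
  ultimately show ?thesis by blast
qed

text \<open>\<open>M\<close> comes from \<open>separated_between\<close> and depends neither on the
  point nor on where the cylinder is visited. Points that visit it on both sides approximate every
  \<open>x\<close> and share one window of length \<open>M\<close> starting at \<open>0\<close>, so
  closedness passes separation on to \<open>x\<close>. Shifting gives the other windows.\<close>

theorem uniformly_separated:
  "\<exists>M::nat. M > 0 \<and> (\<forall>x\<in>X. \<forall>n. separated {n..n + int M - 1} x)"
proof -
  obtain w r N where w: "w \<in> X"
    and cyl: "\<And>x'. \<lbrakk>x' \<in> X; \<forall>k. \<bar>k\<bar> \<le> int r \<longrightarrow> x' k = w k\<rbrakk> \<Longrightarrow> separated {- int N..int N} x'"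
    using separating_cylinder by blast
  obtain M :: nat where "M > 0" and M: "\<And>x a a' b b' n. \<lbrakk>separated {a'..a} x; separated {b..b'} x;
     a < n + int M; n \<le> b\<rbrakk> \<Longrightarrow> separated {n..n + int M - 1} x"
    using separated_between by blast
  have sees: "separated {a + - int N..a + int N} x" if "x \<in> X" "\<And>k. \<bar>k\<bar> \<le> int r \<Longrightarrow> x (a + k) = w k" for x a
    using that by (intro separated_shift_by cyl shift_space_shift_by[OF X_shift]) (auto simp: add.commute)
  \<comment> \<open>The approximation keeps \<open>x\<close> on \<open>{- j..j}\<close> and has
    copies of the block of \<open>w\<close> glued on both sides. \<open>N \<le> j\<close> keeps the
    windows of radius \<open>N\<close> around the left and the right visit at nonpositive and
    nonnegative coordinates respectively.\<close>
  have approx: "\<exists>q\<in>X. (\<forall>k. \<bar>k\<bar> \<le> int j \<longrightarrow> q k = x k) \<and> separated {0..0 + int M - 1} q"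
    if x: "x \<in> X" and jN: "N \<le> j" for x j
  proof -
    \<comment> \<open>The shifts move the block of \<open>w\<close> on \<open>{- r..r}\<close> so
      that it ends, respectively starts, at \<open>0\<close>, and the part of \<open>x\<close> to be
      kept so that it starts at \<open>0\<close>, as the gluing lemma expects.\<close>
    have sh: "shift_by (int r) w \<in> X" "shift_by (- int j) x \<in> X" "shift_by (- int r) w \<in> X"
      using w x by (simp_all add: shift_space_shift_by[OF X_shift])
    obtain p m where p: "p \<in> X" "0 \<le> m" "\<forall>k\<le>0. p k = shift_by (int r) w k"
      "\<forall>k\<ge>0. p (m + k) = shift_by (- int j) x k"
      using irreducible_SFT_glue[OF X_irr sh(1,2)] by blast
    define p1 where "p1 = shift_by (m + int j) p"
    have p1: "p1 \<in> X" unfolding p1_def by (rule shift_space_shift_by[OF X_shift p(1)])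
    have p1x: "p1 k = x k" if "k \<ge> - int j" for k
      using p(4)[rule_format, of "k + int j"] that by (simp add: p1_def ac_simps)
    have p1w: "p1 (- m - int j - int r + k) = w k" if "k \<le> int r" for k
      using p(3)[rule_format, of "k - int r"] that by (simp add: p1_def)
    have sh': "shift_by (int j) p1 \<in> X" using p1 by (rule shift_space_shift_by[OF X_shift])
    obtain q0 m' where q0: "q0 \<in> X" "0 \<le> m'" "\<forall>k\<le>0. q0 k = shift_by (int j) p1 k"
      "\<forall>k\<ge>0. q0 (m' + k) = shift_by (- int r) w k"
      using irreducible_SFT_glue[OF X_irr sh' sh(3)] by blast
    define q where "q = shift_by (- int j) q0"
    have q: "q \<in> X" unfolding q_def by (rule shift_space_shift_by[OF X_shift q0(1)])
    have qp: "q k = p1 k" if "k \<le> int j" for k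
      using q0(3)[rule_format, of "k - int j"] that by (simp add: q_def)
    have qw: "q (m' + int j + int r + k) = w k" if "k \<ge> - int r" for k
      using q0(4)[rule_format, of "k + int r"] that by (simp add: q_def ac_simps)
    have "separated {- m - int j - int r + - int N..- m - int j - int r + int N} q"
    proof (rule sees[OF q])
      fix k assume "\<bar>k\<bar> \<le> int r"
      then show "q (- m - int j - int r + k) = w k"
        using p1w[of k] p(2) by (subst qp) auto
    qed
    moreover have "separated {m' + int j + int r + - int N..m' + int j + int r + int N} q"
      by (rule sees[OF q], rule qw) simp
    ultimately have "separated {0..0 + int M - 1} q"
      by (rule M) (use jN p(2) q0(2) \<open>M > 0\<close> in auto)
    moreover have "\<forall>k. \<bar>k\<bar> \<le> int j \<longrightarrow> q k = x k" using qp p1x by auto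
    ultimately show ?thesis using q by blast
  qed
  have sep0: "separated {0..0 + int M - 1} x" if x: "x \<in> X" for x
  proof -
    have "\<forall>n. \<exists>q. q \<in> X \<and> (\<forall>k. \<bar>k\<bar> \<le> int (n + N) \<longrightarrow> q k = x k) \<and> separated {0..0 + int M - 1} q"
      using approx[OF x] by (meson le_add2)
    then obtain q where q: "\<forall>n. q n \<in> X \<and> (\<forall>k. \<bar>k\<bar> \<le> int (n + N) \<longrightarrow> q n k = x k) \<and> separated {0..0 + int M - 1} (q n)"
      by (rule choice[THEN exE])
    have "converges_to q x" by (rule converges_to_agree) (use q in auto)
    then show ?thesis by (rule separated_limit[rotated]) (simp_all add: q[simplified])
  qed
  have "separated {n..n + int M - 1} x" if x: "x \<in> X" for x n
    using separated_shift_by[OF sep0[OF shift_space_shift_by[OF X_shift x]], of n] by (simp add: add_diff_eq)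
  then show ?thesis using \<open>M > 0\<close> by blast
qed

text \<open>Openness of the covering, with a radius \<open>K\<close> that depends on
  \<open>L\<close> alone. Otherwise counterexamples would accumulate at some \<open>y\<close>; the
  fibres over the nearby points converge to the whole fibre of \<open>f y\<close>, so one of their
  branches converges to \<open>y\<close> and refutes a late counterexample.\<close>

lemma local_lift:
  "\<exists>K::nat. \<forall>y\<in>Y. \<forall>z\<in>X. (\<forall>k. \<bar>k\<bar> \<le> int K \<longrightarrow> z k = f y k) \<longrightarrow>
     (\<exists>y'\<in>fibre Y f z. \<forall>k. \<bar>k\<bar> \<le> int L \<longrightarrow> y' k = y k)"
proof (rule ccontr)
  assume "\<not> ?thesis"
  then have "\<forall>K::nat. \<exists>t. fst t \<in> Y \<and> snd t \<in> X \<and> (\<forall>k. \<bar>k\<bar> \<le> int K \<longrightarrow> snd t k = f (fst t) k) \<and>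
     \<not> (\<exists>y'\<in>fibre Y f (snd t). \<forall>k. \<bar>k\<bar> \<le> int L \<longrightarrow> y' k = fst t k)"
    by simp blast
  then obtain t where t: "\<forall>K::nat. fst (t K) \<in> Y \<and> snd (t K) \<in> X \<and> (\<forall>k. \<bar>k\<bar> \<le> int K \<longrightarrow> snd (t K) k = f (fst (t K)) k) \<and>
     \<not> (\<exists>y'\<in>fibre Y f (snd (t K)). \<forall>k. \<bar>k\<bar> \<le> int L \<longrightarrow> y' k = fst (t K) k)"
    by (rule choice[THEN exE])
  define ys where "ys K = fst (t K)" for K
  define zs where "zs K = snd (t K)" for K
  have ys: "ys K \<in> Y" and zs: "zs K \<in> X" and zf: "\<And>k. \<bar>k\<bar> \<le> int K \<Longrightarrow> zs K k = f (ys K) k"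
    and no: "\<not> (\<exists>y'\<in>fibre Y f (zs K). \<forall>k. \<bar>k\<bar> \<le> int L \<longrightarrow> y' k = ys K k)" for K
    using t by (auto simp: ys_def zs_def)
  obtain A where A: "finite A" "\<forall>y\<in>Y. \<forall>k. y k \<in> A" using sft_alphabet[OF Y_SFT] by blast
  have "\<exists>(q :: nat \<Rightarrow> nat) y. strict_mono q \<and> converges_to (\<lambda>n. ys (q n)) y"
    by (rule converges_to_subsequence_exists[OF A(1)]) (use A(2) ys in blast)
  then obtain q :: "nat \<Rightarrow> nat" and y where q: "strict_mono q" and y: "converges_to (\<lambda>n. ys (q n)) y"
    by blast
  have yY: "y \<in> Y" by (rule sft_converges_to[OF Y_SFT ys y])
  have fy: "converges_to (\<lambda>n. f (ys (q n))) (f y)"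
    by (rule sliding_block_code_converges_to[OF Y_SFT code ys y])
  have z: "converges_to (\<lambda>n. zs (q n)) (f y)"
    unfolding converges_to_def
  proof
    fix k
    have "\<forall>\<^sub>F n in sequentially. f (ys (q n)) k = f y k \<and> nat \<bar>k\<bar> \<le> n"
      using fy by (intro eventually_conj eventually_ge_at_top) (simp add: converges_to_def)
    then show "\<forall>\<^sub>F n in sequentially. zs (q n) k = f y k"
    proof eventually_elim
      case (elim n)
      have "\<bar>k\<bar> \<le> int (q n)" using elim seq_suble[OF q, of n] by linarith
      then show ?case using zf elim by simp
    qed
  qed
  obtain M :: nat where M: "\<And>x n. x \<in> X \<Longrightarrow> separated {n..n + int M - 1} x"
    using uniformly_separated by blast
  have "\<exists>(r :: nat \<Rightarrow> nat) e u. strict_mono r \<and>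
    (\<forall>n. bij_betw (e n) {..<factor_degree Y X f} (fibre Y f (zs (q (r n))))) \<and>
    (\<forall>i<factor_degree Y X f. converges_to (\<lambda>n. e n i) (u i)) \<and>
    u ` {..<factor_degree Y X f} = fibre Y f (f y) \<and>
    (\<forall>i<factor_degree Y X f. \<forall>j<factor_degree Y X f. (\<forall>k\<in>{0..0 + int M - 1}. u i k = u j k) \<longrightarrow> i = j)"
    by (rule fibre_limit_separated[OF zs z _ M[OF zs]]) simp
  then obtain r :: "nat \<Rightarrow> nat" and e u where r: "strict_mono r"
    and e: "\<forall>n. bij_betw (e n) {..<factor_degree Y X f} (fibre Y f (zs (q (r n))))"
    and u: "\<forall>i<factor_degree Y X f. converges_to (\<lambda>n. e n i) (u i)"
      "u ` {..<factor_degree Y X f} = fibre Y f (f y)"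
    by blast
  have "y \<in> fibre Y f (f y)" using yY by (simp add: fibre_def)
  then obtain i where i: "i < factor_degree Y X f" "u i = y" using u(2) by (metis imageE lessThan_iff)
  have conv1: "converges_to (\<lambda>n. e n i) y" using u(1) i by blast
  have conv2: "converges_to (\<lambda>n. ys (q (r n))) y" using converges_to_subseq[OF y r] .
  have "\<forall>\<^sub>F n in sequentially. (\<forall>k\<in>{- int L..int L}. e n i k = y k) \<and> (\<forall>k\<in>{- int L..int L}. ys (q (r n)) k = y k)"
    by (intro eventually_conj converges_to_finite[OF conv1] converges_to_finite[OF conv2]) auto
  then obtain n where n: "\<forall>k\<in>{- int L..int L}. e n i k = y k" "\<forall>k\<in>{- int L..int L}. ys (q (r n)) k = y k"
    using eventually_happens'[OF sequentially_bot] by blast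
  have "e n i \<in> fibre Y f (zs (q (r n)))" using bij_betwE[OF e[rule_format, of n]] i by simp
  moreover have "e n i k = ys (q (r n)) k" if "\<bar>k\<bar> \<le> int L" for k
  proof -
    have "k \<in> {- int L..int L}" using that by auto
    then show ?thesis using n by metis
  qed
  ultimately show False using no[of "q (r n)"] by blast
qed

text \<open>The sign \<open>s\<close> selects whether points are compared to the right or to the left.\<close>

lemma asymptotic_unique:
  assumes "x \<in> X" "y \<in> fibre Y f x" "y' \<in> fibre Y f x" and s: "s = 1 \<or> s = (-1::int)"
    and eq: "\<And>k. c \<le> k \<Longrightarrow> y (s * k) = y' (s * k)"
  shows "y = y'"
proof -
  obtain M :: nat where M: "\<And>x n. x \<in> X \<Longrightarrow> separated {n..n + int M - 1} x"
    using uniformly_separated by blast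
  \<comment> \<open>For \<open>s = 1\<close> the window starts at \<open>c\<close>, for
    \<open>s = - 1\<close> it ends at \<open>- c\<close>.\<close>
  define n where "n = (if s = 1 then c else - c - int M + 1)"
  have "y k = y' k" if "k \<in> {n..n + int M - 1}" for k
    using eq[of "s * k"] s that by (auto simp: n_def)
  then show ?thesis using M[OF assms(1), of n] assms(2,3) unfolding separated_def by blast
qed

text \<open>The analogue of path lifting. Around each far coordinate \<open>s * n\<close>,
  \<open>local_lift\<close> gives a point over \<open>z\<close> that follows \<open>y\<close> on a
  ball of radius \<open>M\<close>. Neighbouring balls overlap in \<open>M\<close> coordinates, so by
  uniform separation all these points are one and the same.\<close>

lemma asymptotic_lift:
  assumes y: "y \<in> Y" and z: "z \<in> X" and s: "s = 1 \<or> s = (-1::int)"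
    and eq: "\<And>k. c \<le> k \<Longrightarrow> z (s * k) = f y (s * k)"
  shows "\<exists>y'\<in>fibre Y f z. \<exists>c'. \<forall>k\<ge>c'. y' (s * k) = y (s * k)"
proof -
  obtain M :: nat where "M > 0" and M: "\<And>x n. x \<in> X \<Longrightarrow> separated {n..n + int M - 1} x"
    using uniformly_separated by blast
  obtain K :: nat where K: "\<And>y z. \<lbrakk>y \<in> Y; z \<in> X; \<forall>k. \<bar>k\<bar> \<le> int K \<longrightarrow> z k = f y k\<rbrakk> \<Longrightarrow>
     \<exists>y'\<in>fibre Y f z. \<forall>k. \<bar>k\<bar> \<le> int M \<longrightarrow> y' k = y k"
    using local_lift[of M] by blast
  have lift: "\<exists>u. u \<in> fibre Y f z \<and> (\<forall>k. \<bar>k - s * n\<bar> \<le> int M \<longrightarrow> u k = y k)" if n: "c + int K \<le> n" for n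
  proof -
    have "\<forall>k. \<bar>k\<bar> \<le> int K \<longrightarrow> shift_by (s * n) z k = f (shift_by (s * n) y) k"
    proof (intro allI impI)
      fix k assume k: "\<bar>k\<bar> \<le> int K"
      have "k + s * n = s * (n + s * k)" using s by auto
      moreover have "c \<le> n + s * k" using k n s by auto
      ultimately have "z (k + s * n) = f y (k + s * n)" using eq by metis
      then show "shift_by (s * n) z k = f (shift_by (s * n) y) k"
        by (simp add: sliding_block_code_shift_by[OF Y_shift code y])
    qed
    then obtain u where u: "u \<in> fibre Y f (shift_by (s * n) z)" "\<forall>k. \<bar>k\<bar> \<le> int M \<longrightarrow> u k = shift_by (s * n) y k"
      using K[OF shift_space_shift_by[OF Y_shift y] shift_space_shift_by[OF X_shift z]] by blast
    have "shift_by (- (s * n)) u \<in> fibre Y f (shift_by (- (s * n)) (shift_by (s * n) z))"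
      by (rule shift_by_fibre[OF Y_shift code u(1)])
    then have "shift_by (- (s * n)) u \<in> fibre Y f z" by simp
    moreover have "\<forall>k. \<bar>k - s * n\<bar> \<le> int M \<longrightarrow> shift_by (- (s * n)) u k = y k"
      using u(2) by simp
    ultimately show ?thesis by blast
  qed
  define v where "v n = (SOME u. u \<in> fibre Y f z \<and> (\<forall>k. \<bar>k - s * n\<bar> \<le> int M \<longrightarrow> u k = y k))" for n
  have v: "v n \<in> fibre Y f z" "\<And>k. \<bar>k - s * n\<bar> \<le> int M \<Longrightarrow> v n k = y k" if "c + int K \<le> n" for n
    using someI_ex[OF lift[OF that]] by (auto simp: v_def)
  have const: "v n = v (c + int K)" if "c + int K \<le> n" for n
    using that
  proof (induction n rule: int_ge_induct)
    case (step n)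
    \<comment> \<open>These \<open>M\<close> coordinates lie in the balls around both
      \<open>s * n\<close> and \<open>s * (n + 1)\<close>.\<close>
    have "v (n + 1) k = v n k" if k: "k \<in> {s * n - int M + 1..s * n - int M + 1 + int M - 1}" for k
    proof -
      have "\<bar>k - s * n\<bar> \<le> int M" "\<bar>k - s * (n + 1)\<bar> \<le> int M"
        using s k \<open>M > 0\<close> by auto
      then show ?thesis using v(2)[of n k] v(2)[of "n + 1" k] step.hyps by simp
    qed
    moreover have "v (n + 1) \<in> fibre Y f z" "v n \<in> fibre Y f z" using v(1) step.hyps by auto
    ultimately have "v (n + 1) = v n"
      using M[OF z, of "s * n - int M + 1"] unfolding separated_def by blast
    then show ?case using step.IH by simp
  qed simp
  have "v (c + int K) (s * k) = y (s * k)" if "c + int K \<le> k" for k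
    using v(2)[OF that, of "s * k"] const[OF that] by simp
  then show ?thesis using v(1) by blast
qed

end

section \<open>Rigidity of maps over the base\<close>

lemma sliding_block_code_asymptotic:
  assumes X: "shift_of_finite_type X" and f: "sliding_block_code X Y f"
    and x: "x \<in> X" "x' \<in> X" and s: "s = 1 \<or> s = (-1::int)" and eq: "\<And>k. c \<le> k \<Longrightarrow> x (s * k) = x' (s * k)"
  shows "\<exists>c'. \<forall>k\<ge>c'. f x (s * k) = f x' (s * k)"
proof -
  obtain r :: nat where r: "\<forall>x\<in>X. \<forall>x'\<in>X. \<forall>n.
      (\<forall>k. n - int r \<le> k \<and> k \<le> n + int r \<longrightarrow> x k = x' k) \<longrightarrow> f x n = f x' n"
    using Curtis_Hedlund_Lyndon[OF X f] by blast
  have "f x (s * k) = f x' (s * k)" if k: "c + int r \<le> k" for k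
  proof (intro r[rule_format] x)
    fix j assume j: "s * k - int r \<le> j \<and> j \<le> s * k + int r"
    have "c \<le> s * j" using j k s by auto
    then have "x (s * (s * j)) = x' (s * (s * j))" by (rule eq)
    then show "x j = x' j" using s by auto
  qed
  then show ?thesis by blast
qed

text \<open>The equalizer of \<open>g\<close> and \<open>h\<close> is closed under passing to asymptotic points, and any two points
  of an irreducible SFT are, up to a shift, asymptotic to a common third one.\<close>

lemma (in unramified_SFT) unique_code_over:
  assumes Z: "irreducible_SFT Z" and g: "sliding_block_code Z Y g" and h: "sliding_block_code Z Y h"
    and over: "\<And>z. z \<in> Z \<Longrightarrow> f (g z) = f (h z)" and z0: "z0 \<in> Z" "g z0 = h z0" and z: "z \<in> Z"
  shows "g z = h z"
proof -
  have Z_SFT: "shift_of_finite_type Z" using Z by (simp add: irreducible_SFT_def)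
  have Z_shift: "shift_space Z" using Z_SFT by (rule sft_shift_space)
  \<comment> \<open>\<open>g v\<close> and \<open>h v\<close> lie over the same point, and both are
    asymptotic to \<open>g u = h u\<close>, hence to each other.\<close>
  have step: "g v = h v" if u: "u \<in> Z" "g u = h u" and v: "v \<in> Z" and s: "s = 1 \<or> s = (-1::int)"
    and eq: "\<And>k. 0 \<le> k \<Longrightarrow> u (s * k) = v (s * k)" for u v s
  proof -
    obtain c1 where c1: "\<forall>k\<ge>c1. g u (s * k) = g v (s * k)"
      using sliding_block_code_asymptotic[OF Z_SFT g u(1) v s eq] by blast
    obtain c2 where c2: "\<forall>k\<ge>c2. h u (s * k) = h v (s * k)"
      using sliding_block_code_asymptotic[OF Z_SFT h u(1) v s eq] by blast
    show ?thesis
    proof (rule asymptotic_unique[OF _ _ _ s])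
      show "f (g v) \<in> X" using sliding_block_code_in[OF code sliding_block_code_in[OF g v]] .
      show "g v \<in> fibre Y f (f (g v))" "h v \<in> fibre Y f (f (g v))"
        using over[OF v] v g h by (auto simp: fibre_def sliding_block_code_in)
      show "g v (s * k) = h v (s * k)" if "max c1 c2 \<le> k" for k
        using c1 c2 u(2) that by (metis max.bounded_iff)
    qed
  qed
  obtain w m where w: "w \<in> Z" "\<forall>k\<le>0. w k = z0 k" "\<forall>k\<ge>0. w (m + k) = z k"
    using irreducible_SFT_glue[OF Z z0(1) z] by blast
  have "g w = h w" by (rule step[OF z0 w(1), of "-1"]) (use w(2) in auto)
  then have gh: "g (shift_by m w) = h (shift_by m w)"
    by (simp add: sliding_block_code_shift_by[OF Z_shift g w(1)] sliding_block_code_shift_by[OF Z_shift h w(1)])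
  show ?thesis
    by (rule step[OF shift_space_shift_by[OF Z_shift w(1)] gh z, of 1])
      (use w(3) in \<open>auto simp: add.commute\<close>)
qed

section \<open>Conjugacies and Galois groups\<close>

lemma sliding_block_codeI:
  assumes "f \<in> extensional X" "continuous_map (shift_topology X) (shift_topology Y) f"
    "\<And>x. x \<in> X \<Longrightarrow> f (shift_map x) = shift_map (f x)"
  shows "sliding_block_code X Y f"
  using assms by (simp add: sliding_block_code_def)

lemma sliding_block_code_compose:
  assumes X: "shift_space X" and f: "sliding_block_code X Y f" and g: "sliding_block_code Y Z g"
  shows "sliding_block_code X Z (compose X g f)"
proof (rule sliding_block_codeI)
  have "continuous_map (shift_topology X) (shift_topology Z) (g \<circ> f)"
    using f g unfolding sliding_block_code_def by (blast intro: continuous_map_compose)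
  then show "continuous_map (shift_topology X) (shift_topology Z) (compose X g f)"
    by (rule continuous_map_eq) (simp add: compose_def)
  fix x assume x: "x \<in> X"
  have "shift_map x \<in> X" using X x by (auto simp: shift_space_def)
  then show "compose X g f (shift_map x) = shift_map (compose X g f x)"
    using f g x sliding_block_code_in[OF f x] by (simp add: compose_def sliding_block_code_def)
qed simp

lemma sliding_block_code_id:
  assumes "shift_space X"
  shows "sliding_block_code X X (\<lambda>x\<in>X. x)"
proof (rule sliding_block_codeI)
  have "continuous_map (shift_topology X) (shift_topology X) id" by simp
  then show "continuous_map (shift_topology X) (shift_topology X) (\<lambda>x\<in>X. x)"
    by (rule continuous_map_eq) simp
  show "(\<lambda>x\<in>X. x) (shift_map x) = shift_map ((\<lambda>x\<in>X. x) x)" if "x \<in> X" for x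
    using assms that by (auto simp: shift_space_def)
qed simp

lemma sliding_block_code_eqI:
  assumes "sliding_block_code X Y f" "sliding_block_code X Y g" "\<And>x. x \<in> X \<Longrightarrow> f x = g x"
  shows "f = g"
  by (rule extensionalityI[of f X g]) (use assms in \<open>simp_all add: sliding_block_code_def\<close>)

section \<open>Compactness and the inverse of a conjugacy\<close>

lemma Hausdorff_shift_topology: "Hausdorff_space (shift_topology X)"
  unfolding shift_topology_def
  by (intro Hausdorff_space_subtopology) (simp add: Hausdorff_space_product_topology)

lemma compact_shift_topology:
  assumes "shift_space X"
  shows "compact_space (shift_topology X)"
proof -
  obtain A where A: "finite A" and cl: "closedin (product_topology (\<lambda>_::int. discrete_topology A) UNIV) X"
    using assms by (auto simp: shift_space_def)
  have "X \<subseteq> (UNIV \<rightarrow>\<^sub>E A)" using closedin_subset[OF cl] by simp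
  then have eq: "shift_topology X = subtopology (product_topology (\<lambda>_. discrete_topology A) UNIV) X"
    by (rule shift_topology_alphabet)
  have "compact_space (product_topology (\<lambda>_::int. discrete_topology A) UNIV)"
    using A by (simp add: compact_space_product_topology compact_space_discrete_topology)
  then show ?thesis
    unfolding eq by (intro compact_space_subtopology closedin_compact_space cl)
qed

lemma conjugacy_code: "conjugacy X Y f \<Longrightarrow> sliding_block_code X Y f"
  and conjugacy_bij: "conjugacy X Y f \<Longrightarrow> bij_betw f X Y"
  by (simp_all add: conjugacy_def)

lemma conjugacy_in: "\<lbrakk>conjugacy X Y f; x \<in> X\<rbrakk> \<Longrightarrow> f x \<in> Y"
  using conjugacy_code sliding_block_code_in by blast

lemma conjugacy_surj: "\<lbrakk>conjugacy X Y f; y \<in> Y\<rbrakk> \<Longrightarrow> \<exists>x\<in>X. y = f x"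
  using conjugacy_bij unfolding bij_betw_def by blast

lemma conjugacy_inj: "\<lbrakk>conjugacy X Y f; x \<in> X; x' \<in> X; f x = f x'\<rbrakk> \<Longrightarrow> x = x'"
  using conjugacy_bij unfolding bij_betw_def by (blast dest: inj_onD)

lemma conjugacy_inv_into:
  assumes "conjugacy X Y f"
  shows "x \<in> X \<Longrightarrow> inv_into X f (f x) = x" "y \<in> Y \<Longrightarrow> f (inv_into X f y) = y"
    "y \<in> Y \<Longrightarrow> inv_into X f y \<in> X"
  using conjugacy_bij[OF assms] by (auto simp: bij_betw_def f_inv_into_f inv_into_into)

lemma conjugacy_id: "shift_space X \<Longrightarrow> conjugacy X X (\<lambda>x\<in>X. x)"
  by (auto simp: conjugacy_def sliding_block_code_id bij_betw_def inj_on_def)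

lemma conjugacy_compose:
  assumes "shift_space X" "conjugacy X Y f" "conjugacy Y Z g"
  shows "conjugacy X Z (compose X g f)"
  using assms unfolding conjugacy_def by (auto intro: sliding_block_code_compose bij_betw_compose)

text \<open>A continuous bijection from a compact space to a Hausdorff space is a homeomorphism. The
  restriction to \<open>Y\<close> makes the inverse extensional, as
  \<open>sliding_block_code\<close> demands.\<close>

lemma conjugacy_inverse:
  assumes X: "shift_space X" and Y: "shift_space Y" and f: "conjugacy X Y f"
  shows "conjugacy Y X (\<lambda>y\<in>Y. inv_into X f y)"
  unfolding conjugacy_def
proof (intro conjI sliding_block_codeI)
  have "homeomorphic_map (shift_topology X) (shift_topology Y) f"
    using f by (intro continuous_imp_homeomorphic_map compact_shift_topology[OF X] Hausdorff_shift_topology)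
      (auto simp: conjugacy_def sliding_block_code_def bij_betw_def)
  then obtain g where g: "homeomorphic_maps (shift_topology X) (shift_topology Y) f g"
    by (auto simp: homeomorphic_map_maps)
  have "continuous_map (shift_topology Y) (shift_topology X) g"
    using g by (simp add: homeomorphic_maps_def)
  then show "continuous_map (shift_topology Y) (shift_topology X) (\<lambda>y\<in>Y. inv_into X f y)"
  proof (rule continuous_map_eq)
    fix y assume "y \<in> topspace (shift_topology Y)"
    then have y: "y \<in> Y" by simp
    then have "g y \<in> X" "f (g y) = y"
      using g by (auto simp: homeomorphic_maps_def continuous_map_def)
    then show "g y = (\<lambda>y\<in>Y. inv_into X f y) y"
      using y conjugacy_inv_into(1)[OF f, of "g y"] by simp
  qed
  show "bij_betw (\<lambda>y\<in>Y. inv_into X f y) Y X"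
    using bij_betw_inv_into[OF conjugacy_bij[OF f]] by (simp cong: bij_betw_cong)
  fix y assume y: "y \<in> Y"
  have sy: "shift_map y \<in> Y" using Y y by (auto simp: shift_space_def)
  have sx: "shift_map (inv_into X f y) \<in> X"
    using X conjugacy_inv_into(3)[OF f y] by (auto simp: shift_space_def)
  have "f (shift_map (inv_into X f y)) = shift_map y"
    using conjugacy_inv_into[OF f] f y by (simp add: conjugacy_def sliding_block_code_def)
  then have "inv_into X f (shift_map y) = shift_map (inv_into X f y)"
    using conjugacy_inv_into(1)[OF f sx] by simp
  then show "(\<lambda>y\<in>Y. inv_into X f y) (shift_map y) = shift_map ((\<lambda>y\<in>Y. inv_into X f y) y)"
    using y sy by simp
qed simp

lemma conjugacy_Bij: "conjugacy X X f \<Longrightarrow> f \<in> Bij X"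
  by (simp add: Bij_def conjugacy_def sliding_block_code_def)

section \<open>Automorphism groups and Galois groups\<close>

lemma subgroup_Aut_shift:
  assumes X: "shift_space X"
  shows "subgroup {f. conjugacy X X f} (BijGroup X)"
proof (rule group.subgroupI[OF group_BijGroup])
  show "{f. conjugacy X X f} \<subseteq> carrier (BijGroup X)" by (auto simp: BijGroup_def conjugacy_Bij)
  show "{f. conjugacy X X f} \<noteq> {}" using conjugacy_id[OF X] by auto
  show "inv\<^bsub>BijGroup X\<^esub> f \<in> {f. conjugacy X X f}" if "f \<in> {f. conjugacy X X f}" for f
    using that conjugacy_inverse[OF X X] by (simp add: inv_BijGroup conjugacy_Bij)
  show "f \<otimes>\<^bsub>BijGroup X\<^esub> g \<in> {f. conjugacy X X f}"
    if "f \<in> {f. conjugacy X X f}" "g \<in> {f. conjugacy X X f}" for f g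
    using that conjugacy_compose[OF X] by (simp add: BijGroup_def conjugacy_Bij)
qed

lemma group_Aut_shift: "shift_space X \<Longrightarrow> group (Aut_shift X)"
  unfolding Aut_shift_def
  by (intro group.subgroup_imp_group group_BijGroup subgroup_Aut_shift)

lemma carrier_Aut_shift [simp]: "carrier (Aut_shift X) = {f. conjugacy X X f}"
  by (simp add: Aut_shift_def)

lemma mult_Aut_shift: "\<lbrakk>conjugacy X X f; conjugacy X X g\<rbrakk> \<Longrightarrow> f \<otimes>\<^bsub>Aut_shift X\<^esub> g = compose X f g"
  by (simp add: Aut_shift_def BijGroup_def conjugacy_Bij)

lemma carrier_Gal:
  assumes "sliding_block_code Y X f"
  shows "\<phi> \<in> carrier (Gal Y f) \<longleftrightarrow> conjugacy Y Y \<phi> \<and> (\<forall>y\<in>Y. f (\<phi> y) = f y)"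
proof -
  have "compose Y f \<phi> = f \<longleftrightarrow> (\<forall>y\<in>Y. f (\<phi> y) = f y)"
  proof
    assume "compose Y f \<phi> = f"
    then show "\<forall>y\<in>Y. f (\<phi> y) = f y" by (metis compose_eq)
  next
    assume "\<forall>y\<in>Y. f (\<phi> y) = f y"
    then show "compose Y f \<phi> = f"
      using assms by (intro extensionalityI[of _ Y]) (auto simp: compose_eq sliding_block_code_def)
  qed
  then show ?thesis by (simp add: Gal_def)
qed

lemma mult_Gal:
  "\<lbrakk>conjugacy Y Y \<phi>; conjugacy Y Y \<psi>\<rbrakk> \<Longrightarrow> \<phi> \<otimes>\<^bsub>Gal Y f\<^esub> \<psi> = compose Y \<phi> \<psi>"
  by (simp add: Gal_def mult_Aut_shift)

lemma one_Gal: "\<one>\<^bsub>Gal Y f\<^esub> = (\<lambda>y\<in>Y. y)"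
  by (simp add: Gal_def Aut_shift_def BijGroup_def)

lemma group_Gal:
  assumes Y: "shift_space Y" and f: "sliding_block_code Y X f"
  shows "group (Gal Y f)"
proof -
  have sub: "subgroup (carrier (Gal Y f)) (BijGroup Y)"
  proof (rule group.subgroupI[OF group_BijGroup])
    show "carrier (Gal Y f) \<subseteq> carrier (BijGroup Y)"
      by (auto simp: BijGroup_def conjugacy_Bij carrier_Gal[OF f])
    have "(\<lambda>y\<in>Y. y) \<in> carrier (Gal Y f)" by (simp add: carrier_Gal[OF f] conjugacy_id[OF Y])
    then show "carrier (Gal Y f) \<noteq> {}" by blast
    show "inv\<^bsub>BijGroup Y\<^esub> \<phi> \<in> carrier (Gal Y f)" if "\<phi> \<in> carrier (Gal Y f)" for \<phi>
    proof -
      have \<phi>: "conjugacy Y Y \<phi>" "\<forall>y\<in>Y. f (\<phi> y) = f y" using that by (simp_all add: carrier_Gal[OF f])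
      have "f (inv_into Y \<phi> y) = f y" if "y \<in> Y" for y
        using \<phi>(2) conjugacy_inv_into[OF \<phi>(1)] that by metis
      then show ?thesis
        using \<phi> conjugacy_inverse[OF Y Y \<phi>(1)] by (simp add: carrier_Gal[OF f] inv_BijGroup conjugacy_Bij)
    qed
    show "\<phi> \<otimes>\<^bsub>BijGroup Y\<^esub> \<psi> \<in> carrier (Gal Y f)"
      if "\<phi> \<in> carrier (Gal Y f)" "\<psi> \<in> carrier (Gal Y f)" for \<phi> \<psi>
    proof -
      have *: "conjugacy Y Y \<phi>" "\<forall>y\<in>Y. f (\<phi> y) = f y" "conjugacy Y Y \<psi>" "\<forall>y\<in>Y. f (\<psi> y) = f y"
        using that by (simp_all add: carrier_Gal[OF f])
      then have "compose Y \<phi> \<psi> \<in> carrier (Gal Y f)"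
        by (auto simp: carrier_Gal[OF f] conjugacy_compose[OF Y] compose_eq conjugacy_in)
      then show ?thesis using * by (simp add: BijGroup_def conjugacy_Bij)
    qed
  qed
  have "Gal Y f = BijGroup Y \<lparr>carrier := carrier (Gal Y f)\<rparr>"
    by (simp add: Gal_def Aut_shift_def)
  then show ?thesis
    using group.subgroup_imp_group[OF group_BijGroup sub] by simp
qed

locale Galois_SFT =
  fixes Y :: "(int \<Rightarrow> 'a) set" and X :: "(int \<Rightarrow> 'b) set" and f :: "(int \<Rightarrow> 'a) \<Rightarrow> (int \<Rightarrow> 'b)"
  assumes Y_irr: "irreducible_SFT Y" and base_irr: "irreducible_SFT X" and Galois: "Galois_factor Y X f"

sublocale Galois_SFT \<subseteq> unramified_SFT Y X f
  using Y_irr base_irr Galois by unfold_locales (auto simp: irreducible_SFT_def Galois_factor_def)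

context Galois_SFT
begin

lemma Gal_iff: "\<phi> \<in> carrier (Gal Y f) \<longleftrightarrow> conjugacy Y Y \<phi> \<and> (\<forall>y\<in>Y. f (\<phi> y) = f y)"
  by (rule carrier_Gal[OF code])

text \<open>The action is free: elements of the group are maps over \<open>X\<close> from an
  irreducible SFT, so \<open>unique_code_over\<close> applies.\<close>

lemma Gal_eqI:
  assumes "\<phi> \<in> carrier (Gal Y f)" "\<psi> \<in> carrier (Gal Y f)" "y \<in> Y" "\<phi> y = \<psi> y"
  shows "\<phi> = \<psi>"
proof (rule sliding_block_code_eqI)
  show \<phi>: "sliding_block_code Y Y \<phi>" and \<psi>: "sliding_block_code Y Y \<psi>"
    using assms by (auto simp: Gal_iff conjugacy_code)
  show "\<phi> z = \<psi> z" if "z \<in> Y" for z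
    using assms by (intro unique_code_over[OF Y_irr \<phi> \<psi> _ assms(3,4) that]) (auto simp: Gal_iff)
qed

text \<open>The group acts freely on each fibre and has as many elements as the fibre.\<close>

lemma Gal_transitive:
  assumes "x \<in> X" "y \<in> fibre Y f x" "y' \<in> fibre Y f x"
  shows "\<exists>\<phi>\<in>carrier (Gal Y f). \<phi> y = y'"
proof -
  have y: "y \<in> Y" "f y = x" using assms by (auto simp: fibre_def)
  have inj: "inj_on (\<lambda>\<phi>. \<phi> y) (carrier (Gal Y f))"
    using Gal_eqI y by (auto simp: inj_on_def)
  have "(\<lambda>\<phi>. \<phi> y) ` carrier (Gal Y f) \<subseteq> fibre Y f x"
    using y by (auto simp: Gal_iff fibre_def conjugacy_in)
  moreover have "card ((\<lambda>\<phi>. \<phi> y) ` carrier (Gal Y f)) = card (fibre Y f x)"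
    using Galois fibre_card[OF assms(1)] by (simp add: card_image[OF inj] Galois_factor_def)
  ultimately have "(\<lambda>\<phi>. \<phi> y) ` carrier (Gal Y f) = fibre Y f x"
    by (intro card_subset_eq finite_fibre assms(1))
  then have "y' \<in> (\<lambda>\<phi>. \<phi> y) ` carrier (Gal Y f)" using assms(3) by simp
  then obtain \<phi> where "y' = \<phi> y" "\<phi> \<in> carrier (Gal Y f)" by (rule imageE)
  then show ?thesis by (intro bexI[of _ \<phi>]) simp_all
qed

end

section \<open>Pointed covers\<close>

lemma extensional_eq_compose_iff:
  "f \<in> extensional A \<Longrightarrow> f = compose A g h \<longleftrightarrow> (\<forall>x\<in>A. f x = g (h x))"
  by (auto simp: compose_def extensional_def fun_eq_iff restrict_def)

lemma sliding_block_code_extensional: "sliding_block_code X Y f \<Longrightarrow> f \<in> extensional X"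
  by (simp add: sliding_block_code_def)

locale pointed_SFT =
  fixes X :: "(int \<Rightarrow> 'a) set" and x0 :: "int \<Rightarrow> 'a"
  assumes X_irr: "irreducible_SFT X" and x0: "x0 \<in> X"
begin

lemma X_shift_space: "shift_space X"
  using X_irr by (simp add: irreducible_SFT_def sft_shift_space)

abbreviation "covers \<equiv> pointed_Galois_factors X x0"

lemma cover_Galois: "t \<in> covers \<Longrightarrow> Galois_SFT (total_space t) X (covering t)"
  using X_irr by (simp add: pointed_Galois_factors_def Galois_SFT_def)

lemma cover_irr: "t \<in> covers \<Longrightarrow> irreducible_SFT (total_space t)"
  and cover_base: "t \<in> covers \<Longrightarrow> base_point t \<in> total_space t"
  and cover_base_image: "t \<in> covers \<Longrightarrow> covering t (base_point t) = x0"
  by (simp_all add: pointed_Galois_factors_def)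

lemma cover_SFT: "t \<in> covers \<Longrightarrow> shift_of_finite_type (total_space t)"
  and cover_shift: "t \<in> covers \<Longrightarrow> shift_space (total_space t)"
  using cover_irr by (auto simp: irreducible_SFT_def sft_shift_space)

lemma cover_unramified: "t \<in> covers \<Longrightarrow> unramified_SFT (total_space t) X (covering t)"
  using cover_Galois Galois_SFT_def by (metis Galois_SFT.Y_irr X_irr Galois_factor_def Galois_SFT.Galois irreducible_SFT_def unramified_SFT.intro)

lemma cover_code: "t \<in> covers \<Longrightarrow> sliding_block_code (total_space t) X (covering t)"
  using unramified_SFT.code[OF cover_unramified] .

lemma pointed_conjugacy_iff:
  assumes "s \<in> covers"
  shows "pointed_conjugacy s t \<gamma> \<longleftrightarrow> conjugacy (total_space s) (total_space t) \<gamma> \<and>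
    \<gamma> (base_point s) = base_point t \<and> (\<forall>y\<in>total_space s. covering t (\<gamma> y) = covering s y)"
  using extensional_eq_compose_iff[OF sliding_block_code_extensional[OF cover_code[OF assms]], of "covering t" \<gamma>]
  unfolding pointed_conjugacy_def by auto

lemma pointed_conjugacy_id:
  assumes "t \<in> covers"
  shows "pointed_conjugacy t t (\<lambda>y\<in>total_space t. y)"
  using assms by (simp add: pointed_conjugacy_iff conjugacy_id cover_shift cover_base)

lemma pointed_conjugacy_inverse:
  assumes s: "s \<in> covers" and t: "t \<in> covers" and \<gamma>: "pointed_conjugacy s t \<gamma>"
  shows "pointed_conjugacy t s (\<lambda>y\<in>total_space t. inv_into (total_space s) \<gamma> y)"
proof -
  have \<gamma>': "conjugacy (total_space s) (total_space t) \<gamma>" "\<gamma> (base_point s) = base_point t"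
    "\<forall>y\<in>total_space s. covering t (\<gamma> y) = covering s y"
    using \<gamma> by (auto simp: pointed_conjugacy_iff[OF s])
  have "inv_into (total_space s) \<gamma> (base_point t) = base_point s"
    using conjugacy_inv_into(1)[OF \<gamma>'(1) cover_base[OF s]] \<gamma>'(2) by simp
  moreover have "covering s (inv_into (total_space s) \<gamma> y) = covering t y" if "y \<in> total_space t" for y
    using \<gamma>'(3) conjugacy_inv_into(2,3)[OF \<gamma>'(1) that] by metis
  ultimately show ?thesis
    using conjugacy_inverse[OF cover_shift[OF s] cover_shift[OF t] \<gamma>'(1)] cover_base[OF t]
    by (simp add: pointed_conjugacy_iff[OF t])
qed

lemma pointed_conjugacy_compose:
  assumes s: "s \<in> covers" and t: "t \<in> covers"
    and \<gamma>: "pointed_conjugacy s t \<gamma>" and \<delta>: "pointed_conjugacy t u \<delta>"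
  shows "pointed_conjugacy s u (compose (total_space s) \<delta> \<gamma>)"
  using assms cover_base[OF s] conjugacy_compose[OF cover_shift[OF s]]
  by (auto simp: pointed_conjugacy_iff[OF s] pointed_conjugacy_iff[OF t] compose_eq conjugacy_in)

text \<open>Pinning the base points removes all freedom; this gives meaning to the description of
  \<open>\<theta>\<close> in \<open>component_at\<close>.\<close>

lemma pointed_conjugacy_unique:
  assumes s: "s \<in> covers" and t: "t \<in> covers"
    and "pointed_conjugacy s t \<gamma>" "pointed_conjugacy s t \<delta>"
  shows "\<gamma> = \<delta>"
proof -
  interpret unramified_SFT "total_space t" X "covering t" using t by (rule cover_unramified)
  have *: "conjugacy (total_space s) (total_space t) \<gamma>" "\<gamma> (base_point s) = base_point t"
    "\<forall>y\<in>total_space s. covering t (\<gamma> y) = covering s y"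
    "conjugacy (total_space s) (total_space t) \<delta>" "\<delta> (base_point s) = base_point t"
    "\<forall>y\<in>total_space s. covering t (\<delta> y) = covering s y"
    using assms by (auto simp: pointed_conjugacy_iff[OF s])
  have codes: "sliding_block_code (total_space s) (total_space t) \<gamma>"
    "sliding_block_code (total_space s) (total_space t) \<delta>"
    using * by (auto intro: conjugacy_code)
  show ?thesis
    by (rule sliding_block_code_eqI[OF codes], rule unique_code_over[OF cover_irr[OF s] codes _ cover_base[OF s]])
      (use * in simp_all)
qed

lemma equiv_covers: "equiv covers (pointed_equiv X x0)"
proof (rule equivI)
  show "pointed_equiv X x0 \<subseteq> covers \<times> covers" by (auto simp: pointed_equiv_def)
  show "refl_on covers (pointed_equiv X x0)"
    using pointed_conjugacy_id by (auto simp: refl_on_def pointed_equiv_def)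
  show "sym (pointed_equiv X x0)"
    using pointed_conjugacy_inverse unfolding sym_def pointed_equiv_def by blast
  show "trans (pointed_equiv X x0)"
    using pointed_conjugacy_compose unfolding trans_def pointed_equiv_def by blast
qed

end

section \<open>The tower of representatives and its transition maps\<close>

locale Galois_tower = pointed_SFT X x0 for X :: "(int \<Rightarrow> 'a) set" and x0 +
  fixes R :: "'a reps"
  assumes R: "\<forall>i\<in>Galois_classes X x0. R i \<in> i"
begin

abbreviation "idx \<equiv> Galois_classes X x0"
abbreviation "Y i \<equiv> total_space (R i)"
abbreviation "base i \<equiv> base_point (R i)"
abbreviation "cov i \<equiv> covering (R i)"
abbreviation "G \<equiv> absolute_Galois X x0 R"
abbreviation "F \<equiv> limit_fibre X x0 R"

lemma R_cover: "i \<in> idx \<Longrightarrow> R i \<in> covers"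
  using R in_quotient_imp_subset[OF equiv_covers] unfolding Galois_classes_def by blast

lemma class_of_R:
  assumes "i \<in> idx"
  shows "pointed_equiv X x0 `` {R i} = i"
proof -
  obtain t where "i = pointed_equiv X x0 `` {t}" "t \<in> covers"
    using assms unfolding Galois_classes_def by (elim quotientE)
  moreover have "R i \<in> i" using R assms by blast
  ultimately show ?thesis using equiv_class_eq[OF equiv_covers, of t "R i"] by auto
qed

lemma representative_exists:
  assumes "t \<in> covers"
  shows "\<exists>i\<in>idx. \<exists>\<theta>. pointed_conjugacy (R i) t \<theta>"
proof -
  let ?i = "pointed_equiv X x0 `` {t}"
  have i: "?i \<in> idx" using assms by (auto simp: Galois_classes_def intro: quotientI)
  then have "R ?i \<in> ?i" using R by blast
  then have "(t, R ?i) \<in> pointed_equiv X x0" by simp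
  then have "(R ?i, t) \<in> pointed_equiv X x0"
    using equiv_covers by (meson equivE symE)
  then show ?thesis using i by (auto simp: pointed_equiv_def)
qed

text \<open>A pointed conjugacy from \<open>R i\<close> to \<open>t\<close> shows that
  \<open>t\<close> has class \<open>i\<close>, and it is the only such map; so any one that has been
  found may replace the description.\<close>

lemma component_at_eq:
  assumes t: "t \<in> covers" and i: "i \<in> idx" and \<theta>: "pointed_conjugacy (R i) t \<theta>"
  shows "component_at X x0 R g t =
    compose (total_space t) \<theta> (compose (total_space t) (g i) (inv_into (Y i) \<theta>))"
proof -
  have "(R i, t) \<in> pointed_equiv X x0" using t \<theta> R_cover[OF i] by (auto simp: pointed_equiv_def)
  then have "pointed_equiv X x0 `` {t} = i"
    using equiv_class_eq[OF equiv_covers] class_of_R[OF i] by metis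
  moreover have "(THE \<theta>. pointed_conjugacy (R i) t \<theta>) = \<theta>"
    using \<theta> pointed_conjugacy_unique[OF R_cover[OF i] t] by blast
  ultimately show ?thesis by (simp add: component_at_def)
qed

lemma is_transition_iff:
  assumes "j \<in> idx"
  shows "is_transition R i j \<alpha> \<longleftrightarrow> unramified (Y j) (Y i) \<alpha> \<and> \<alpha> (base j) = base i \<and>
    (\<forall>y\<in>Y j. cov i (\<alpha> y) = cov j y)"
  using extensional_eq_compose_iff[OF sliding_block_code_extensional[OF cover_code[OF R_cover[OF assms]]], of "cov i" \<alpha>]
  unfolding is_transition_def by auto

lemma transition_code:
  "is_transition R i j \<alpha> \<Longrightarrow> sliding_block_code (Y j) (Y i) \<alpha>"
  by (simp add: is_transition_def unramified_def factor_map_def)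

lemma transition_eq:
  assumes i: "i \<in> idx" and j: "j \<in> idx" and \<alpha>: "is_transition R i j \<alpha>"
  shows "transition R i j = \<alpha>"
  unfolding transition_def
proof (rule the_equality[where P = "is_transition R i j", OF \<alpha>])
  fix \<beta> assume \<beta>: "is_transition R i j \<beta>"
  interpret unramified_SFT "Y i" X "cov i" using R_cover[OF i] by (rule cover_unramified)
  note codes = transition_code[OF \<beta>] transition_code[OF \<alpha>]
  show "\<beta> = \<alpha>"
    by (rule sliding_block_code_eqI[OF codes],
        rule unique_code_over[OF cover_irr[OF R_cover[OF j]] codes _ cover_base[OF R_cover[OF j]]])
      (use \<alpha> \<beta> in \<open>simp_all add: is_transition_iff[OF j]\<close>)
qed

lemma rep_Gal_iff:
  assumes "i \<in> idx"
  shows "\<phi> \<in> carrier (rep_Gal R i) \<longleftrightarrow> conjugacy (Y i) (Y i) \<phi> \<and> (\<forall>y\<in>Y i. cov i (\<phi> y) = cov i y)"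
  unfolding rep_Gal_def by (rule carrier_Gal[OF cover_code[OF R_cover[OF assms]]])

lemma rep_Gal_eqI:
  assumes "i \<in> idx" "\<phi> \<in> carrier (rep_Gal R i)" "\<psi> \<in> carrier (rep_Gal R i)" "y \<in> Y i" "\<phi> y = \<psi> y"
  shows "\<phi> = \<psi>"
  using Galois_SFT.Gal_eqI[OF cover_Galois[OF R_cover[OF assms(1)]]] assms(2-) unfolding rep_Gal_def by blast

lemma rep_Gal_transitive:
  assumes "i \<in> idx" "x \<in> X" "y \<in> fibre (Y i) (cov i) x" "y' \<in> fibre (Y i) (cov i) x"
  shows "\<exists>\<phi>\<in>carrier (rep_Gal R i). \<phi> y = y'"
  using Galois_SFT.Gal_transitive[OF cover_Galois[OF R_cover[OF assms(1)]]] assms(2-) unfolding rep_Gal_def by blast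

text \<open>\<open>\<psi> \<circ> \<alpha>\<close> and \<open>\<alpha> \<circ> \<phi>\<close> are
  maps from \<open>Y j\<close> to \<open>Y i\<close> over \<open>X\<close>; agreement at one point
  therefore propagates.\<close>

lemma over_transition:
  assumes i: "i \<in> idx" and j: "j \<in> idx" and \<alpha>: "is_transition R i j \<alpha>"
    and \<phi>: "\<phi> \<in> carrier (rep_Gal R j)" and \<psi>: "\<psi> \<in> carrier (rep_Gal R i)"
    and y0: "y0 \<in> Y j" "\<psi> (\<alpha> y0) = \<alpha> (\<phi> y0)" and y: "y \<in> Y j"
  shows "\<psi> (\<alpha> y) = \<alpha> (\<phi> y)"
proof -
  interpret unramified_SFT "Y i" X "cov i" using R_cover[OF i] by (rule cover_unramified)
  have Yj: "shift_space (Y j)" using R_cover[OF j] by (rule cover_shift)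
  have \<phi>': "conjugacy (Y j) (Y j) \<phi>" "\<forall>y\<in>Y j. cov j (\<phi> y) = cov j y" using \<phi> by (simp_all add: rep_Gal_iff[OF j])
  have \<psi>': "conjugacy (Y i) (Y i) \<psi>" "\<forall>y\<in>Y i. cov i (\<psi> y) = cov i y" using \<psi> by (simp_all add: rep_Gal_iff[OF i])
  have \<alpha>c: "\<forall>y\<in>Y j. cov i (\<alpha> y) = cov j y" using \<alpha> by (simp add: is_transition_iff[OF j])
  have c1: "sliding_block_code (Y j) (Y i) (compose (Y j) \<psi> \<alpha>)"
    by (rule sliding_block_code_compose[OF Yj transition_code[OF \<alpha>] conjugacy_code[OF \<psi>'(1)]])
  have c2: "sliding_block_code (Y j) (Y i) (compose (Y j) \<alpha> \<phi>)"
    by (rule sliding_block_code_compose[OF Yj conjugacy_code[OF \<phi>'(1)] transition_code[OF \<alpha>]])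
  have "compose (Y j) \<psi> \<alpha> y = compose (Y j) \<alpha> \<phi> y"
  proof (rule unique_code_over[OF cover_irr[OF R_cover[OF j]] c1 c2 _ y0(1) _ y])
    show "cov i (compose (Y j) \<psi> \<alpha> z) = cov i (compose (Y j) \<alpha> \<phi> z)" if "z \<in> Y j" for z
      using that \<phi>' \<psi>' \<alpha>c sliding_block_code_in[OF transition_code[OF \<alpha>] that] conjugacy_in[OF \<phi>'(1) that]
      by (simp add: compose_eq)
    show "compose (Y j) \<psi> \<alpha> y0 = compose (Y j) \<alpha> \<phi> y0" using y0 by (simp add: compose_eq)
  qed
  then show ?thesis using y by (simp add: compose_eq)
qed

text \<open>The image of \<open>\<phi>\<close> exists because the Galois group is transitive on
  fibres: some \<open>\<psi>0\<close> has the right value at the image of the base point, and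
  \<open>over_transition\<close> does the rest. Freeness gives uniqueness.\<close>

lemma Gal_transition_iff:
  assumes i: "i \<in> idx" and j: "j \<in> idx" and \<alpha>: "is_transition R i j \<alpha>"
    and \<phi>: "\<phi> \<in> carrier (rep_Gal R j)" and \<psi>: "\<psi> \<in> carrier (rep_Gal R i)"
  shows "Gal_transition R i j \<phi> = \<psi> \<longleftrightarrow> (\<forall>y\<in>Y j. \<psi> (\<alpha> y) = \<alpha> (\<phi> y))"
proof -
  have b: "base j \<in> Y j" using R_cover[OF j] by (rule cover_base)
  have tr: "transition R i j = \<alpha>" by (rule transition_eq[OF i j \<alpha>])
  have \<alpha>in: "\<alpha> y \<in> Y i" if "y \<in> Y j" for y using sliding_block_code_in[OF transition_code[OF \<alpha>] that] .
  let ?P = "\<lambda>\<psi>. \<psi> \<in> carrier (rep_Gal R i) \<and> (\<forall>y\<in>Y j. \<psi> (\<alpha> y) = \<alpha> (\<phi> y))"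
  have P_eq: "(\<psi> \<in> carrier (rep_Gal R i) \<and> compose (Y j) \<psi> (transition R i j) = compose (Y j) (transition R i j) \<phi>)
     \<longleftrightarrow> ?P \<psi>" for \<psi>
    unfolding tr using extensional_eq_compose_iff[OF compose_extensional, of "Y j" \<psi> \<alpha> \<alpha> \<phi>] by (simp add: compose_eq)
  have uniq: "\<psi>1 = \<psi>2" if "?P \<psi>1" "?P \<psi>2" for \<psi>1 \<psi>2
    using rep_Gal_eqI[OF i, of \<psi>1 \<psi>2 "\<alpha> (base j)"] that b \<alpha>in by auto
  have \<phi>': "conjugacy (Y j) (Y j) \<phi>" "\<forall>y\<in>Y j. cov j (\<phi> y) = cov j y" using \<phi> by (simp_all add: rep_Gal_iff[OF j])
  have \<alpha>c: "\<forall>y\<in>Y j. cov i (\<alpha> y) = cov j y" using \<alpha> by (simp add: is_transition_iff[OF j])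
  have "\<exists>\<psi>0\<in>carrier (rep_Gal R i). \<psi>0 (\<alpha> (base j)) = \<alpha> (\<phi> (base j))"
    by (rule rep_Gal_transitive[OF i, of "cov j (base j)"])
      (use b \<phi>' \<alpha>c \<alpha>in conjugacy_in[OF \<phi>'(1) b] sliding_block_code_in[OF cover_code[OF R_cover[OF j]] b]
        in \<open>simp_all add: fibre_def\<close>)
  then obtain \<psi>0 where \<psi>0: "\<psi>0 \<in> carrier (rep_Gal R i)" "\<psi>0 (\<alpha> (base j)) = \<alpha> (\<phi> (base j))" by blast
  then have P0: "?P \<psi>0" using over_transition[OF i j \<alpha> \<phi> \<psi>0(1) b] by blast
  have "Gal_transition R i j \<phi> = (THE \<psi>. ?P \<psi>)" unfolding Gal_transition_def P_eq ..
  also have "\<dots> = \<psi>0"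
    by (rule the_equality[where P = ?P, OF P0]) (rule uniq[OF _ P0])
  finally have eq: "Gal_transition R i j \<phi> = \<psi>0" .
  show ?thesis
  proof
    assume "Gal_transition R i j \<phi> = \<psi>"
    then show "\<forall>y\<in>Y j. \<psi> (\<alpha> y) = \<alpha> (\<phi> y)" using P0 eq by simp
  next
    assume "\<forall>y\<in>Y j. \<psi> (\<alpha> y) = \<alpha> (\<phi> y)"
    then have "\<psi>0 = \<psi>" using uniq[OF P0] \<psi> by simp
    then show "Gal_transition R i j \<phi> = \<psi>" using eq by simp
  qed
qed

text \<open>The form used from here on: the order and the descriptions of the transition maps are
  gone, and an element is a family that commutes with every transition map.\<close>

lemma carrier_absolute_Galois:
  "g \<in> carrier G \<longleftrightarrow> g \<in> (\<Pi>\<^sub>E i\<in>idx. carrier (rep_Gal R i)) \<and>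
    (\<forall>i\<in>idx. \<forall>j\<in>idx. \<forall>\<alpha>. is_transition R i j \<alpha> \<longrightarrow> (\<forall>y\<in>Y j. g i (\<alpha> y) = \<alpha> (g j y)))"
proof -
  have "(class_le R i j \<longrightarrow> Gal_transition R i j (g j) = g i) \<longleftrightarrow>
      (\<forall>\<alpha>. is_transition R i j \<alpha> \<longrightarrow> (\<forall>y\<in>Y j. g i (\<alpha> y) = \<alpha> (g j y)))"
    if g: "g \<in> (\<Pi>\<^sub>E i\<in>idx. carrier (rep_Gal R i))" and i: "i \<in> idx" and j: "j \<in> idx" for i j
    using Gal_transition_iff[OF i j _ PiE_mem[OF g j] PiE_mem[OF g i]] unfolding class_le_def by blast
  then show ?thesis unfolding absolute_Galois_def by auto
qed

lemma limit_fibre_iff: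
  "\<xi> \<in> F x \<longleftrightarrow> \<xi> \<in> (\<Pi>\<^sub>E i\<in>idx. fibre (Y i) (cov i) x) \<and>
    (\<forall>i\<in>idx. \<forall>j\<in>idx. \<forall>\<alpha>. is_transition R i j \<alpha> \<longrightarrow> \<alpha> (\<xi> j) = \<xi> i)"
proof -
  have "(class_le R i j \<longrightarrow> transition R i j (\<xi> j) = \<xi> i) \<longleftrightarrow> (\<forall>\<alpha>. is_transition R i j \<alpha> \<longrightarrow> \<alpha> (\<xi> j) = \<xi> i)"
    if i: "i \<in> idx" and j: "j \<in> idx" for i j
    using transition_eq[OF i j] unfolding class_le_def by metis
  then show ?thesis unfolding limit_fibre_def by auto
qed

end

section \<open>Limit fibres and the absolute Galois group\<close>

context Galois_tower
begin

section \<open>Threads over arbitrary points\<close>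

lemma cov_unramified: "i \<in> idx \<Longrightarrow> unramified_SFT (Y i) X (cov i)"
  using R_cover by (rule cover_unramified)

lemma cov_code: "i \<in> idx \<Longrightarrow> sliding_block_code (Y i) X (cov i)"
  using R_cover by (rule cover_code)

lemma Y_shift_space: "i \<in> idx \<Longrightarrow> shift_space (Y i)"
  and Y_of_finite_type: "i \<in> idx \<Longrightarrow> shift_of_finite_type (Y i)"
  and base_in: "i \<in> idx \<Longrightarrow> base i \<in> Y i"
  using R_cover cover_shift cover_SFT cover_base by auto

lemma cov_in: "\<lbrakk>i \<in> idx; y \<in> Y i\<rbrakk> \<Longrightarrow> cov i y \<in> X"
  using cov_code sliding_block_code_in by blast

lemma transition_in: "\<lbrakk>is_transition R i j \<alpha>; y \<in> Y j\<rbrakk> \<Longrightarrow> \<alpha> y \<in> Y i"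
  using transition_code sliding_block_code_in by blast

lemma limit_fibre_comp:
  assumes "\<xi> \<in> F x" "i \<in> idx"
  shows "\<xi> i \<in> Y i" "cov i (\<xi> i) = x"
  using assms PiE_mem[of \<xi> idx "\<lambda>i. fibre (Y i) (cov i) x" i] by (auto simp: limit_fibre_iff fibre_def)

lemma base_thread: "(\<lambda>i\<in>idx. base i) \<in> F x0"
  unfolding limit_fibre_iff
  using cover_base[OF R_cover] cover_base_image[OF R_cover]
  by (auto simp: fibre_def is_transition_def)

text \<open>The components are lifted independently, with a bound that may vary with
  \<open>i\<close>. Compatibility is automatic: \<open>\<alpha> (\<zeta> j)\<close> and
  \<open>\<zeta> i\<close> both lie over \<open>v\<close> and are asymptotic to
  \<open>\<xi> i\<close>, so they coincide by \<open>asymptotic_unique\<close>.\<close>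

lemma limit_fibre_asymptotic:
  assumes u: "u \<in> X" "F u \<noteq> {}" and v: "v \<in> X" and s: "s = 1 \<or> s = (-1::int)"
    and eq: "\<And>k. c \<le> k \<Longrightarrow> v (s * k) = u (s * k)"
  shows "F v \<noteq> {}"
proof -
  obtain \<xi> where \<xi>: "\<xi> \<in> F u" using u(2) by blast
  have ex: "\<exists>y. y \<in> fibre (Y i) (cov i) v \<and> (\<exists>c. \<forall>k\<ge>c. y (s * k) = \<xi> i (s * k))" if i: "i \<in> idx" for i
  proof -
    interpret unramified_SFT "Y i" X "cov i" using i by (rule cov_unramified)
    show ?thesis
      using asymptotic_lift[OF limit_fibre_comp(1)[OF \<xi> i] v s, of c] eq
      by (auto simp: limit_fibre_comp(2)[OF \<xi> i])
  qed
  define \<zeta> where "\<zeta> = (\<lambda>i\<in>idx. SOME y. y \<in> fibre (Y i) (cov i) v \<and> (\<exists>c. \<forall>k\<ge>c. y (s * k) = \<xi> i (s * k)))"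
  have \<zeta>: "\<zeta> i \<in> fibre (Y i) (cov i) v" "\<exists>c. \<forall>k\<ge>c. \<zeta> i (s * k) = \<xi> i (s * k)" if "i \<in> idx" for i
    using someI_ex[OF ex[OF that]] that by (simp_all add: \<zeta>_def)
  have "\<alpha> (\<zeta> j) = \<zeta> i" if i: "i \<in> idx" and j: "j \<in> idx" and \<alpha>: "is_transition R i j \<alpha>" for i j \<alpha>
  proof -
    interpret unramified_SFT "Y i" X "cov i" using i by (rule cov_unramified)
    have \<zeta>j: "\<zeta> j \<in> Y j" "cov j (\<zeta> j) = v" using \<zeta>(1)[OF j] by (simp_all add: fibre_def)
    obtain c1 where c1: "\<forall>k\<ge>c1. \<zeta> j (s * k) = \<xi> j (s * k)" using \<zeta>(2)[OF j] by blast
    have "\<exists>c'. \<forall>k\<ge>c'. \<alpha> (\<zeta> j) (s * k) = \<alpha> (\<xi> j) (s * k)"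
      by (rule sliding_block_code_asymptotic[OF Y_of_finite_type[OF j] transition_code[OF \<alpha>] \<zeta>j(1)
            limit_fibre_comp(1)[OF \<xi> j] s, of c1]) (use c1 in simp)
    then obtain c2 where c2: "\<forall>k\<ge>c2. \<alpha> (\<zeta> j) (s * k) = \<alpha> (\<xi> j) (s * k)" by blast
    obtain c3 where c3: "\<forall>k\<ge>c3. \<zeta> i (s * k) = \<xi> i (s * k)" using \<zeta>(2)[OF i] by blast
    have \<alpha>\<xi>: "\<alpha> (\<xi> j) = \<xi> i" using \<xi> i j \<alpha> by (simp add: limit_fibre_iff)
    have "\<alpha> (\<zeta> j) \<in> fibre (Y i) (cov i) v"
      using \<alpha> \<zeta>j transition_in[OF \<alpha> \<zeta>j(1)] by (simp add: fibre_def is_transition_iff[OF j])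
    then show ?thesis
      by (rule asymptotic_unique[OF v _ \<zeta>(1)[OF i] s, of _ "max c2 c3"]) (use c2 c3 \<alpha>\<xi> in simp)
  qed
  then have "\<zeta> \<in> F v"
    unfolding limit_fibre_iff using \<zeta>(1) by (auto simp: \<zeta>_def)
  then show ?thesis by blast
qed

lemma limit_fibre_shift:
  assumes "x \<in> X" "F x \<noteq> {}"
  shows "F (shift_by m x) \<noteq> {}"
proof -
  obtain \<xi> where \<xi>: "\<xi> \<in> F x" using assms(2) by blast
  have "(\<lambda>i\<in>idx. shift_by m (\<xi> i)) \<in> F (shift_by m x)"
    unfolding limit_fibre_iff
  proof (intro conjI ballI allI impI)
    have "shift_by m (\<xi> i) \<in> fibre (Y i) (cov i) (shift_by m x)" if i: "i \<in> idx" for i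
      using \<xi> i by (intro shift_by_fibre[OF Y_shift_space[OF i] cov_code[OF i]]) (auto simp: limit_fibre_iff PiE_iff)
    then show "(\<lambda>i\<in>idx. shift_by m (\<xi> i)) \<in> (\<Pi>\<^sub>E i\<in>idx. fibre (Y i) (cov i) (shift_by m x))"
      by auto
    fix i j \<alpha> assume i: "i \<in> idx" and j: "j \<in> idx" and \<alpha>: "is_transition R i j \<alpha>"
    have "\<alpha> (\<xi> j) = \<xi> i" using \<xi> i j \<alpha> by (simp add: limit_fibre_iff)
    then show "\<alpha> ((\<lambda>i\<in>idx. shift_by m (\<xi> i)) j) = (\<lambda>i\<in>idx. shift_by m (\<xi> i)) i"
      using i j sliding_block_code_shift_by[OF Y_shift_space[OF j] transition_code[OF \<alpha>] limit_fibre_comp(1)[OF \<xi> j]]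
      by simp
  qed
  then show ?thesis by blast
qed

text \<open>Threads are transported from \<open>x0\<close> to \<open>x\<close> by lifting along a point that is left
  asymptotic to \<open>x0\<close> and, after a shift, right asymptotic to \<open>x\<close>.\<close>

lemma limit_fibre_nonempty:
  assumes x: "x \<in> X"
  shows "F x \<noteq> {}"
proof -
  obtain w m where w: "w \<in> X" "\<forall>k\<le>0. w k = x0 k" "\<forall>k\<ge>0. w (m + k) = x k"
    using irreducible_SFT_glue[OF X_irr x0 x] by blast
  have "F x0 \<noteq> {}" using base_thread by blast
  then have "F w \<noteq> {}"
    by (rule limit_fibre_asymptotic[OF x0 _ w(1), of "-1" 0]) (use w(2) in auto)
  then have Fw: "F (shift_by m w) \<noteq> {}" by (rule limit_fibre_shift[OF w(1)])
  show ?thesis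
    by (rule limit_fibre_asymptotic[OF shift_space_shift_by[OF X_shift_space w(1)] Fw x, of 1 0])
      (use w(3) in \<open>auto simp: add.commute\<close>)
qed

section \<open>The group structure of the inverse limit\<close>

lemma rep_Gal_group: "i \<in> idx \<Longrightarrow> group (rep_Gal R i)"
  unfolding rep_Gal_def by (rule group_Gal[OF Y_shift_space cov_code])

lemma rep_Gal_conjugacy: "\<lbrakk>i \<in> idx; \<phi> \<in> carrier (rep_Gal R i)\<rbrakk> \<Longrightarrow> conjugacy (Y i) (Y i) \<phi>"
  by (simp add: rep_Gal_iff)

lemma rep_Gal_mult_apply:
  assumes "i \<in> idx" "\<phi> \<in> carrier (rep_Gal R i)" "\<psi> \<in> carrier (rep_Gal R i)" "y \<in> Y i"
  shows "(\<phi> \<otimes>\<^bsub>rep_Gal R i\<^esub> \<psi>) y = \<phi> (\<psi> y)"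
  using assms rep_Gal_conjugacy[OF assms(1)] by (simp add: rep_Gal_def mult_Gal compose_eq)

lemma rep_Gal_inv_apply:
  assumes i: "i \<in> idx" and \<phi>: "\<phi> \<in> carrier (rep_Gal R i)" and y: "y \<in> Y i"
  shows "(inv\<^bsub>rep_Gal R i\<^esub> \<phi>) (\<phi> y) = y"
proof -
  interpret group "rep_Gal R i" using i by (rule rep_Gal_group)
  have "(inv\<^bsub>rep_Gal R i\<^esub> \<phi> \<otimes>\<^bsub>rep_Gal R i\<^esub> \<phi>) y = y"
    using \<phi> y by (simp add: l_inv) (simp add: rep_Gal_def one_Gal)
  then show ?thesis using rep_Gal_mult_apply[OF i inv_closed[OF \<phi>] \<phi> y] by simp
qed

lemma G_comp: "\<lbrakk>g \<in> carrier G; i \<in> idx\<rbrakk> \<Longrightarrow> g i \<in> carrier (rep_Gal R i)"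
  by (auto simp: carrier_absolute_Galois)

lemma G_comp_in: "\<lbrakk>g \<in> carrier G; i \<in> idx; y \<in> Y i\<rbrakk> \<Longrightarrow> g i y \<in> Y i"
  using G_comp rep_Gal_conjugacy conjugacy_in by blast

lemma G_transition:
  "\<lbrakk>g \<in> carrier G; i \<in> idx; j \<in> idx; is_transition R i j \<alpha>; y \<in> Y j\<rbrakk> \<Longrightarrow> g i (\<alpha> y) = \<alpha> (g j y)"
  by (simp add: carrier_absolute_Galois)

text \<open>By freeness at each level, one test point for each index decides.\<close>

lemma G_eqI:
  assumes "g \<in> carrier G" "h \<in> carrier G" "\<And>i. i \<in> idx \<Longrightarrow> \<exists>y\<in>Y i. g i y = h i y"
  shows "g = h"
proof (rule PiE_ext)
  show "g \<in> (\<Pi>\<^sub>E i\<in>idx. carrier (rep_Gal R i))" "h \<in> (\<Pi>\<^sub>E i\<in>idx. carrier (rep_Gal R i))"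
    using assms by (auto simp: carrier_absolute_Galois)
  fix i assume "i \<in> idx"
  then show "g i = h i" using assms(3)[of i] rep_Gal_eqI G_comp[OF assms(1)] G_comp[OF assms(2)] by blast
qed

lemma subgroup_G: "subgroup (carrier G) (product_group idx (rep_Gal R))"
proof -
  let ?P = "product_group idx (rep_Gal R)"
  have P: "group ?P" by (intro product_group rep_Gal_group)
  interpret P: group ?P by (rule P)
  have carr: "g \<in> carrier G \<Longrightarrow> g \<in> carrier ?P" for g by (simp add: carrier_absolute_Galois)
  show ?thesis
  proof (rule P.subgroupI)
    show "carrier G \<subseteq> carrier ?P" using carr by blast
    have "\<one>\<^bsub>?P\<^esub> \<in> carrier G"
      unfolding carrier_absolute_Galois
    proof (intro conjI ballI allI impI)
      show "\<one>\<^bsub>?P\<^esub> \<in> (\<Pi>\<^sub>E i\<in>idx. carrier (rep_Gal R i))" using P.one_closed by simp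
      show "\<one>\<^bsub>?P\<^esub> i (\<alpha> y) = \<alpha> (\<one>\<^bsub>?P\<^esub> j y)"
        if "i \<in> idx" "j \<in> idx" "is_transition R i j \<alpha>" "y \<in> Y j" for i j \<alpha> y
        using that transition_in[OF that(3,4)] by (simp add: rep_Gal_def one_Gal)
    qed
    then show "carrier G \<noteq> {}" by blast
    show "g \<otimes>\<^bsub>?P\<^esub> h \<in> carrier G" if g: "g \<in> carrier G" and h: "h \<in> carrier G" for g h
      unfolding carrier_absolute_Galois
    proof (intro conjI ballI allI impI)
      show "g \<otimes>\<^bsub>?P\<^esub> h \<in> (\<Pi>\<^sub>E i\<in>idx. carrier (rep_Gal R i))"
        using P.m_closed[OF carr[OF g] carr[OF h]] by simp
      fix i j \<alpha> y assume a: "i \<in> idx" "j \<in> idx" "is_transition R i j \<alpha>" "y \<in> Y j"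
      show "(g \<otimes>\<^bsub>?P\<^esub> h) i (\<alpha> y) = \<alpha> ((g \<otimes>\<^bsub>?P\<^esub> h) j y)"
        using a g h by (simp add: rep_Gal_mult_apply G_comp transition_in[OF a(3,4)] G_comp_in
            G_transition[OF h a] G_transition[OF g a(1-3)])
    qed
    show "inv\<^bsub>?P\<^esub> g \<in> carrier G" if g: "g \<in> carrier G" for g
      unfolding carrier_absolute_Galois
    proof (intro conjI ballI allI impI)
      show "inv\<^bsub>?P\<^esub> g \<in> (\<Pi>\<^sub>E i\<in>idx. carrier (rep_Gal R i))"
        using P.inv_closed[OF carr[OF g]] by simp
      have inv: "(inv\<^bsub>?P\<^esub> g) i = inv\<^bsub>rep_Gal R i\<^esub> (g i)" if "i \<in> idx" for i
        using g that rep_Gal_group by (subst inv_product_group) (auto simp: carrier_absolute_Galois)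
      fix i j \<alpha> y assume a: "i \<in> idx" "j \<in> idx" "is_transition R i j \<alpha>" "y \<in> Y j"
      \<comment> \<open>Every point of \<open>Y j\<close> has the form \<open>g j z\<close>, which
        turns equivariance of the inverse into equivariance of \<open>g\<close> at
        \<open>z\<close>.\<close>
      obtain z where z: "z \<in> Y j" "y = g j z"
        using conjugacy_surj[OF rep_Gal_conjugacy[OF a(2) G_comp[OF g a(2)]] a(4)] by blast
      have "(inv\<^bsub>?P\<^esub> g) i (\<alpha> y) = (inv\<^bsub>rep_Gal R i\<^esub> (g i)) (g i (\<alpha> z))"
        using z by (simp add: inv[OF a(1)] G_transition[OF g a(1-3)])
      also have "\<dots> = \<alpha> z" by (rule rep_Gal_inv_apply[OF a(1) G_comp[OF g a(1)] transition_in[OF a(3) z(1)]])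
      also have "\<dots> = \<alpha> ((inv\<^bsub>?P\<^esub> g) j y)"
        using rep_Gal_inv_apply[OF a(2) G_comp[OF g a(2)] z(1)] z(2) by (simp add: inv[OF a(2)])
      finally show "(inv\<^bsub>?P\<^esub> g) i (\<alpha> y) = \<alpha> ((inv\<^bsub>?P\<^esub> g) j y)" .
    qed
  qed
qed

lemma G_eq: "G = product_group idx (rep_Gal R) \<lparr>carrier := carrier G\<rparr>"
  by (simp add: absolute_Galois_def)

lemma group_G: "group G"
proof -
  have "group (product_group idx (rep_Gal R))" by (intro product_group rep_Gal_group)
  from group.subgroup_imp_group[OF this subgroup_G] show ?thesis by (simp add: G_eq[symmetric])
qed

lemma G_mult_apply:
  assumes "g \<in> carrier G" "h \<in> carrier G" "i \<in> idx" "y \<in> Y i"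
  shows "(g \<otimes>\<^bsub>G\<^esub> h) i y = g i (h i y)"
proof -
  have "monoid.mult G = monoid.mult (product_group idx (rep_Gal R))"
    by (simp add: absolute_Galois_def)
  then show ?thesis using assms by (simp add: rep_Gal_mult_apply G_comp)
qed

end

section \<open>The automorphisms attached to threads\<close>

context Galois_tower
begin

section \<open>Twisted covers and transports\<close>

abbreviation "\<beta> \<equiv> Galois_beta X x0 R"

definition twist ::
    "((int \<Rightarrow> 'a) \<Rightarrow> (int \<Rightarrow> 'a)) \<Rightarrow> ('a pointed_cover set \<Rightarrow> int \<Rightarrow> nat) \<Rightarrow> 'a pointed_cover set \<Rightarrow> 'a pointed_cover" where
  "twist f \<xi> i = \<lparr>total_space = Y i, base_point = \<xi> i,
     covering = compose (Y i) (inv_into X f) (cov i)\<rparr>"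

text \<open>A pointed conjugacy from the representative of class \<open>k\<close> onto
  \<open>twist f \<xi> i\<close>, written with \<open>f\<close> on the right instead of its inverse
  on the left: \<open>\<theta>\<close> lies over \<open>f\<close>. Such maps can be chained when
  automorphisms of \<open>X\<close> are composed.\<close>

definition transport ::
    "((int \<Rightarrow> 'a) \<Rightarrow> (int \<Rightarrow> 'a)) \<Rightarrow> ('a pointed_cover set \<Rightarrow> int \<Rightarrow> nat) \<Rightarrow> 'a pointed_cover set \<Rightarrow> 'a pointed_cover set
      \<Rightarrow> ((int \<Rightarrow> nat) \<Rightarrow> (int \<Rightarrow> nat)) \<Rightarrow> bool" where
  "transport f \<xi> i k \<theta> \<longleftrightarrow> k \<in> idx \<and> conjugacy (Y k) (Y i) \<theta> \<and> \<theta> (base k) = \<xi> i \<and>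
     (\<forall>y\<in>Y k. cov i (\<theta> y) = f (cov k y))"

text \<open>The fibre of the twisted map over \<open>x\<close> is the fibre of \<open>cov i\<close>
  over \<open>f x\<close>, so the degree stays the same, and composing with a bijection of
  \<open>X\<close> does not change which automorphisms preserve the map. The base point is right
  because \<open>\<xi> i\<close> lies over \<open>f x0\<close>.\<close>

lemma twist_cover:
  assumes f: "conjugacy X X f" and \<xi>: "\<xi> \<in> F (f x0)" and i: "i \<in> idx"
  shows "twist f \<xi> i \<in> covers"
proof -
  interpret Galois_SFT "Y i" X "cov i" using R_cover[OF i] by (rule cover_Galois)
  let ?c = "compose (Y i) (inv_into X f) (cov i)"
  have c_apply: "?c y = inv_into X f (cov i y)" if "y \<in> Y i" for y using that by (simp add: compose_eq)
  have "?c = compose (Y i) (\<lambda>x\<in>X. inv_into X f x) (cov i)"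
    using cov_in[OF i] by (auto simp: compose_def fun_eq_iff)
  then have c_code: "sliding_block_code (Y i) X ?c"
    using sliding_block_code_compose[OF Y_shift code conjugacy_code[OF conjugacy_inverse[OF X_shift X_shift f]]] by simp
  have c_fibre: "fibre (Y i) ?c x = fibre (Y i) (cov i) (f x)" if x: "x \<in> X" for x
  proof -
    have "?c y = x \<longleftrightarrow> cov i y = f x" if "y \<in> Y i" for y
      using conjugacy_inv_into[OF f] x cov_in[OF i that] c_apply[OF that] by metis
    then show ?thesis by (auto simp: fibre_def)
  qed
  have c_card: "card (fibre (Y i) ?c x) = factor_degree (Y i) X (cov i)" if "x \<in> X" for x
    using c_fibre[OF that] fibre_card[OF conjugacy_in[OF f that]] by simp
  have c_image: "?c ` Y i = X"
  proof
    show "?c ` Y i \<subseteq> X" using c_code sliding_block_code_in by blast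
    show "X \<subseteq> ?c ` Y i"
    proof
      fix x assume x: "x \<in> X"
      have "fibre (Y i) ?c x \<noteq> {}" using c_card[OF x] degree_pos by (metis card.empty not_one_le_zero)
      then show "x \<in> ?c ` Y i" by (auto simp: fibre_def)
    qed
  qed
  have c_unram: "unramified (Y i) X ?c"
    unfolding unramified_def factor_map_def using c_code c_image c_card degree_pos by blast
  interpret c: unramified_SFT "Y i" X ?c
    using Y_SFT X_irr c_unram by unfold_locales
  have "factor_degree (Y i) X ?c = factor_degree (Y i) X (cov i)"
    using c.fibre_card[OF x0] c_card[OF x0] by simp
  moreover have "carrier (Gal (Y i) ?c) = carrier (Gal (Y i) (cov i))"
  proof -
    have "?c (\<phi> y) = ?c y \<longleftrightarrow> cov i (\<phi> y) = cov i y" if "y \<in> Y i" "conjugacy (Y i) (Y i) \<phi>" for \<phi> y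
      using that conjugacy_in[OF that(2,1)] c_apply cov_in[OF i] conjugacy_inv_into(2)[OF f] by metis
    then show ?thesis unfolding set_eq_iff carrier_Gal[OF c_code] carrier_Gal[OF code] by blast
  qed
  ultimately have "Galois_factor (Y i) X ?c"
    using Galois c_unram by (simp add: Galois_factor_def)
  moreover have "?c (\<xi> i) = x0"
    using limit_fibre_comp[OF \<xi> i] conjugacy_inv_into(1)[OF f x0] by (simp add: compose_eq)
  ultimately show ?thesis
    using Y_irr limit_fibre_comp(1)[OF \<xi> i] by (simp add: pointed_Galois_factors_def twist_def)
qed

lemma transport_iff:
  assumes f: "conjugacy X X f" and i: "i \<in> idx" and k: "k \<in> idx"
  shows "transport f \<xi> i k \<theta> \<longleftrightarrow> pointed_conjugacy (R k) (twist f \<xi> i) \<theta>"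
proof -
  have "covering (twist f \<xi> i) (\<theta> y) = cov k y \<longleftrightarrow> cov i (\<theta> y) = f (cov k y)"
    if \<theta>: "conjugacy (Y k) (Y i) \<theta>" and y: "y \<in> Y k" for y
  proof -
    have "\<theta> y \<in> Y i" using \<theta> y by (rule conjugacy_in)
    then show ?thesis
      using cov_in[OF i \<open>\<theta> y \<in> Y i\<close>] cov_in[OF k y] conjugacy_inv_into[OF f]
      by (simp add: twist_def compose_eq) metis
  qed
  then show ?thesis
    using k by (auto simp: transport_def pointed_conjugacy_iff[OF R_cover[OF k]] twist_def)
qed

lemma transport_exists:
  assumes "conjugacy X X f" "\<xi> \<in> F (f x0)" "i \<in> idx"
  shows "\<exists>k \<theta>. transport f \<xi> i k \<theta>"
  using representative_exists[OF twist_cover[OF assms]] transport_iff[OF assms(1,3)] by blast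

lemma transportD:
  assumes "transport f \<xi> i k \<theta>"
  shows "k \<in> idx" "conjugacy (Y k) (Y i) \<theta>" "\<theta> (base k) = \<xi> i"
    "y \<in> Y k \<Longrightarrow> cov i (\<theta> y) = f (cov k y)" "y \<in> Y k \<Longrightarrow> \<theta> y \<in> Y i"
  using assms conjugacy_in by (auto simp: transport_def)

lemma beta_component:
  assumes f: "conjugacy X X f" and \<xi>: "\<xi> \<in> F (f x0)" and i: "i \<in> idx"
    and \<theta>: "transport f \<xi> i k \<theta>" and g: "g \<in> carrier G"
  shows "\<beta> f \<xi> g i = compose (Y i) \<theta> (compose (Y i) (g k) (inv_into (Y k) \<theta>))"
proof -
  have k: "k \<in> idx" using \<theta> by (rule transportD)
  have pc: "pointed_conjugacy (R k) (twist f \<xi> i) \<theta>" using \<theta> transport_iff[OF f i k] by simp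
  have "\<beta> f \<xi> g i = component_at X x0 R g (twist f \<xi> i)"
    using g i by (simp add: Galois_beta_def twist_def)
  also have "\<dots> = compose (Y i) \<theta> (compose (Y i) (g k) (inv_into (Y k) \<theta>))"
    using component_at_eq[OF twist_cover[OF f \<xi> i] k pc] by (simp add: twist_def)
  finally show ?thesis .
qed

text \<open>The working form of \<open>\<beta>\<close>: evaluating at points
  \<open>\<theta> y\<close> removes the inverse of \<open>\<theta>\<close>, and every point of
  \<open>Y i\<close> has this form.\<close>

lemma beta_apply:
  assumes "conjugacy X X f" "\<xi> \<in> F (f x0)" "i \<in> idx" "transport f \<xi> i k \<theta>" "g \<in> carrier G" "y \<in> Y k"
  shows "\<beta> f \<xi> g i (\<theta> y) = \<theta> (g k y)"
  using beta_component[OF assms(1-5)] transportD(5)[OF assms(4,6)]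
    conjugacy_inv_into(1)[OF transportD(2)[OF assms(4)] assms(6)]
  by (simp add: compose_eq)

lemma transport_rep_Gal:
  assumes f: "conjugacy X X f" and i: "i \<in> idx" and \<theta>: "transport f \<xi> i k \<theta>" and \<phi>: "\<phi> \<in> carrier (rep_Gal R k)"
  shows "compose (Y i) \<theta> (compose (Y i) \<phi> (inv_into (Y k) \<theta>)) \<in> carrier (rep_Gal R i)"
proof -
  note k = transportD(1)[OF \<theta>] and conj = transportD(2)[OF \<theta>]
  have \<phi>': "conjugacy (Y k) (Y k) \<phi>" "\<forall>y\<in>Y k. cov k (\<phi> y) = cov k y" using \<phi> by (simp_all add: rep_Gal_iff[OF k])
  have "compose (Y i) \<theta> (compose (Y i) \<phi> (inv_into (Y k) \<theta>)) =
     compose (Y i) \<theta> (compose (Y i) \<phi> (\<lambda>y\<in>Y i. inv_into (Y k) \<theta> y))"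
    by (auto simp: compose_def fun_eq_iff)
  moreover have "conjugacy (Y i) (Y i) (compose (Y i) \<theta> (compose (Y i) \<phi> (\<lambda>y\<in>Y i. inv_into (Y k) \<theta> y)))"
    by (intro conjugacy_compose[OF Y_shift_space[OF i] _ conj] conjugacy_compose[OF Y_shift_space[OF i] _ \<phi>'(1)]
        conjugacy_inverse[OF Y_shift_space[OF k] Y_shift_space[OF i] conj])
  moreover have "cov i (\<theta> (\<phi> (inv_into (Y k) \<theta> y))) = cov i y" if y: "y \<in> Y i" for y
    using conjugacy_inv_into(2,3)[OF conj y] transportD(4)[OF \<theta>] \<phi>' conjugacy_in[OF \<phi>'(1)] by metis
  ultimately show ?thesis by (simp add: rep_Gal_iff[OF i] compose_eq)
qed

text \<open>Transports respect the order of the tower: conjugating \<open>\<alpha>\<close> by them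
  gives a transition map again. \<open>\<eta>\<close> matches the fibres, so the degree is
  unchanged, and the base points match because \<open>\<xi>\<close> is a thread.\<close>

lemma transport_transition:
  assumes f: "conjugacy X X f" and \<xi>: "\<xi> \<in> F (f x0)" and i: "i \<in> idx" and j: "j \<in> idx"
    and \<theta>: "transport f \<xi> i k \<theta>" and \<eta>: "transport f \<xi> j l \<eta>" and \<alpha>: "is_transition R i j \<alpha>"
  shows "\<exists>\<alpha>'. is_transition R k l \<alpha>' \<and> (\<forall>y\<in>Y l. \<theta> (\<alpha>' y) = \<alpha> (\<eta> y))"
proof -
  note k = transportD(1)[OF \<theta>] and l = transportD(1)[OF \<eta>]
  note conj\<theta> = transportD(2)[OF \<theta>] and conj\<eta> = transportD(2)[OF \<eta>]
  define \<alpha>' where "\<alpha>' = compose (Y l) (\<lambda>y\<in>Y i. inv_into (Y k) \<theta> y) (compose (Y l) \<alpha> \<eta>)"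
  have \<alpha>\<eta>: "\<alpha> (\<eta> y) \<in> Y i" if "y \<in> Y l" for y
    using transition_in[OF \<alpha> transportD(5)[OF \<eta> that]] .
  have \<alpha>'_apply: "\<alpha>' y = inv_into (Y k) \<theta> (\<alpha> (\<eta> y))" if "y \<in> Y l" for y
    using that \<alpha>\<eta> by (simp add: \<alpha>'_def compose_eq)
  have \<theta>\<alpha>': "\<theta> (\<alpha>' y) = \<alpha> (\<eta> y)" and \<alpha>'_in: "\<alpha>' y \<in> Y k" if "y \<in> Y l" for y
    using that conjugacy_inv_into(2,3)[OF conj\<theta> \<alpha>\<eta>[OF that]] by (simp_all add: \<alpha>'_apply)
  have \<alpha>_props: "unramified (Y j) (Y i) \<alpha>" "\<alpha> (base j) = base i" "\<forall>y\<in>Y j. cov i (\<alpha> y) = cov j y"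
    using \<alpha> by (simp_all add: is_transition_iff[OF j])
  have code: "sliding_block_code (Y l) (Y k) \<alpha>'"
    unfolding \<alpha>'_def
    by (rule sliding_block_code_compose[OF Y_shift_space[OF l]
          sliding_block_code_compose[OF Y_shift_space[OF l] conjugacy_code[OF conj\<eta>] transition_code[OF \<alpha>]]
          conjugacy_code[OF conjugacy_inverse[OF Y_shift_space[OF k] Y_shift_space[OF i] conj\<theta>]]])
  have fib: "card (fibre (Y l) \<alpha>' z) = card (fibre (Y j) \<alpha> (\<theta> z))" if z: "z \<in> Y k" for z
  proof (rule bij_betw_same_card)
    have iff: "\<alpha>' y = z \<longleftrightarrow> \<alpha> (\<eta> y) = \<theta> z" if "y \<in> Y l" for y
      using \<theta>\<alpha>'[OF that] conjugacy_inj[OF conj\<theta> \<alpha>'_in[OF that] z] by auto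
    show "bij_betw \<eta> (fibre (Y l) \<alpha>' z) (fibre (Y j) \<alpha> (\<theta> z))"
      unfolding bij_betw_def
    proof
      show "inj_on \<eta> (fibre (Y l) \<alpha>' z)"
        using conjugacy_inj[OF conj\<eta>] by (auto simp: inj_on_def fibre_def)
      show "\<eta> ` fibre (Y l) \<alpha>' z = fibre (Y j) \<alpha> (\<theta> z)"
      proof
        show "\<eta> ` fibre (Y l) \<alpha>' z \<subseteq> fibre (Y j) \<alpha> (\<theta> z)"
          using iff transportD(5)[OF \<eta>] by (auto simp: fibre_def)
        show "fibre (Y j) \<alpha> (\<theta> z) \<subseteq> \<eta> ` fibre (Y l) \<alpha>' z"
        proof
          fix v assume v: "v \<in> fibre (Y j) \<alpha> (\<theta> z)"
          then obtain y where "y \<in> Y l" "v = \<eta> y" using conjugacy_surj[OF conj\<eta>] by (auto simp: fibre_def)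
          then show "v \<in> \<eta> ` fibre (Y l) \<alpha>' z" using iff v by (auto simp: fibre_def)
        qed
      qed
    qed
  qed
  obtain d where d: "d \<ge> 1" "\<forall>y\<in>Y i. card (fibre (Y j) \<alpha> y) = d"
    using \<alpha>_props(1) by (auto simp: unramified_def)
  have card: "card (fibre (Y l) \<alpha>' z) = d" if "z \<in> Y k" for z
    using fib[OF that] d(2) transportD(5)[OF \<theta> that] by simp
  have "\<alpha>' ` Y l = Y k"
  proof
    show "\<alpha>' ` Y l \<subseteq> Y k" using \<alpha>'_in by blast
    show "Y k \<subseteq> \<alpha>' ` Y l"
    proof
      fix z assume z: "z \<in> Y k"
      have "fibre (Y l) \<alpha>' z \<noteq> {}" using card[OF z] d(1) by (metis card.empty not_one_le_zero)
      then show "z \<in> \<alpha>' ` Y l" by (auto simp: fibre_def)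
    qed
  qed
  then have "unramified (Y l) (Y k) \<alpha>'"
    unfolding unramified_def factor_map_def using code card d(1) by blast
  moreover have "\<alpha>' (base l) = base k"
  proof (rule conjugacy_inj[OF conj\<theta> \<alpha>'_in[OF base_in[OF l]] base_in[OF k]])
    have "\<alpha> (\<xi> j) = \<xi> i" using \<xi> i j \<alpha> by (simp add: limit_fibre_iff)
    then show "\<theta> (\<alpha>' (base l)) = \<theta> (base k)"
      using \<theta>\<alpha>'[OF base_in[OF l]] transportD(3)[OF \<theta>] transportD(3)[OF \<eta>] by simp
  qed
  moreover have "cov k (\<alpha>' y) = cov l y" if y: "y \<in> Y l" for y
  proof (rule conjugacy_inj[OF f cov_in[OF k \<alpha>'_in[OF y]] cov_in[OF l y]])
    have "f (cov k (\<alpha>' y)) = cov i (\<alpha> (\<eta> y))" using transportD(4)[OF \<theta> \<alpha>'_in[OF y]] \<theta>\<alpha>'[OF y] by simp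
    also have "\<dots> = f (cov l y)" using \<alpha>_props(3) transportD(4,5)[OF \<eta> y] by simp
    finally show "f (cov k (\<alpha>' y)) = f (cov l y)" .
  qed
  ultimately have "is_transition R k l \<alpha>'" by (simp add: is_transition_iff[OF l])
  then show ?thesis using \<theta>\<alpha>' by blast
qed

lemma beta_closed:
  assumes f: "conjugacy X X f" and \<xi>: "\<xi> \<in> F (f x0)" and g: "g \<in> carrier G"
  shows "\<beta> f \<xi> g \<in> carrier G"
  unfolding carrier_absolute_Galois
proof (intro conjI ballI allI impI)
  show "\<beta> f \<xi> g \<in> (\<Pi>\<^sub>E i\<in>idx. carrier (rep_Gal R i))"
  proof (rule PiE_I)
    fix i assume i: "i \<in> idx"
    obtain k \<theta> where \<theta>: "transport f \<xi> i k \<theta>" using transport_exists[OF f \<xi> i] by blast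
    show "\<beta> f \<xi> g i \<in> carrier (rep_Gal R i)"
      unfolding beta_component[OF f \<xi> i \<theta> g]
      by (rule transport_rep_Gal[OF f i \<theta> G_comp[OF g transportD(1)[OF \<theta>]]])
  next
    fix i assume "i \<notin> idx"
    then show "\<beta> f \<xi> g i = undefined" using g by (simp add: Galois_beta_def)
  qed
  fix i j \<alpha> y assume i: "i \<in> idx" and j: "j \<in> idx" and \<alpha>: "is_transition R i j \<alpha>" and y: "y \<in> Y j"
  obtain k \<theta> where \<theta>: "transport f \<xi> i k \<theta>" using transport_exists[OF f \<xi> i] by blast
  obtain l \<eta> where \<eta>: "transport f \<xi> j l \<eta>" using transport_exists[OF f \<xi> j] by blast
  obtain \<alpha>' where \<alpha>': "is_transition R k l \<alpha>'" "\<forall>y\<in>Y l. \<theta> (\<alpha>' y) = \<alpha> (\<eta> y)"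
    using transport_transition[OF f \<xi> i j \<theta> \<eta> \<alpha>] by blast
  obtain u where u: "u \<in> Y l" "y = \<eta> u" using conjugacy_surj[OF transportD(2)[OF \<eta>] y] by blast
  have "\<beta> f \<xi> g i (\<alpha> y) = \<beta> f \<xi> g i (\<theta> (\<alpha>' u))" using \<alpha>'(2) u by simp
  also have "\<dots> = \<theta> (g k (\<alpha>' u))"
    by (rule beta_apply[OF f \<xi> i \<theta> g transition_in[OF \<alpha>'(1) u(1)]])
  also have "\<dots> = \<theta> (\<alpha>' (g l u))"
    by (simp add: G_transition[OF g transportD(1)[OF \<theta>] transportD(1)[OF \<eta>] \<alpha>'(1) u(1)])
  also have "\<dots> = \<alpha> (\<eta> (g l u))" using \<alpha>'(2) G_comp_in[OF g transportD(1)[OF \<eta>] u(1)] by simp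
  also have "\<dots> = \<alpha> (\<beta> f \<xi> g j y)" by (simp add: u(2) beta_apply[OF f \<xi> j \<eta> g u(1)])
  finally show "\<beta> f \<xi> g i (\<alpha> y) = \<alpha> (\<beta> f \<xi> g j y)" .
qed

text \<open>One point for each index decides, and it may be given in transported form, where
  \<open>beta_apply\<close> evaluates the left-hand side.\<close>

lemma beta_eqI:
  assumes f: "conjugacy X X f" and \<xi>: "\<xi> \<in> F (f x0)" and g: "g \<in> carrier G" and h: "h \<in> carrier G"
    and eq: "\<And>i. i \<in> idx \<Longrightarrow> \<exists>k \<theta>. transport f \<xi> i k \<theta> \<and> (\<exists>y\<in>Y k. h i (\<theta> y) = \<theta> (g k y))"
  shows "\<beta> f \<xi> g = h"
proof (rule G_eqI[OF beta_closed[OF f \<xi> g] h])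
  fix i assume i: "i \<in> idx"
  obtain k \<theta> y where \<theta>: "transport f \<xi> i k \<theta>" and y: "y \<in> Y k" "h i (\<theta> y) = \<theta> (g k y)"
    using eq[OF i] by blast
  show "\<exists>y\<in>Y i. \<beta> f \<xi> g i y = h i y"
    using transportD(5)[OF \<theta> y(1)] beta_apply[OF f \<xi> i \<theta> g y(1)] y(2) by (intro bexI[of _ "\<theta> y"]) simp_all
qed

lemma beta_mult:
  assumes f: "conjugacy X X f" and \<xi>: "\<xi> \<in> F (f x0)" and g: "g \<in> carrier G" and h: "h \<in> carrier G"
  shows "\<beta> f \<xi> (g \<otimes>\<^bsub>G\<^esub> h) = \<beta> f \<xi> g \<otimes>\<^bsub>G\<^esub> \<beta> f \<xi> h"
proof -
  interpret G: group G by (rule group_G)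
  note bg = beta_closed[OF f \<xi> g] and bh = beta_closed[OF f \<xi> h]
  show ?thesis
  proof (rule beta_eqI[OF f \<xi> G.m_closed[OF g h] G.m_closed[OF bg bh]])
    fix i assume i: "i \<in> idx"
    obtain k \<theta> where \<theta>: "transport f \<xi> i k \<theta>" using transport_exists[OF f \<xi> i] by blast
    note k = transportD(1)[OF \<theta>]
    have b: "base k \<in> Y k" using k by (rule base_in)
    have "(\<beta> f \<xi> g \<otimes>\<^bsub>G\<^esub> \<beta> f \<xi> h) i (\<theta> (base k)) = \<theta> ((g \<otimes>\<^bsub>G\<^esub> h) k (base k))"
      by (simp add: G_mult_apply[OF bg bh i transportD(5)[OF \<theta> b]] G_mult_apply[OF g h k b]
          beta_apply[OF f \<xi> i \<theta> h b] beta_apply[OF f \<xi> i \<theta> g G_comp_in[OF h k b]])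
    then show "\<exists>k \<theta>. transport f \<xi> i k \<theta> \<and>
       (\<exists>y\<in>Y k. (\<beta> f \<xi> g \<otimes>\<^bsub>G\<^esub> \<beta> f \<xi> h) i (\<theta> y) = \<theta> ((g \<otimes>\<^bsub>G\<^esub> h) k y))"
      using \<theta> b by blast
  qed
qed

section \<open>Composition and change of thread\<close>

lemma transport_compose:
  assumes f: "conjugacy X X f" and \<theta>': "transport f' \<xi>' i k \<theta>'" and \<theta>: "transport f \<xi> k m \<theta>" and \<zeta>: "\<zeta> i = \<theta>' (\<xi> k)"
  shows "transport (compose X f' f) \<zeta> i m (compose (Y m) \<theta>' \<theta>)"
proof -
  note m = transportD(1)[OF \<theta>]
  have "conjugacy (Y m) (Y i) (compose (Y m) \<theta>' \<theta>)"
    by (rule conjugacy_compose[OF Y_shift_space[OF m] transportD(2)[OF \<theta>] transportD(2)[OF \<theta>']])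
  moreover have "cov i (\<theta>' (\<theta> y)) = f' (f (cov m y))" if "y \<in> Y m" for y
    using transportD(4,5)[OF \<theta> that] transportD(4)[OF \<theta>'] by simp
  ultimately show ?thesis
    using m \<zeta> base_in[OF m] transportD(3)[OF \<theta>] cov_in[OF m] by (simp add: transport_def compose_eq)
qed

text \<open>A transport from \<open>Y m\<close> to \<open>Y (\<pi> i)\<close> over \<open>f\<close>
  followed by one to \<open>Y i\<close> over \<open>f'\<close> lies over the composite. Where the
  base point of \<open>R m\<close> ends up dictates the new thread,
  \<open>\<zeta> i = \<theta>' i (\<xi> (\<pi> i))\<close>; \<open>transport_transition\<close>
  makes it compatible.\<close>

lemma beta_compose:
  assumes f: "conjugacy X X f" and f': "conjugacy X X f'" and \<xi>: "\<xi> \<in> F (f x0)" and \<xi>': "\<xi>' \<in> F (f' x0)"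
  shows "\<exists>\<zeta>\<in>F (compose X f' f x0). \<forall>g\<in>carrier G. \<beta> f' \<xi>' (\<beta> f \<xi> g) = \<beta> (compose X f' f) \<zeta> g"
proof -
  have "\<exists>t. transport f' \<xi>' i (fst t) (snd t)" if "i \<in> idx" for i
    using transport_exists[OF f' \<xi>' that] by auto
  then have "\<forall>i. \<exists>t. i \<in> idx \<longrightarrow> transport f' \<xi>' i (fst t) (snd t)" by blast
  then obtain t where t: "\<forall>i. i \<in> idx \<longrightarrow> transport f' \<xi>' i (fst (t i)) (snd (t i))"
    by (rule choice[THEN exE])
  define \<pi> where "\<pi> i = fst (t i)" for i
  define \<theta>' where "\<theta>' i = snd (t i)" for i
  have \<theta>': "transport f' \<xi>' i (\<pi> i) (\<theta>' i)" if "i \<in> idx" for i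
    using t that by (simp add: \<pi>_def \<theta>'_def)
  have \<pi>: "\<pi> i \<in> idx" if "i \<in> idx" for i using \<theta>'[OF that] by (rule transportD)
  define \<zeta> where "\<zeta> = (\<lambda>i\<in>idx. \<theta>' i (\<xi> (\<pi> i)))"
  have ff: "conjugacy X X (compose X f' f)" by (rule conjugacy_compose[OF X_shift_space f f'])
  have \<zeta>F: "\<zeta> \<in> F (compose X f' f x0)"
    unfolding limit_fibre_iff
  proof (intro conjI ballI allI impI)
    have "\<theta>' i (\<xi> (\<pi> i)) \<in> fibre (Y i) (cov i) (compose X f' f x0)" if i: "i \<in> idx" for i
      using transportD(4,5)[OF \<theta>'[OF i] limit_fibre_comp(1)[OF \<xi> \<pi>[OF i]]] limit_fibre_comp(2)[OF \<xi> \<pi>[OF i]] x0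
      by (simp add: fibre_def compose_eq)
    then show "\<zeta> \<in> (\<Pi>\<^sub>E i\<in>idx. fibre (Y i) (cov i) (compose X f' f x0))" by (auto simp: \<zeta>_def)
    fix i j \<alpha> assume i: "i \<in> idx" and j: "j \<in> idx" and \<alpha>: "is_transition R i j \<alpha>"
    obtain \<alpha>' where \<alpha>': "is_transition R (\<pi> i) (\<pi> j) \<alpha>'" "\<forall>y\<in>Y (\<pi> j). \<theta>' i (\<alpha>' y) = \<alpha> (\<theta>' j y)"
      using transport_transition[OF f' \<xi>' i j \<theta>'[OF i] \<theta>'[OF j] \<alpha>] by blast
    have "\<alpha>' (\<xi> (\<pi> j)) = \<xi> (\<pi> i)" using \<xi> \<pi>[OF i] \<pi>[OF j] \<alpha>'(1) by (simp add: limit_fibre_iff)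
    then show "\<alpha> (\<zeta> j) = \<zeta> i"
      using \<alpha>'(2) limit_fibre_comp(1)[OF \<xi> \<pi>[OF j]] i j by (metis \<zeta>_def restrict_apply')
  qed
  have "\<beta> (compose X f' f) \<zeta> g = \<beta> f' \<xi>' (\<beta> f \<xi> g)" if g: "g \<in> carrier G" for g
  proof (rule beta_eqI[OF ff \<zeta>F g])
    note bg = beta_closed[OF f \<xi> g]
    show "\<beta> f' \<xi>' (\<beta> f \<xi> g) \<in> carrier G" by (rule beta_closed[OF f' \<xi>' bg])
    fix i assume i: "i \<in> idx"
    obtain m \<theta> where \<theta>: "transport f \<xi> (\<pi> i) m \<theta>" using transport_exists[OF f \<xi> \<pi>[OF i]] by blast
    note m = transportD(1)[OF \<theta>]
    have tr: "transport (compose X f' f) \<zeta> i m (compose (Y m) (\<theta>' i) \<theta>)"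
      by (rule transport_compose[OF f \<theta>'[OF i] \<theta>]) (simp add: \<zeta>_def i)
    have b: "base m \<in> Y m" using m by (rule base_in)
    have "\<beta> f' \<xi>' (\<beta> f \<xi> g) i (compose (Y m) (\<theta>' i) \<theta> (base m)) = compose (Y m) (\<theta>' i) \<theta> (g m (base m))"
      using b G_comp_in[OF g m b]
      by (simp add: compose_eq beta_apply[OF f' \<xi>' i \<theta>'[OF i] bg transportD(5)[OF \<theta> b]]
          beta_apply[OF f \<xi> \<pi>[OF i] \<theta> g b])
    then show "\<exists>k \<theta>. transport (compose X f' f) \<zeta> i k \<theta> \<and>
        (\<exists>y\<in>Y k. \<beta> f' \<xi>' (\<beta> f \<xi> g) i (\<theta> y) = \<theta> (g k y))"
      using tr b by blast
  qed
  then show ?thesis using \<zeta>F by (intro bexI[of _ \<zeta>]) simp_all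
qed

text \<open>With the thread of base points, the identity of \<open>Y i\<close> is a transport from
  class \<open>i\<close> to itself.\<close>

lemma beta_id:
  assumes g: "g \<in> carrier G"
  shows "\<beta> (\<lambda>x\<in>X. x) (\<lambda>i\<in>idx. base i) g = g"
proof (rule beta_eqI[OF conjugacy_id[OF X_shift_space] _ g g])
  show "(\<lambda>i\<in>idx. base i) \<in> F ((\<lambda>x\<in>X. x) x0)" using base_thread x0 by simp
  fix i assume i: "i \<in> idx"
  have "transport (\<lambda>x\<in>X. x) (\<lambda>i\<in>idx. base i) i i (\<lambda>y\<in>Y i. y)"
    using i base_in[OF i] cov_in[OF i] by (simp add: transport_def conjugacy_id Y_shift_space)
  moreover have "g i ((\<lambda>y\<in>Y i. y) (base i)) = (\<lambda>y\<in>Y i. y) (g i (base i))"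
    using base_in[OF i] G_comp_in[OF g i base_in[OF i]] by simp
  ultimately show "\<exists>k \<theta>. transport (\<lambda>x\<in>X. x) (\<lambda>i\<in>idx. base i) i k \<theta> \<and> (\<exists>y\<in>Y k. g i (\<theta> y) = \<theta> (g k y))"
    using base_in[OF i] by blast
qed

text \<open>Each \<open>h i\<close> is found by transitivity on the fibre. The family is compatible
  because both sides of the condition agree at \<open>\<xi> j\<close>, and
  \<open>over_transition\<close> extends this to all of \<open>Y j\<close>.\<close>

lemma thread_translation:
  assumes x: "x \<in> X" and \<xi>: "\<xi> \<in> F x" and \<xi>': "\<xi>' \<in> F x"
  shows "\<exists>h\<in>carrier G. \<forall>i\<in>idx. h i (\<xi> i) = \<xi>' i"
proof -
  have "\<exists>\<phi>. \<phi> \<in> carrier (rep_Gal R i) \<and> \<phi> (\<xi> i) = \<xi>' i" if i: "i \<in> idx" for i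
    using rep_Gal_transitive[OF i x, of "\<xi> i" "\<xi>' i"] limit_fibre_comp[OF \<xi> i] limit_fibre_comp[OF \<xi>' i]
    by (auto simp: fibre_def)
  then have "\<forall>i. \<exists>\<phi>. i \<in> idx \<longrightarrow> \<phi> \<in> carrier (rep_Gal R i) \<and> \<phi> (\<xi> i) = \<xi>' i" by blast
  then obtain h where h: "\<forall>i. i \<in> idx \<longrightarrow> h i \<in> carrier (rep_Gal R i) \<and> h i (\<xi> i) = \<xi>' i"
    by (rule choice[THEN exE])
  have "(\<lambda>i\<in>idx. h i) \<in> carrier G"
    unfolding carrier_absolute_Galois
  proof (intro conjI ballI allI impI)
    show "(\<lambda>i\<in>idx. h i) \<in> (\<Pi>\<^sub>E i\<in>idx. carrier (rep_Gal R i))" using h by auto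
    fix i j \<alpha> y assume i: "i \<in> idx" and j: "j \<in> idx" and \<alpha>: "is_transition R i j \<alpha>" and y: "y \<in> Y j"
    have "\<alpha> (\<xi> j) = \<xi> i" "\<alpha> (\<xi>' j) = \<xi>' i" using \<xi> \<xi>' i j \<alpha> by (simp_all add: limit_fibre_iff)
    then have "h i (\<alpha> (\<xi> j)) = \<alpha> (h j (\<xi> j))" using h i j by simp
    then have "h i (\<alpha> y) = \<alpha> (h j y)"
      by (rule over_transition[OF i j \<alpha> _ _ limit_fibre_comp(1)[OF \<xi> j] _ y, rotated 2]) (use h i j in auto)
    then show "(\<lambda>i\<in>idx. h i) i (\<alpha> y) = \<alpha> ((\<lambda>i\<in>idx. h i) j y)" using i j by simp
  qed
  then show ?thesis using h by (intro bexI) auto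
qed

text \<open>Following a transport for \<open>\<xi>\<close> by \<open>h i\<close> yields one for
  \<open>\<xi>'\<close> out of the same class \<open>k\<close>, so the two automorphisms are
  conjugate under \<open>h\<close>. The equation is kept free of inverses, the shape that
  \<open>H_conj_invariant\<close> takes.\<close>

lemma beta_inner:
  assumes f: "conjugacy X X f" and \<xi>: "\<xi> \<in> F (f x0)" and \<xi>': "\<xi>' \<in> F (f x0)"
  shows "\<exists>h\<in>carrier G. \<forall>g\<in>carrier G. \<beta> f \<xi>' g \<otimes>\<^bsub>G\<^esub> h = h \<otimes>\<^bsub>G\<^esub> \<beta> f \<xi> g"
proof -
  interpret G: group G by (rule group_G)
  obtain h where h: "h \<in> carrier G" "\<forall>i\<in>idx. h i (\<xi> i) = \<xi>' i"
    using thread_translation[OF conjugacy_in[OF f x0] \<xi> \<xi>'] by blast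
  have "\<beta> f \<xi>' g \<otimes>\<^bsub>G\<^esub> h = h \<otimes>\<^bsub>G\<^esub> \<beta> f \<xi> g" if g: "g \<in> carrier G" for g
  proof (rule G_eqI)
    note bg = beta_closed[OF f \<xi> g] and bg' = beta_closed[OF f \<xi>' g]
    show "\<beta> f \<xi>' g \<otimes>\<^bsub>G\<^esub> h \<in> carrier G" "h \<otimes>\<^bsub>G\<^esub> \<beta> f \<xi> g \<in> carrier G"
      by (intro G.m_closed bg bg' h(1))+
    fix i assume i: "i \<in> idx"
    obtain k \<theta> where \<theta>: "transport f \<xi> i k \<theta>" using transport_exists[OF f \<xi> i] by blast
    note k = transportD(1)[OF \<theta>]
    have hi: "conjugacy (Y i) (Y i) (h i)" "\<forall>y\<in>Y i. cov i (h i y) = cov i y"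
      using G_comp[OF h(1) i] by (simp_all add: rep_Gal_iff[OF i])
    have tr: "transport f \<xi>' i k (compose (Y k) (h i) \<theta>)"
      using k h(2) i base_in[OF k] transportD(3,4,5)[OF \<theta>] hi
        conjugacy_compose[OF Y_shift_space[OF k] transportD(2)[OF \<theta>] hi(1)]
      by (simp add: transport_def compose_eq)
    have b: "base k \<in> Y k" using k by (rule base_in)
    have "(\<beta> f \<xi>' g \<otimes>\<^bsub>G\<^esub> h) i (\<theta> (base k)) = \<beta> f \<xi>' g i (compose (Y k) (h i) \<theta> (base k))"
      using b by (simp add: G_mult_apply[OF bg' h(1) i transportD(5)[OF \<theta> b]] compose_eq)
    also have "\<dots> = h i (\<theta> (g k (base k)))"
      using G_comp_in[OF g k b] by (simp add: beta_apply[OF f \<xi>' i tr g b] compose_eq)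
    also have "\<dots> = (h \<otimes>\<^bsub>G\<^esub> \<beta> f \<xi> g) i (\<theta> (base k))"
      by (simp add: G_mult_apply[OF h(1) bg i transportD(5)[OF \<theta> b]] beta_apply[OF f \<xi> i \<theta> g b])
    finally show "\<exists>y\<in>Y i. (\<beta> f \<xi>' g \<otimes>\<^bsub>G\<^esub> h) i y = (h \<otimes>\<^bsub>G\<^esub> \<beta> f \<xi> g) i y"
      using transportD(5)[OF \<theta> b] by blast
  qed
  then show ?thesis using h(1) by blast
qed

text \<open>Component \<open>i\<close> of the image depends only on component \<open>k\<close> of
  \<open>g\<close>, through a map between discrete sets.\<close>

lemma continuous_beta:
  assumes f: "conjugacy X X f" and \<xi>: "\<xi> \<in> F (f x0)"
  shows "continuous_map (Galois_topology X x0 R) (Galois_topology X x0 R) (\<beta> f \<xi>)"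
proof -
  let ?P = "product_topology (\<lambda>i. discrete_topology (carrier (rep_Gal R i))) idx"
  have top: "topspace (Galois_topology X x0 R) = carrier G"
    by (auto simp: Galois_topology_def carrier_absolute_Galois)
  have "continuous_map (Galois_topology X x0 R) ?P (\<beta> f \<xi>)"
    unfolding continuous_map_componentwise
  proof (intro conjI ballI)
    show "\<beta> f \<xi> ` topspace (Galois_topology X x0 R) \<subseteq> extensional idx"
      using beta_closed[OF f \<xi>] by (auto simp: top carrier_absolute_Galois PiE_def)
    fix i assume i: "i \<in> idx"
    obtain k \<theta> where \<theta>: "transport f \<xi> i k \<theta>" using transport_exists[OF f \<xi> i] by blast
    note k = transportD(1)[OF \<theta>]
    have proj: "continuous_map (Galois_topology X x0 R) (discrete_topology (carrier (rep_Gal R k))) (\<lambda>g. g k)"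
      unfolding Galois_topology_def
      by (intro continuous_map_from_subtopology continuous_map_product_projection k)
    have "continuous_map (discrete_topology (carrier (rep_Gal R k))) (discrete_topology (carrier (rep_Gal R i)))
        (\<lambda>\<phi>. compose (Y i) \<theta> (compose (Y i) \<phi> (inv_into (Y k) \<theta>)))"
      using transport_rep_Gal[OF f i \<theta>] by auto
    then have "continuous_map (Galois_topology X x0 R) (discrete_topology (carrier (rep_Gal R i)))
        ((\<lambda>\<phi>. compose (Y i) \<theta> (compose (Y i) \<phi> (inv_into (Y k) \<theta>))) \<circ> (\<lambda>g. g k))"
      by (rule continuous_map_compose[OF proj])
    then show "continuous_map (Galois_topology X x0 R) (discrete_topology (carrier (rep_Gal R i))) (\<lambda>g. \<beta> f \<xi> g i)"
      by (rule continuous_map_eq) (simp add: top beta_component[OF f \<xi> i \<theta>])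
  qed
  then show ?thesis
    unfolding Galois_topology_def
    by (intro continuous_map_into_subtopology) (auto simp: Galois_topology_def[symmetric] top beta_closed[OF f \<xi>])
qed

end

section \<open>The representation on cohomology\<close>

text \<open>The inverse of a bijection that respects the operations respects them too, so these maps
  form a subgroup of all bijections. Closure of the carrier is what allows injectivity to be applied
  to sums and multiples.\<close>

lemma group_GL_module:
  assumes add: "\<And>v w. \<lbrakk>v \<in> carrier V; w \<in> carrier V\<rbrakk> \<Longrightarrow> v \<oplus>\<^bsub>V\<^esub> w \<in> carrier V"
    and smult: "\<And>c v. \<lbrakk>c \<in> carrier K; v \<in> carrier V\<rbrakk> \<Longrightarrow> c \<odot>\<^bsub>V\<^esub> v \<in> carrier V"
  shows "group (GL_module K V)"
proof -
  let ?L = "{T \<in> Bij (carrier V).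
        (\<forall>v\<in>carrier V. \<forall>w\<in>carrier V. T (v \<oplus>\<^bsub>V\<^esub> w) = T v \<oplus>\<^bsub>V\<^esub> T w) \<and>
        (\<forall>c\<in>carrier K. \<forall>v\<in>carrier V. T (c \<odot>\<^bsub>V\<^esub> v) = c \<odot>\<^bsub>V\<^esub> T v)}"
  have inT: "T v \<in> carrier V" if "T \<in> Bij (carrier V)" "v \<in> carrier V" for T v
    using Bij_imp_funcset that by fastforce
  have "subgroup ?L (BijGroup (carrier V))"
  proof (rule group.subgroupI[OF group_BijGroup])
    show "?L \<subseteq> carrier (BijGroup (carrier V))" by (auto simp: BijGroup_def)
    have "(\<lambda>v\<in>carrier V. v) \<in> ?L" using add smult by (auto simp: id_Bij)
    then show "?L \<noteq> {}" by blast
    show "inv\<^bsub>BijGroup (carrier V)\<^esub> T \<in> ?L" if "T \<in> ?L" for T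
    proof -
      have T: "T \<in> Bij (carrier V)"
        "\<And>v w. \<lbrakk>v \<in> carrier V; w \<in> carrier V\<rbrakk> \<Longrightarrow> T (v \<oplus>\<^bsub>V\<^esub> w) = T v \<oplus>\<^bsub>V\<^esub> T w"
        "\<And>c v. \<lbrakk>c \<in> carrier K; v \<in> carrier V\<rbrakk> \<Longrightarrow> T (c \<odot>\<^bsub>V\<^esub> v) = c \<odot>\<^bsub>V\<^esub> T v"
        using that by auto
      define S where "S = inv_into (carrier V) T"
      have S: "S v \<in> carrier V" "T (S v) = v" if "v \<in> carrier V" for v
        using T(1) that by (auto simp: S_def Bij_def bij_betw_def inv_into_into f_inv_into_f)
      have inj: "u = v" if "T u = T v" "u \<in> carrier V" "v \<in> carrier V" for u v
        using T(1) that by (auto simp: Bij_def bij_betw_def inj_on_def)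
      have "S (v \<oplus>\<^bsub>V\<^esub> w) = S v \<oplus>\<^bsub>V\<^esub> S w" if "v \<in> carrier V" "w \<in> carrier V" for v w
        by (rule inj) (use that in \<open>simp_all add: S T(2) add\<close>)
      moreover have "S (c \<odot>\<^bsub>V\<^esub> v) = c \<odot>\<^bsub>V\<^esub> S v" if "c \<in> carrier K" "v \<in> carrier V" for c v
        by (rule inj) (use that in \<open>simp_all add: S T(3) smult\<close>)
      moreover have "(\<lambda>v\<in>carrier V. S v) \<in> Bij (carrier V)"
        using restrict_inv_into_Bij[OF T(1)] by (simp add: S_def)
      ultimately show ?thesis
        unfolding inv_BijGroup[OF T(1)] S_def[symmetric] by (simp add: add smult)
    qed
    show "S \<otimes>\<^bsub>BijGroup (carrier V)\<^esub> T \<in> ?L" if "S \<in> ?L" "T \<in> ?L" for S T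
      using that by (simp add: BijGroup_def compose_Bij compose_eq add smult inT)
  qed
  from group.subgroup_imp_group[OF group_BijGroup this] show ?thesis by (simp add: GL_module_def)
qed

section \<open>Characters with values in the prime field\<close>

locale Galois_tower_mod = Galois_tower X x0 R for X :: "(int \<Rightarrow> 'a) set" and x0 and R +
  fixes p :: nat
  assumes p: "prime p"
begin

abbreviation "H \<equiv> Galois_H1 X x0 R p"
abbreviation "\<Upsilon> \<equiv> Upsilon X x0 R p"

lemma p_pos: "int p > 0"
  using p prime_gt_0_nat by simp

lemma carrier_H:
  "\<eta> \<in> carrier H \<longleftrightarrow> \<eta> \<in> extensional (carrier G) \<and> (\<forall>g\<in>carrier G. \<eta> g \<in> {0..int p - 1}) \<and>
    (\<forall>g\<in>carrier G. \<forall>h\<in>carrier G. \<eta> (g \<otimes>\<^bsub>G\<^esub> h) = (\<eta> g + \<eta> h) mod int p) \<and>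
    continuous_map (Galois_topology X x0 R) (discrete_topology {0..int p - 1}) \<eta>"
  by (auto simp: Galois_H1_def Let_def residue_ring_def hom_def Pi_iff)

lemma H_add: "v \<oplus>\<^bsub>H\<^esub> w = (\<lambda>g\<in>carrier G. (v g + w g) mod int p)"
  by (simp add: Galois_H1_def Let_def residue_ring_def)

lemma H_smult: "c \<odot>\<^bsub>H\<^esub> v = (\<lambda>g\<in>carrier G. (c * v g) mod int p)"
  by (simp add: Galois_H1_def Let_def residue_ring_def)

lemma topspace_Galois_topology: "topspace (Galois_topology X x0 R) = carrier G"
  by (auto simp: Galois_topology_def carrier_absolute_Galois)

lemma H_add_closed:
  assumes v: "v \<in> carrier H" and w: "w \<in> carrier H"
  shows "v \<oplus>\<^bsub>H\<^esub> w \<in> carrier H"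
proof -
  interpret G: group G by (rule group_G)
  let ?D = "discrete_topology {0..int p - 1}"
  \<comment> \<open>Continuity of the sum: the pair of characters is continuous into a product of
    two discrete spaces, which is discrete, so addition on it is continuous.\<close>
  have pair: "continuous_map (Galois_topology X x0 R)
      (discrete_topology ({0..int p - 1} \<times> {0..int p - 1})) (\<lambda>g. (v g, w g))"
    unfolding prod_topology_discrete_topology
    using v w by (simp add: carrier_H continuous_map_pairedI)
  have "continuous_map (discrete_topology ({0..int p - 1} \<times> {0..int p - 1})) ?D (\<lambda>(a, b). (a + b) mod int p)"
    using p_pos by auto
  then have "continuous_map (Galois_topology X x0 R) ?D ((\<lambda>(a, b). (a + b) mod int p) \<circ> (\<lambda>g. (v g, w g)))"
    by (rule continuous_map_compose[OF pair])
  then have "continuous_map (Galois_topology X x0 R) ?D (\<lambda>g\<in>carrier G. (v g + w g) mod int p)"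
    by (rule continuous_map_eq) (simp add: topspace_Galois_topology)
  \<comment> \<open>Commutativity of addition is what makes a sum of homomorphisms a
    homomorphism.\<close>
  moreover have "((a + b) mod int p + (c + d) mod int p) mod int p =
      ((a + c) mod int p + (b + d) mod int p) mod int p" for a b c d
    by (simp only: mod_add_eq) (simp add: ac_simps)
  ultimately show ?thesis
    using v w p_pos by (auto simp: carrier_H H_add)
qed

lemma H_smult_closed:
  assumes v: "v \<in> carrier H"
  shows "c \<odot>\<^bsub>H\<^esub> v \<in> carrier H"
proof -
  interpret G: group G by (rule group_G)
  let ?D = "discrete_topology {0..int p - 1}"
  have "continuous_map (Galois_topology X x0 R) ?D v" using v by (simp add: carrier_H)
  moreover have "continuous_map ?D ?D (\<lambda>a. (c * a) mod int p)" using p_pos by auto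
  ultimately have "continuous_map (Galois_topology X x0 R) ?D ((\<lambda>a. (c * a) mod int p) \<circ> v)"
    by (rule continuous_map_compose)
  then have "continuous_map (Galois_topology X x0 R) ?D (\<lambda>g\<in>carrier G. (c * v g) mod int p)"
    by (rule continuous_map_eq) (simp add: topspace_Galois_topology)
  then show ?thesis
    using v p_pos by (auto simp: carrier_H H_smult mod_simps distrib_left)
qed

text \<open>In an abelian group the value at \<open>h\<close> cancels. The values are reduced
  residues, so congruence modulo \<open>p\<close> is equality.\<close>

lemma H_conj_invariant:
  assumes \<eta>: "\<eta> \<in> carrier H" and x: "x \<in> carrier G" and y: "y \<in> carrier G" and h: "h \<in> carrier G"
    and eq: "x \<otimes>\<^bsub>G\<^esub> h = h \<otimes>\<^bsub>G\<^esub> y"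
  shows "\<eta> x = \<eta> y"
proof -
  have hom: "\<eta> (g \<otimes>\<^bsub>G\<^esub> k) = (\<eta> g + \<eta> k) mod int p" if "g \<in> carrier G" "k \<in> carrier G" for g k
    using \<eta> that by (simp add: carrier_H)
  have "(\<eta> x + \<eta> h) mod int p = (\<eta> y + \<eta> h) mod int p"
    using hom[OF x h] hom[OF h y] eq by (simp add: add.commute)
  then have "\<eta> x mod int p = \<eta> y mod int p"
    using mod_diff_cong[of "\<eta> x + \<eta> h" "int p" "\<eta> y + \<eta> h" "\<eta> h" "\<eta> h"] by simp
  moreover have "\<eta> x \<in> {0..int p - 1}" "\<eta> y \<in> {0..int p - 1}" using \<eta> x y by (simp_all add: carrier_H)
  ultimately show ?thesis by simp
qed

lemma H_beta_closed:
  assumes f: "conjugacy X X f" and \<xi>: "\<xi> \<in> F (f x0)" and \<eta>: "\<eta> \<in> carrier H"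
  shows "compose (carrier G) \<eta> (\<beta> f \<xi>) \<in> carrier H"
proof -
  interpret G: group G by (rule group_G)
  have "continuous_map (Galois_topology X x0 R) (discrete_topology {0..int p - 1}) (\<eta> \<circ> \<beta> f \<xi>)"
    using \<eta> continuous_beta[OF f \<xi>] by (intro continuous_map_compose) (auto simp: carrier_H)
  then have "continuous_map (Galois_topology X x0 R) (discrete_topology {0..int p - 1}) (compose (carrier G) \<eta> (\<beta> f \<xi>))"
    by (rule continuous_map_eq) (simp add: topspace_Galois_topology compose_eq)
  then show ?thesis
    using \<eta> beta_closed[OF f \<xi>] beta_mult[OF f \<xi>] by (simp add: carrier_H compose_eq)
qed

text \<open>The restriction to \<open>X\<close> makes the inverse an extensional map, hence an
  element of \<open>Aut_shift X\<close>.\<close>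

definition inverse_auto :: "((int \<Rightarrow> 'a) \<Rightarrow> (int \<Rightarrow> 'a)) \<Rightarrow> ((int \<Rightarrow> 'a) \<Rightarrow> (int \<Rightarrow> 'a))" where
  "inverse_auto f = (\<lambda>x\<in>X. inv_into X f x)"

lemma conjugacy_inverse_auto: "conjugacy X X f \<Longrightarrow> conjugacy X X (inverse_auto f)"
  unfolding inverse_auto_def by (rule conjugacy_inverse[OF X_shift_space X_shift_space])

lemma inverse_auto_thread:
  assumes "conjugacy X X f"
  shows "\<exists>\<xi>. \<xi> \<in> F (inverse_auto f x0)"
  using limit_fibre_nonempty[OF conjugacy_in[OF conjugacy_inverse_auto[OF assms] x0]] by blast

text \<open>At the base thread \<open>\<beta>\<close> of the identity is trivial, and another thread
  over \<open>x0\<close> changes it by conjugation.\<close>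

lemma beta_id_inner:
  assumes \<zeta>: "\<zeta> \<in> F x0"
  shows "\<exists>h\<in>carrier G. \<forall>g\<in>carrier G. \<beta> (\<lambda>x\<in>X. x) \<zeta> g \<otimes>\<^bsub>G\<^esub> h = h \<otimes>\<^bsub>G\<^esub> g"
proof -
  have "\<zeta> \<in> F ((\<lambda>x\<in>X. x) x0)" "(\<lambda>i\<in>idx. base i) \<in> F ((\<lambda>x\<in>X. x) x0)"
    using \<zeta> base_thread x0 by simp_all
  then show ?thesis
    using beta_inner[OF conjugacy_id[OF X_shift_space], of "\<lambda>i\<in>idx. base i" \<zeta>] beta_id by simp
qed

text \<open>Preceded by \<open>\<beta>\<close> of the inverse automorphism,
  \<open>\<beta> f \<xi>\<close> becomes \<open>\<beta>\<close> of the identity at some thread,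
  which is inner and therefore onto.\<close>

lemma beta_surj:
  assumes f: "conjugacy X X f" and \<xi>: "\<xi> \<in> F (f x0)"
  shows "\<beta> f \<xi> ` carrier G = carrier G"
proof
  interpret G: group G by (rule group_G)
  show "\<beta> f \<xi> ` carrier G \<subseteq> carrier G" using beta_closed[OF f \<xi>] by blast
  show "carrier G \<subseteq> \<beta> f \<xi> ` carrier G"
  proof
    fix k assume k: "k \<in> carrier G"
    note f' = conjugacy_inverse_auto[OF f]
    obtain \<xi>' where \<xi>': "\<xi>' \<in> F (inverse_auto f x0)" using inverse_auto_thread[OF f] by blast
    have id: "compose X f (inverse_auto f) = (\<lambda>x\<in>X. x)"
      using conjugacy_inv_into(2)[OF f] by (auto simp: inverse_auto_def compose_def fun_eq_iff)
    obtain \<zeta> where \<zeta>: "\<zeta> \<in> F x0" "\<forall>g\<in>carrier G. \<beta> f \<xi> (\<beta> (inverse_auto f) \<xi>' g) = \<beta> (\<lambda>x\<in>X. x) \<zeta> g"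
      using beta_compose[OF f' f \<xi>' \<xi>] x0 unfolding id by auto
    obtain h where h: "h \<in> carrier G" "\<forall>g\<in>carrier G. \<beta> (\<lambda>x\<in>X. x) \<zeta> g \<otimes>\<^bsub>G\<^esub> h = h \<otimes>\<^bsub>G\<^esub> g"
      using beta_id_inner[OF \<zeta>(1)] by blast
    \<comment> \<open>Conjugation by \<open>h\<close> sends this element to
      \<open>k\<close>.\<close>
    define g where "g = inv\<^bsub>G\<^esub> h \<otimes>\<^bsub>G\<^esub> (k \<otimes>\<^bsub>G\<^esub> h)"
    have g: "g \<in> carrier G" using h k by (simp add: g_def)
    have "\<beta> f \<xi> (\<beta> (inverse_auto f) \<xi>' g) \<otimes>\<^bsub>G\<^esub> h = k \<otimes>\<^bsub>G\<^esub> h"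
      using \<zeta>(2) h g k by (simp add: g_def G.m_assoc[symmetric])
    then have "\<beta> f \<xi> (\<beta> (inverse_auto f) \<xi>' g) = k"
      using h k g beta_closed[OF f \<xi> beta_closed[OF f' \<xi>' g]] by simp
    then show "k \<in> \<beta> f \<xi> ` carrier G" using beta_closed[OF f' \<xi>' g] by blast
  qed
qed

text \<open>Up to inner automorphisms, \<open>\<beta>\<close> of \<open>f\<^sup>-\<^sup>1\<close> is inverse to \<open>\<beta>\<close> of \<open>f\<close>.\<close>

lemma Upsilon_eq:
  assumes f: "conjugacy X X f" and \<xi>': "\<xi>' \<in> F (inverse_auto f x0)" and \<eta>: "\<eta> \<in> carrier H"
  shows "\<Upsilon> f \<eta> = compose (carrier G) \<eta> (\<beta> (inverse_auto f) \<xi>')"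
proof -
  note f' = conjugacy_inverse_auto[OF f]
  \<comment> \<open>The right-hand side does not mention \<open>\<xi>\<close>: this gives the
    formula and also the uniqueness behind the definite description.\<close>
  have eq: "compose (carrier G) \<eta> (inv_into (carrier G) (\<beta> f \<xi>)) = compose (carrier G) \<eta> (\<beta> (inverse_auto f) \<xi>')"
    if \<xi>: "\<xi> \<in> F (f x0)" for \<xi>
  proof (rule extensionalityI[of _ "carrier G"])
    fix g assume g: "g \<in> carrier G"
    \<comment> \<open>\<open>inv_into\<close> selects a preimage of \<open>g\<close>; every preimage
      is conjugate to \<open>\<beta> (inverse_auto f) \<xi>' g\<close>, so the selection does not
      affect the value of \<open>\<eta>\<close>.\<close>
    define u where "u = inv_into (carrier G) (\<beta> f \<xi>) g"
    have u: "u \<in> carrier G" "\<beta> f \<xi> u = g"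
      using g beta_surj[OF f \<xi>] by (auto simp: u_def inv_into_into f_inv_into_f)
    have id: "compose X (inverse_auto f) f = (\<lambda>x\<in>X. x)"
      using conjugacy_inv_into(1)[OF f] conjugacy_in[OF f] by (auto simp: inverse_auto_def compose_def fun_eq_iff)
    obtain \<zeta> where \<zeta>: "\<zeta> \<in> F x0" "\<forall>g\<in>carrier G. \<beta> (inverse_auto f) \<xi>' (\<beta> f \<xi> g) = \<beta> (\<lambda>x\<in>X. x) \<zeta> g"
      using beta_compose[OF f f' \<xi> \<xi>'] x0 unfolding id by auto
    obtain h where h: "h \<in> carrier G" "\<forall>g\<in>carrier G. \<beta> (\<lambda>x\<in>X. x) \<zeta> g \<otimes>\<^bsub>G\<^esub> h = h \<otimes>\<^bsub>G\<^esub> g"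
      using beta_id_inner[OF \<zeta>(1)] by blast
    have "\<beta> (inverse_auto f) \<xi>' g \<otimes>\<^bsub>G\<^esub> h = h \<otimes>\<^bsub>G\<^esub> u" using \<zeta>(2) h(2) u by auto
    then have "\<eta> (\<beta> (inverse_auto f) \<xi>' g) = \<eta> u"
      by (rule H_conj_invariant[OF \<eta> beta_closed[OF f' \<xi>' g] u(1) h(1)])
    then show "compose (carrier G) \<eta> (inv_into (carrier G) (\<beta> f \<xi>)) g = compose (carrier G) \<eta> (\<beta> (inverse_auto f) \<xi>') g"
      using g by (simp add: compose_eq u_def)
  qed auto
  obtain \<xi> where \<xi>: "\<xi> \<in> F (f x0)" using limit_fibre_nonempty[OF conjugacy_in[OF f x0]] by blast
  have "(THE \<psi>. \<exists>\<xi>\<in>F (f x0). \<psi> = compose (carrier G) \<eta> (inv_into (carrier G) (\<beta> f \<xi>)))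
     = compose (carrier G) \<eta> (\<beta> (inverse_auto f) \<xi>')"
  proof (rule the_equality)
    show "\<exists>\<xi>\<in>F (f x0). compose (carrier G) \<eta> (\<beta> (inverse_auto f) \<xi>') = compose (carrier G) \<eta> (inv_into (carrier G) (\<beta> f \<xi>))"
      using eq[OF \<xi>] \<xi> by (intro bexI[of _ \<xi>]) simp_all
    show "\<psi> = compose (carrier G) \<eta> (\<beta> (inverse_auto f) \<xi>')"
      if "\<exists>\<xi>\<in>F (f x0). \<psi> = compose (carrier G) \<eta> (inv_into (carrier G) (\<beta> f \<xi>))" for \<psi>
      using that eq by auto
  qed
  then show ?thesis using \<eta> by (simp add: Upsilon_def)
qed

section \<open>Upsilon as a linear representation\<close>

lemma Upsilon_closed:
  assumes f: "conjugacy X X f" and \<eta>: "\<eta> \<in> carrier H"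
  shows "\<Upsilon> f \<eta> \<in> carrier H"
proof -
  obtain \<xi>' where \<xi>': "\<xi>' \<in> F (inverse_auto f x0)" using inverse_auto_thread[OF f] by blast
  show ?thesis
    unfolding Upsilon_eq[OF f \<xi>' \<eta>] by (rule H_beta_closed[OF conjugacy_inverse_auto[OF f] \<xi>' \<eta>])
qed

lemma inverse_auto_compose:
  assumes f: "conjugacy X X f" and f': "conjugacy X X f'"
  shows "inverse_auto (compose X f' f) = compose X (inverse_auto f) (inverse_auto f')"
proof (rule extensionalityI[of _ X])
  note ff = conjugacy_compose[OF X_shift_space f f']
  fix x assume x: "x \<in> X"
  let ?y = "inv_into X f (inv_into X f' x)"
  have y: "?y \<in> X" "compose X f' f ?y = x"
    using conjugacy_inv_into(2,3)[OF f' x] conjugacy_inv_into(2,3)[OF f, of "inv_into X f' x"] by (simp_all add: compose_eq)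
  have "inv_into X (compose X f' f) x = ?y"
    using conjugacy_inv_into(1)[OF ff y(1)] y(2) by simp
  then show "inverse_auto (compose X f' f) x = compose X (inverse_auto f) (inverse_auto f') x"
    using x conjugacy_inv_into(3)[OF f' x] by (simp add: inverse_auto_def compose_eq)
qed (auto simp: inverse_auto_def)

text \<open>Two reversals of order cancel: the inverse of \<open>f' \<circ> f\<close> is the inverse
  of \<open>f\<close> after that of \<open>f'\<close>, and precomposition applies the factor next to
  \<open>\<eta>\<close> first. Hence a homomorphism and not an antihomomorphism.\<close>

lemma Upsilon_compose:
  assumes f: "conjugacy X X f" and f': "conjugacy X X f'" and \<eta>: "\<eta> \<in> carrier H"
  shows "\<Upsilon> (compose X f' f) \<eta> = \<Upsilon> f' (\<Upsilon> f \<eta>)"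
proof -
  obtain \<xi> where \<xi>: "\<xi> \<in> F (inverse_auto f x0)" using inverse_auto_thread[OF f] by blast
  obtain \<xi>' where \<xi>': "\<xi>' \<in> F (inverse_auto f' x0)" using inverse_auto_thread[OF f'] by blast
  note i = conjugacy_inverse_auto[OF f] and i' = conjugacy_inverse_auto[OF f']
  obtain \<zeta> where \<zeta>: "\<zeta> \<in> F (inverse_auto (compose X f' f) x0)"
    "\<forall>g\<in>carrier G. \<beta> (inverse_auto f) \<xi> (\<beta> (inverse_auto f') \<xi>' g) = \<beta> (inverse_auto (compose X f' f)) \<zeta> g"
    using beta_compose[OF i' i \<xi>' \<xi>] unfolding inverse_auto_compose[OF f f'] by blast
  have "\<Upsilon> (compose X f' f) \<eta> = compose (carrier G) \<eta> (\<beta> (inverse_auto (compose X f' f)) \<zeta>)"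
    by (rule Upsilon_eq[OF conjugacy_compose[OF X_shift_space f f'] \<zeta>(1) \<eta>])
  also have "\<dots> = compose (carrier G) (compose (carrier G) \<eta> (\<beta> (inverse_auto f) \<xi>)) (\<beta> (inverse_auto f') \<xi>')"
    using \<zeta>(2) beta_closed[OF i' \<xi>'] by (intro extensionalityI[of _ "carrier G"]) (simp_all add: compose_eq)
  also have "\<dots> = compose (carrier G) (\<Upsilon> f \<eta>) (\<beta> (inverse_auto f') \<xi>')"
    by (simp add: Upsilon_eq[OF f \<xi> \<eta>])
  also have "\<dots> = \<Upsilon> f' (\<Upsilon> f \<eta>)"
    by (rule Upsilon_eq[OF f' \<xi>' Upsilon_closed[OF f \<eta>], symmetric])
  finally show ?thesis .
qed

lemma Upsilon_id:
  assumes \<eta>: "\<eta> \<in> carrier H"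
  shows "\<Upsilon> (\<lambda>x\<in>X. x) \<eta> = \<eta>"
proof -
  have id: "inverse_auto (\<lambda>x\<in>X. x) = (\<lambda>x\<in>X. x)"
    using conjugacy_inv_into(1)[OF conjugacy_id[OF X_shift_space]]
    by (intro extensionalityI[of _ X]) (auto simp: inverse_auto_def)
  have \<xi>: "(\<lambda>i\<in>idx. base i) \<in> F (inverse_auto (\<lambda>x\<in>X. x) x0)" using base_thread x0 by (simp add: id)
  have "\<Upsilon> (\<lambda>x\<in>X. x) \<eta> = compose (carrier G) \<eta> (\<beta> (\<lambda>x\<in>X. x) (\<lambda>i\<in>idx. base i))"
    using Upsilon_eq[OF conjugacy_id[OF X_shift_space] \<xi> \<eta>] by (simp add: id)
  also have "\<dots> = \<eta>"
    using \<eta> by (intro extensionalityI[of _ "carrier G"]) (simp_all add: compose_eq beta_id carrier_H)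
  finally show ?thesis .
qed

lemma Upsilon_Bij:
  assumes f: "conjugacy X X f"
  shows "\<Upsilon> f \<in> Bij (carrier H)"
proof -
  note f' = conjugacy_inverse_auto[OF f]
  have id: "compose X (inverse_auto f) f = (\<lambda>x\<in>X. x)" "compose X f (inverse_auto f) = (\<lambda>x\<in>X. x)"
    using conjugacy_inv_into(1,2)[OF f] conjugacy_in[OF f] by (auto simp: inverse_auto_def compose_def fun_eq_iff)
  have "bij_betw (\<Upsilon> f) (carrier H) (carrier H)"
  proof (rule bij_betw_byWitness[where f' = "\<Upsilon> (inverse_auto f)"])
    show "\<forall>\<eta>\<in>carrier H. \<Upsilon> (inverse_auto f) (\<Upsilon> f \<eta>) = \<eta>"
      using Upsilon_compose[OF f f'] Upsilon_id by (simp add: id)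
    show "\<forall>\<eta>\<in>carrier H. \<Upsilon> f (\<Upsilon> (inverse_auto f) \<eta>) = \<eta>"
      using Upsilon_compose[OF f' f] Upsilon_id by (simp add: id)
  qed (use Upsilon_closed[OF f] Upsilon_closed[OF f'] in blast)+
  then show ?thesis by (simp add: Bij_def Upsilon_def)
qed

lemma Upsilon_GL:
  assumes f: "conjugacy X X f"
  shows "\<Upsilon> f \<in> carrier (GL_module (residue_ring (int p)) H)"
proof -
  \<comment> \<open>One thread serves all characters, so that \<open>\<Upsilon> f\<close> is
    precomposition with a fixed map and linearity is read off pointwise.\<close>
  obtain \<xi> where \<xi>: "\<xi> \<in> F (inverse_auto f x0)" using inverse_auto_thread[OF f] by blast
  note \<Upsilon>_eq = Upsilon_eq[OF f \<xi>] and closed = beta_closed[OF conjugacy_inverse_auto[OF f] \<xi>]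
  have "\<Upsilon> f (v \<oplus>\<^bsub>H\<^esub> w) = \<Upsilon> f v \<oplus>\<^bsub>H\<^esub> \<Upsilon> f w" if "v \<in> carrier H" "w \<in> carrier H" for v w
    unfolding \<Upsilon>_eq[OF H_add_closed[OF that]] \<Upsilon>_eq[OF that(1)] \<Upsilon>_eq[OF that(2)]
    unfolding H_add
    using closed by (intro extensionalityI[of _ "carrier G"]) (simp_all add: compose_eq)
  moreover have "\<Upsilon> f (c \<odot>\<^bsub>H\<^esub> v) = c \<odot>\<^bsub>H\<^esub> \<Upsilon> f v" if "v \<in> carrier H" for c v
    unfolding \<Upsilon>_eq[OF H_smult_closed[OF that]] \<Upsilon>_eq[OF that]
    unfolding H_smult
    using closed by (intro extensionalityI[of _ "carrier G"]) (simp_all add: compose_eq)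
  ultimately show ?thesis using Upsilon_Bij[OF f] by (simp add: GL_module_def)
qed

lemma Upsilon_group_hom:
  "group_hom (Aut_shift X) (GL_module (residue_ring (int p)) H) \<Upsilon>"
proof (intro group_hom.intro group_hom_axioms.intro homI)
  show "group (Aut_shift X)" by (rule group_Aut_shift[OF X_shift_space])
  show "group (GL_module (residue_ring (int p)) H)"
    by (rule group_GL_module) (simp_all add: H_add_closed H_smult_closed)
  show "\<Upsilon> f \<in> carrier (GL_module (residue_ring (int p)) H)" if "f \<in> carrier (Aut_shift X)" for f
    using that by (simp add: Upsilon_GL)
  fix f g assume "f \<in> carrier (Aut_shift X)" "g \<in> carrier (Aut_shift X)"
  then have f: "conjugacy X X f" and g: "conjugacy X X g" by simp_all
  have "\<Upsilon> (compose X f g) = compose (carrier H) (\<Upsilon> f) (\<Upsilon> g)"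
    using Upsilon_compose[OF g f]
    by (intro extensionalityI[of _ "carrier H"]) (simp_all add: compose_eq Upsilon_def[abs_def])
  then show "\<Upsilon> (f \<otimes>\<^bsub>Aut_shift X\<^esub> g) = \<Upsilon> f \<otimes>\<^bsub>GL_module (residue_ring (int p)) H\<^esub> \<Upsilon> g"
    using Upsilon_Bij[OF f] Upsilon_Bij[OF g] by (simp add: mult_Aut_shift[OF f g] GL_module_def BijGroup_def)
qed

end

theorem theorem6p4:
  fixes X :: "(int \<Rightarrow> 'a) set" and x0 :: "int \<Rightarrow> 'a" and p :: nat
    and R :: "'a pointed_cover set \<Rightarrow> 'a pointed_cover"
  assumes "irreducible_SFT X" and "x0 \<in> X" and "prime p"
    and "\<forall>i\<in>Galois_classes X x0. R i \<in> i"
  shows "group_hom (Aut_shift X) (GL_module (residue_ring (int p)) (Galois_H1 X x0 R p))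
           (Upsilon X x0 R p)"
proof -
  interpret Galois_tower_mod X x0 R p
    using assms by unfold_locales
  show ?thesis by (rule Upsilon_group_hom)
qed

end
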